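(* There is an absolute constant $C$ such that $g(n,p,q) = \binom{n}{2} - o(n^2)$ (as $n\to\infty$) for every integer $p \geq 4$ and every integer $q$ with $q_{\text{quad}}(p) + C\log p/\log\log p \le q \le \binom{p}{2}$.
   Context: $g(n,p,q)$ denotes the minimum number of colors in a coloring of the edges of the complete graph $K_n$ in which every copy of $K_p$ receives at least $q$ distinct colors. $q_{\text{quad}}(p) := \binom{p}{2} - \lfloor p/2 \rfloor + 2$. Logarithms are natural. *)

theory Defs
  imports Complex_Main "HOL-Library.Ramsey" "HOL-Library.Landau_Symbols"
begin

text \<open>The complete graph on a vertex set \<open>V\<close> has edge set \<open>nsets V 2\<close>; its copies of
  \<open>K\<^sub>p\<close> are the members of \<open>nsets V p\<close>.\<close>

definition pq_coloring :: "nat \<Rightarrow> nat \<Rightarrow> nat \<Rightarrow> (nat set \<Rightarrow> nat) \<Rightarrow> bool" where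
  "pq_coloring n p q c \<longleftrightarrow> (\<forall>S \<in> nsets {..<n} p. q \<le> card (c ` nsets S 2))"

definition g :: "nat \<Rightarrow> nat \<Rightarrow> nat \<Rightarrow> nat" where
  "g n p q = (LEAST k. \<exists>c. pq_coloring n p q c \<and> card (c ` nsets {..<n} 2) = k)"

definition q_quad :: "nat \<Rightarrow> int" where
  "q_quad p = int (p choose 2) - \<lfloor>real p / 2\<rfloor> + 2"

end

theory Submission
  imports Defs "HOL-Probability.Probability"
begin

text \<open>Two disjoint edges of the same colour span a 4-set. Hence a colouring of \<open>K\<^sub>n\<close> with \<open>\<epsilon> n\<^sup>2\<close> colours too few
  yields a 4-uniform hypergraph with a positive multiple of \<open>n\<^sup>2\<close> edges and all degrees at most \<open>n\<close>, unless a large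
  colour class or many monochromatic cherries at one vertex already give a bad \<open>K\<^sub>p\<close>. The task is then of
  Brown-Erdos-Sos type: find at most \<open>p\<close> vertices spanning \<open>p/2 - O(log p / log log p)\<close> hyperedges.

  Configurations with \<open>m\<close> edges on \<open>2 m + k\<close> vertices that occur at least \<open>c n\<^sup>k\<close> times are built by recursion on \<open>k\<close>.
  If unboundedly many copies share suitable \<open>k\<close> vertices, a sunflower among them is the set we look for. Otherwise we
  may thin out the copies so that such \<open>k\<close> vertices determine the copy; regarding \<open>k\<close>-tuples as facets, the simplex
  removal lemma of Frankl and Roedl gives \<open>c' n\<^bsup>k+1\<^esup>\<close> simplices, and the copies on the facets of a simplex glue to a
  configuration with \<open>(k+1) m\<close> edges and excess \<open>k + 1\<close>. As the number of edges grows like \<open>k!\<close>, it exceeds \<open>p\<close> after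
  \<open>O(log p / log log p)\<close> steps, and \<open>k\<close> is what is lost.

  The removal lemma is proved on an ultraproduct with its Loeb measure: there the internal sets depending on the
  coordinates in \<open>e\<close> are independent of all lower order cylinders given those contained in \<open>e\<close>, so the facets can
  be cleaned level by level without loss.\<close>

section \<open>Loeb measures on ultraproducts\<close>

text \<open>What limits the gluing is not the number of simplices but rigidity: vertices of
  different copies in a simplex may coincide, and the glued configuration must again be nearly
  determined by its facets. One condition, \<open>star\<close>, serves both needs: for a marked set
  \<open>X\<close> and a possibly empty fixed set \<open>U\<close>, the vertices of
  \<open>U\<close>, all but two of the marks and one arbitrary further vertex together satisfy
  \<open>hall\<close>. With a mark as the further vertex this governs the facets; with any other
  vertex it shows that coincidences cost a factor n. Every gluing needs a fresh set of marks. Once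
  there are five marks a general recipe produces the next ones; the first levels are settled by
  computation. One of them cannot do without \<open>U\<close> and so gains a factor 3 instead of 4,
  which the constant in \<open>fact k \<le> 3 * card E\<close> absorbs. Finally, a
  \<open>good\<close> set must have just about p vertices while configurations grow in leaps; the
  flexibility conditions let a configuration be cut to size at a loss linear in k.\<close>

lemma free_ultrafilter_exists:
  obtains U :: "nat filter" where "U \<le> sequentially" "U \<noteq> bot"
    "\<And>P. eventually P U \<or> eventually (\<lambda>x. \<not> P x) U"
proof -
  \<comment> \<open>Families all of whose finite subfamilies have infinite intersection. Asking for
    infinite rather than non-empty puts every cofinite set into a maximal family, so the ultrafilter
    is free.\<close>
  define S :: "nat set set set" where
    "S = {F. \<forall>G. finite G \<longrightarrow> G \<subseteq> F \<longrightarrow> infinite (\<Inter>G)}"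
  have "\<exists>F\<in>S. \<forall>X\<in>S. F \<subseteq> X \<longrightarrow> X = F"
  proof (rule subset_Zorn)
    fix C assume C: "subset.chain S C"
    show "\<exists>Y\<in>S. \<forall>X\<in>C. X \<subseteq> Y"
    proof (cases "C = {}")
      case True
      have "{} \<in> S" by (auto simp: S_def)
      with True show ?thesis by blast
    next
      case False
      have "\<Union>C \<in> S"
        unfolding S_def
      proof (intro CollectI allI impI)
        fix G assume G: "finite G" "G \<subseteq> \<Union>C"
        obtain X where "X \<in> C" "G \<subseteq> X"
          using finite_subset_Union_chain[OF G False C] by blast
        moreover have "X \<in> S" using \<open>X \<in> C\<close> C by (auto simp: subset.chain_def)
        ultimately show "infinite (\<Inter>G)" using G(1) by (auto simp: S_def)
      qed
      then show ?thesis by blast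
    qed
  qed
  then obtain F where F: "F \<in> S" and max: "\<And>X. X \<in> S \<Longrightarrow> F \<subseteq> X \<Longrightarrow> X = F" by blast
  have inf: "infinite (\<Inter>G)" if "finite G" "G \<subseteq> F" for G
    using F that by (auto simp: S_def)
  \<comment> \<open>Maximality in usable form: a set meeting every finite intersection of members of
    \<open>F\<close> in an infinite set lies in \<open>F\<close>. All filter properties below are
    instances.\<close>
  have mem: "A \<in> F" if A: "\<And>G. finite G \<Longrightarrow> G \<subseteq> F \<Longrightarrow> infinite (A \<inter> \<Inter>G)" for A
  proof -
    have "insert A F \<in> S" unfolding S_def
    proof (intro CollectI allI impI)
      fix G assume G: "finite G" "G \<subseteq> insert A F"
      have "infinite (A \<inter> \<Inter>(G - {A}))" using G by (intro A) auto
      moreover have "A \<inter> \<Inter>(G - {A}) \<subseteq> \<Inter>G" by auto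
      ultimately show "infinite (\<Inter>G)" using finite_subset by blast
    qed
    then show ?thesis using max by blast
  qed
  have ultra: "A \<in> F \<or> -A \<in> F" for A
  proof (rule ccontr)
    assume *: "\<not> (A \<in> F \<or> -A \<in> F)"
    obtain G where G: "finite G" "G \<subseteq> F" "finite (A \<inter> \<Inter>G)" using mem[of A] * by blast
    obtain H where H: "finite H" "H \<subseteq> F" "finite (-A \<inter> \<Inter>H)" using mem[of "-A"] * by blast
    have "\<Inter>(G \<union> H) \<subseteq> (A \<inter> \<Inter>G) \<union> (-A \<inter> \<Inter>H)" by auto
    then have "finite (\<Inter>(G \<union> H))" using G H finite_subset by blast
    then show False using inf[of "G \<union> H"] G H by auto
  qed
  have sup: "B \<in> F" if "A \<in> F" "A \<subseteq> B" for A B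
  proof (rule mem)
    fix G assume G: "finite G" "G \<subseteq> F"
    have "infinite (\<Inter>(insert A G))" using G that by (intro inf) auto
    moreover have "\<Inter>(insert A G) \<subseteq> B \<inter> \<Inter>G" using that by auto
    ultimately show "infinite (B \<inter> \<Inter>G)" using finite_subset by blast
  qed
  have int: "A \<inter> B \<in> F" if "A \<in> F" "B \<in> F" for A B
  proof (rule mem)
    fix G assume G: "finite G" "G \<subseteq> F"
    have "infinite (\<Inter>(insert A (insert B G)))" using G that by (intro inf) auto
    moreover have "\<Inter>(insert A (insert B G)) = A \<inter> B \<inter> \<Inter>G" by auto
    ultimately show "infinite (A \<inter> B \<inter> \<Inter>G)" by simp
  qed
  have cof: "A \<in> F" if "finite (- A)" for A
  proof (rule mem)
    fix G assume "finite G" "G \<subseteq> F"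
    then have "infinite (\<Inter>G)" by (rule inf)
    moreover have "\<Inter>G \<subseteq> (A \<inter> \<Inter>G) \<union> - A" by auto
    ultimately show "infinite (A \<inter> \<Inter>G)" using that finite_subset by blast
  qed
  have emp: "{} \<notin> F" using inf[of "{{}}"] by auto
  define U where "U = Abs_filter (\<lambda>P. Collect P \<in> F)"
  have isf: "is_filter (\<lambda>P. Collect P \<in> F)"
  proof
    show "Collect (\<lambda>x. True) \<in> F" by (rule cof) simp
    show "Collect (\<lambda>x. P x \<and> Q x) \<in> F" if "Collect P \<in> F" "Collect Q \<in> F" for P Q
      using int[OF that] by (simp add: Collect_conj_eq)
    show "Collect Q \<in> F" if "\<forall>x. P x \<longrightarrow> Q x" "Collect P \<in> F" for P Q
      using sup[OF that(2)] that(1) by blast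
  qed
  have ev: "eventually P U \<longleftrightarrow> Collect P \<in> F" for P
    unfolding U_def by (rule eventually_Abs_filter[OF isf])
  show thesis
  proof
    show "U \<le> sequentially"
    proof (rule filter_leI)
      fix P :: "nat \<Rightarrow> bool" assume "eventually P sequentially"
      then obtain N where N: "\<And>n. n \<ge> N \<Longrightarrow> P n" by (auto simp: eventually_sequentially)
      have "- Collect P \<subseteq> {..<N}" using N not_less by auto
      then show "eventually P U" unfolding ev by (intro cof) (rule finite_subset, auto)
    qed
    show "U \<noteq> bot" using emp ev[of "\<lambda>x. False"] by (auto simp: trivial_limit_def)
    show "eventually P U \<or> eventually (\<lambda>x. \<not> P x) U" for P
      using ultra[of "Collect P"] by (simp add: ev Collect_neg_eq)
  qed
qed

section \<open>Internal sets and countable saturation\<close>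

locale ultraproduct =
  fixes J :: "'i set" and n :: "nat \<Rightarrow> nat" and U :: "nat filter"
  assumes finite_J: "finite J" and n_pos: "\<And>N. n N > 0"
    and U_le: "U \<le> sequentially" and U_nontriv: "U \<noteq> bot"
    and U_ultra: "\<And>P. eventually P U \<or> eventually (\<lambda>x. \<not> P x) U"
begin

definition V :: "nat \<Rightarrow> ('i \<Rightarrow> nat) set" where "V N = PiE J (\<lambda>_. {..<n N})"

definition avg :: "nat \<Rightarrow> (('i \<Rightarrow> nat) \<Rightarrow> real) \<Rightarrow> real" where
  "avg N f = (\<Sum>x\<in>V N. f x) / real (card (V N))"

text \<open>Points are sequences, not classes modulo \<open>U\<close>. An internal set sees a
  sequence only up to \<open>U\<close>-almost equality, so no quotient has to be formed.\<close>

definition Om :: "(nat \<Rightarrow> 'i \<Rightarrow> nat) set" where "Om = {x. \<forall>N. x N \<in> V N}"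

definition IS :: "(nat \<Rightarrow> ('i \<Rightarrow> nat) set) \<Rightarrow> (nat \<Rightarrow> 'i \<Rightarrow> nat) set" where
  "IS A = {x \<in> Om. \<forall>\<^sub>F N in U. x N \<in> A N}"

definition cyl :: "'i set \<Rightarrow> nat \<Rightarrow> ('i \<Rightarrow> nat) set \<Rightarrow> bool" where
  "cyl e N A \<longleftrightarrow> (\<forall>x\<in>V N. \<forall>y\<in>V N. (\<forall>j\<in>e. x j = y j) \<longrightarrow> (x \<in> A \<longleftrightarrow> y \<in> A))"

definition Alg :: "'i set \<Rightarrow> (nat \<Rightarrow> 'i \<Rightarrow> nat) set set" where
  "Alg e = {IS A | A. \<forall>N. cyl e N (A N)}"

lemma finite_V [simp]: "finite (V N)" by (simp add: V_def finite_J finite_PiE)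
lemma V_nonempty [simp]: "V N \<noteq> {}" using n_pos by (auto simp: V_def PiE_eq_empty_iff)
lemma card_V: "card (V N) = n N ^ card J" by (simp add: V_def card_PiE finite_J)
lemma card_V_pos [simp]: "card (V N) > 0" using V_nonempty by (simp add: card_gt_0_iff)

lemma ev_not: "(\<forall>\<^sub>F N in U. \<not> P N) \<longleftrightarrow> \<not> (\<forall>\<^sub>F N in U. P N)"
proof
  assume a: "\<forall>\<^sub>F N in U. \<not> P N"
  show "\<not> (\<forall>\<^sub>F N in U. P N)"
  proof
    assume "\<forall>\<^sub>F N in U. P N"
    with a have "\<forall>\<^sub>F N in U. False" by eventually_elim simp
    then show False using U_nontriv by simp
  qed
qed (use U_ultra in blast)

lemma IS_subset: "IS A \<subseteq> Om" by (auto simp: IS_def)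

lemma IS_Int: "IS A \<inter> IS B = IS (\<lambda>N. A N \<inter> B N)"
  by (auto simp: IS_def eventually_conj_iff)

lemma IS_Compl: "Om - IS A = IS (\<lambda>N. - A N)"
  by (auto simp: IS_def ev_not)

lemma IS_Un: "IS A \<union> IS B = IS (\<lambda>N. A N \<union> B N)"
proof -
  have "IS A \<union> IS B = Om - ((Om - IS A) \<inter> (Om - IS B))" using IS_subset by auto
  also have "\<dots> = IS (\<lambda>N. A N \<union> B N)"
    by (simp only: IS_Compl IS_Int) (simp add: Compl_Int)
  finally show ?thesis .
qed

lemma IS_UNIV: "IS (\<lambda>N. UNIV) = Om" by (auto simp: IS_def)
lemma IS_empty: "IS (\<lambda>N. {}) = {}" using U_nontriv by (auto simp: IS_def)

text \<open>If the inclusion fails, it fails for \<open>U\<close>-almost all \<open>N\<close>, and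
  choosing a witness of the failure in each coordinate gives a point of \<open>IS A\<close> outside
  \<open>IS B\<close>. This is the way back from points to finite sets.\<close>

lemma IS_mono: "IS A \<subseteq> IS B \<longleftrightarrow> (\<forall>\<^sub>F N in U. A N \<inter> V N \<subseteq> B N)"
proof
  assume *: "IS A \<subseteq> IS B"
  show "\<forall>\<^sub>F N in U. A N \<inter> V N \<subseteq> B N"
  proof (rule ccontr)
    assume "\<not> ?thesis"
    then have ev: "\<forall>\<^sub>F N in U. \<not> (A N \<inter> V N \<subseteq> B N)" using ev_not by blast
    have "\<exists>y. y \<in> V N \<and> (\<not> A N \<inter> V N \<subseteq> B N \<longrightarrow> y \<in> A N - B N)" for N
      using V_nonempty[of N] by blast
    then obtain x where x1: "\<And>N. x N \<in> V N"
      and x2: "\<And>N. \<not> A N \<inter> V N \<subseteq> B N \<Longrightarrow> x N \<in> A N - B N" by metis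
    have "x \<in> IS A"
      unfolding IS_def Om_def using x1 eventually_mono[OF ev, of "\<lambda>N. x N \<in> A N"] x2 by auto
    moreover have "\<forall>\<^sub>F N in U. x N \<notin> B N"
      using ev by eventually_elim (use x2 in auto)
    then have "x \<notin> IS B" by (simp add: IS_def ev_not)
    ultimately show False using * by auto
  qed
next
  assume ev: "\<forall>\<^sub>F N in U. A N \<inter> V N \<subseteq> B N"
  show "IS A \<subseteq> IS B"
  proof
    fix x assume x: "x \<in> IS A"
    then have "\<forall>\<^sub>F N in U. x N \<in> A N" "\<And>N. x N \<in> V N" by (auto simp: IS_def Om_def)
    from this(1) ev have "\<forall>\<^sub>F N in U. x N \<in> B N" by eventually_elim (use \<open>\<And>N. x N \<in> V N\<close> in auto)
    then show "x \<in> IS B" using x by (auto simp: IS_def)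
  qed
qed

text \<open>A diagonal choice: in coordinate \<open>N\<close> the point is taken from the longest
  initial intersection, of index at most \<open>N\<close>, that is still non-empty there. For fixed
  \<open>k\<close> this index is at least \<open>k\<close> for \<open>U\<close>-almost all
  \<open>N\<close>, because \<open>U\<close> is free.\<close>

lemma saturation:
  fixes A :: "nat \<Rightarrow> nat \<Rightarrow> ('i \<Rightarrow> nat) set"
  assumes ne: "\<And>k. (\<Inter>i\<le>k. IS (A i)) \<noteq> {}"
  shows "(\<Inter>i. IS (A i)) \<noteq> {}"
proof -
  define B where "B k N = (\<Inter>i\<le>k. A i N) \<inter> V N" for k N
  have B_ne: "\<forall>\<^sub>F N in U. B k N \<noteq> {}" for k
  proof -
    obtain x where x: "x \<in> IS (A i)" if "i \<le> k" for i using ne[of k] by auto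
    have xV: "x N \<in> V N" for N using x[of 0] by (auto simp: IS_def Om_def)
    have "\<forall>\<^sub>F N in U. \<forall>i\<in>{..k}. x N \<in> A i N"
      using x by (intro eventually_ball_finite) (auto simp: IS_def)
    then show ?thesis by eventually_elim (use xV in \<open>auto simp: B_def\<close>)
  qed
  define m where "m N = (GREATEST k. k \<le> N \<and> B k N \<noteq> {})" for N
  define x where "x N = (if \<exists>k\<le>N. B k N \<noteq> {} then (SOME y. y \<in> B (m N) N) else (SOME y. y \<in> V N))" for N
  have m: "B (m N) N \<noteq> {}" "k \<le> m N" if "k \<le> N" "B k N \<noteq> {}" for k N
  proof -
    have "m N \<le> N \<and> B (m N) N \<noteq> {}" unfolding m_def
      by (rule GreatestI_nat[where P="\<lambda>k. k \<le> N \<and> B k N \<noteq> {}" and b=N and k=k]) (use that in auto)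
    then show "B (m N) N \<noteq> {}" by simp
    show "k \<le> m N" unfolding m_def
      by (rule Greatest_le_nat[where P="\<lambda>k. k \<le> N \<and> B k N \<noteq> {}" and b=N]) (use that in auto)
  qed
  have xB: "x N \<in> B (m N) N" if "k \<le> N" "B k N \<noteq> {}" for k N
    using m(1)[OF that] that some_in_eq[of "B (m N) N"] by (auto simp: x_def)
  have xV: "x N \<in> V N" for N
  proof (cases "\<exists>k\<le>N. B k N \<noteq> {}")
    case True then show ?thesis using xB by (auto simp: B_def)
  next
    case False then show ?thesis using some_in_eq[of "V N"] by (auto simp: x_def)
  qed
  have "x \<in> IS (A k)" for k
  proof -
    have "\<forall>\<^sub>F N in U. k \<le> N" using U_le eventually_ge_at_top[of k] by (auto simp: le_filter_def)
    then have "\<forall>\<^sub>F N in U. x N \<in> A k N" using B_ne[of k]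
    proof eventually_elim
      case (elim N)
      have "x N \<in> B (m N) N" "k \<le> m N" using xB[OF elim] m(2)[OF elim] by auto
      then show ?case by (auto simp: B_def)
    qed
    then show ?thesis using xV by (auto simp: IS_def Om_def)
  qed
  then show ?thesis by blast
qed

text \<open>Saturation applied to the differences \<open>T N - A i N\<close>. It will replace a
  countable internal cover by a finite one, which can be read in single coordinates.\<close>

lemma compactness:
  assumes "IS T \<subseteq> (\<Union>i. IS (A i))"
  obtains k :: nat where "IS T \<subseteq> (\<Union>i\<le>k. IS (A i))"
proof -
  have "\<exists>k. (\<Inter>i\<le>k. IS (\<lambda>N. T N - A i N)) = {}"
  proof (rule ccontr)
    assume "\<not> ?thesis"
    then have "(\<Inter>i. IS (\<lambda>N. T N - A i N)) \<noteq> {}" by (intro saturation) auto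
    then obtain x where x: "\<And>i. x \<in> IS (\<lambda>N. T N - A i N)" by auto
    have "x \<in> IS T" "x \<notin> IS (A i)" for i
    proof -
      have "IS (\<lambda>N. T N - A i N) = IS T \<inter> (Om - IS (A i))"
        by (simp only: IS_Compl IS_Int) (simp add: Diff_eq)
      then show "x \<in> IS T" "x \<notin> IS (A i)" using x[of i] by auto
    qed
    then show False using assms by auto
  qed
  then obtain k where k: "(\<Inter>i\<le>k. IS (\<lambda>N. T N - A i N)) = {}" by blast
  have "IS (\<lambda>N. T N - A i N) = IS T - IS (A i)" for i
  proof -
    have "IS (\<lambda>N. T N - A i N) = IS T \<inter> (Om - IS (A i))"
      by (simp only: IS_Compl IS_Int) (simp add: Diff_eq)
    then show ?thesis using IS_subset by auto
  qed
  then have "IS T \<subseteq> (\<Union>i\<le>k. IS (A i))" using k by auto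
  then show thesis by (rule that)
qed

section \<open>Ultralimits and the Loeb measure\<close>

definition ulim :: "(nat \<Rightarrow> real) \<Rightarrow> real" where "ulim f = Lim U f"

lemma ulim:
  assumes "\<And>N. \<bar>f N\<bar> \<le> C"
  shows "(f \<longlongrightarrow> ulim f) U"
proof -
  have "\<exists>l\<in>{-C..C}. inf (nhds l) (filtermap f U) \<noteq> bot"
    using compact_Icc[of "-C" C, unfolded compact_filter, rule_format, of "filtermap f U"]
      U_nontriv assms by (auto simp: filtermap_bot_iff eventually_filtermap abs_le_iff minus_le_iff)
  then obtain l where l: "inf (nhds l) (filtermap f U) \<noteq> bot" by blast
  have "(f \<longlongrightarrow> l) U"
  proof (rule topological_tendstoI)
    fix S assume S: "open S" "l \<in> S"
    show "\<forall>\<^sub>F x in U. f x \<in> S"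
    proof (rule ccontr)
      assume "\<not> ?thesis"
      then have "\<forall>\<^sub>F x in U. f x \<notin> S" using ev_not by blast
      then have "\<forall>\<^sub>F y in filtermap f U. y \<notin> S" by (simp add: eventually_filtermap)
      moreover have "\<forall>\<^sub>F y in nhds l. y \<in> S" using S eventually_nhds by blast
      ultimately have "\<forall>\<^sub>F y in inf (nhds l) (filtermap f U). False"
        unfolding eventually_inf by blast
      then show False using l by simp
    qed
  qed
  then show ?thesis using U_nontriv by (simp add: ulim_def tendsto_Lim)
qed

lemma ulim_unique: "(f \<longlongrightarrow> l) U \<Longrightarrow> ulim f = l"
  using U_nontriv by (simp add: ulim_def tendsto_Lim)

lemma avg_bound:
  assumes "\<And>x. x \<in> V N \<Longrightarrow> \<bar>f x\<bar> \<le> C"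
  shows "\<bar>avg N f\<bar> \<le> C"
proof -
  have "\<bar>\<Sum>x\<in>V N. f x\<bar> \<le> (\<Sum>x\<in>V N. C)" using assms by (intro sum_abs[THEN order_trans] sum_mono) auto
  then show ?thesis by (simp add: avg_def abs_divide field_simps)
qed

lemma avg_add: "avg N (\<lambda>x. f x + h x) = avg N f + avg N h"
  by (simp add: avg_def sum.distrib add_divide_distrib)
lemma avg_cmult: "avg N (\<lambda>x. c * f x) = c * avg N f"
  by (simp add: avg_def sum_distrib_left[symmetric])

lemma avg_indicator: "avg N (indicator A) = real (card (A \<inter> V N)) / real (card (V N))"
proof -
  have "(\<Sum>x\<in>V N. indicator A x :: real) = real (card (A \<inter> V N))"
    by (simp add: indicator_def sum.If_cases Int_commute)
  then show ?thesis by (simp add: avg_def)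
qed

lemma avg_ind_bounds: "0 \<le> avg N (indicator A)" "avg N (indicator A) \<le> 1"
proof -
  have "card (A \<inter> V N) \<le> card (V N)" by (intro card_mono) auto
  then show "0 \<le> avg N (indicator A)" "avg N (indicator A) \<le> 1" by (auto simp: avg_indicator)
qed

definition mu :: "(nat \<Rightarrow> ('i \<Rightarrow> nat) set) \<Rightarrow> real" where
  "mu A = ulim (\<lambda>N. avg N (indicator (A N)))"

lemma mu_lim: "((\<lambda>N. avg N (indicator (A N))) \<longlongrightarrow> mu A) U"
  unfolding mu_def using avg_ind_bounds by (intro ulim[where C=1]) (auto simp: abs_le_iff intro: order_trans[of _ 0])

lemma mu_cong: "IS A = IS B \<Longrightarrow> mu A = mu B"
proof -
  assume "IS A = IS B"
  then have "\<forall>\<^sub>F N in U. A N \<inter> V N \<subseteq> B N" "\<forall>\<^sub>F N in U. B N \<inter> V N \<subseteq> A N"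
    using IS_mono by blast+
  then have "\<forall>\<^sub>F N in U. avg N (indicator (A N)) = avg N (indicator (B N))"
  proof eventually_elim
    case (elim N)
    then have "A N \<inter> V N = B N \<inter> V N" by auto
    then show ?case by (simp add: avg_indicator)
  qed
  then have "((\<lambda>N. avg N (indicator (B N))) \<longlongrightarrow> mu A) U"
    using mu_lim[of A] tendsto_cong by fast
  then show ?thesis by (simp add: mu_def[of B] ulim_unique)
qed

lemma mu_nonneg: "0 \<le> mu A"
  using avg_ind_bounds U_nontriv by (intro tendsto_lowerbound[OF mu_lim]) auto

lemma Alg_algebra: "algebra Om (Alg e)"
  unfolding algebra_iff_Un
proof (intro conjI ballI)
  show "Alg e \<subseteq> Pow Om" using IS_subset by (auto simp: Alg_def)
  show "{} \<in> Alg e" unfolding Alg_def using IS_empty by (auto simp: cyl_def intro!: exI[of _ "\<lambda>N. {}"])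
  fix a assume a: "a \<in> Alg e"
  then obtain A where A: "a = IS A" "\<And>N. cyl e N (A N)" by (auto simp: Alg_def)
  show "Om - a \<in> Alg e"
    unfolding A(1) IS_Compl using A(2) by (auto simp: Alg_def cyl_def intro!: exI[of _ "\<lambda>N. - A N"])
  fix b assume b: "b \<in> Alg e"
  then obtain B where B: "b = IS B" "\<And>N. cyl e N (B N)" by (auto simp: Alg_def)
  show "a \<union> b \<in> Alg e"
    unfolding A(1) B(1) IS_Un using A(2) B(2) unfolding Alg_def cyl_def
    by (intro CollectI exI[of _ "\<lambda>N. A N \<union> B N"]) blast
qed

lemma Alg_mono: "e \<subseteq> e' \<Longrightarrow> Alg e \<subseteq> Alg e'"
  unfolding Alg_def cyl_def by blast

lemma IS_in_Alg_J: "IS A \<in> Alg J"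
proof -
  have "cyl J N (A N)" for N
  proof -
    have "x = y" if "x \<in> V N" "y \<in> V N" "\<forall>j\<in>J. x j = y j" for x y
      using that by (auto simp: V_def intro: PiE_ext)
    then show ?thesis unfolding cyl_def by blast
  qed
  then show ?thesis by (auto simp: Alg_def)
qed

text \<open>Countable additivity comes for free: by saturation a decreasing sequence of internal
  sets with empty intersection is empty from some index on, so continuity at the empty set, the
  hypothesis of Caratheodory's theorem, is immediate.\<close>

lemma ex_loeb_measure:
  "\<exists>M. space M = Om \<and> sets M = sigma_sets Om (Alg J) \<and> prob_space M \<and> (\<forall>A. measure M (IS A) = mu A)"
proof -
  interpret algebra Om "Alg J" by (rule Alg_algebra)
  \<comment> \<open>Defined through an arbitrary representing sequence; by \<open>mu_cong\<close>
    the choice does not matter.\<close>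
  define f :: "(nat \<Rightarrow> 'i \<Rightarrow> nat) set \<Rightarrow> ennreal" where "f a = ennreal (mu (SOME A. a = IS A))" for a
  have fI: "f (IS A) = ennreal (mu A)" for A
  proof -
    have "IS A = IS (SOME B. IS A = IS B)" by (rule someI[of _ A]) simp
    then show ?thesis unfolding f_def using mu_cong by metis
  qed
  have "\<exists>\<mu> :: _ \<Rightarrow> ennreal. (\<forall>s \<in> Alg J. \<mu> s = f s) \<and> measure_space Om (sigma_sets Om (Alg J)) \<mu>"
  proof (rule caratheodory_empty_continuous)
    have "mu (\<lambda>N. {}) = 0" unfolding mu_def by (rule ulim_unique) (simp add: avg_def)
    then show "positive (Alg J) f" using fI[of "\<lambda>N. {}"] by (simp add: positive_def IS_empty)
    show "additive (Alg J) f"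
      unfolding additive_def
    proof (intro ballI impI)
      fix a b assume ab: "a \<in> Alg J" "b \<in> Alg J" "a \<inter> b = {}"
      obtain A B where AB: "a = IS A" "b = IS B" using ab by (auto simp: Alg_def)
      have "IS (\<lambda>N. A N \<inter> B N) \<subseteq> IS (\<lambda>N. {})" using ab(3) AB IS_Int by auto
      then have ev: "\<forall>\<^sub>F N in U. A N \<inter> B N \<inter> V N \<subseteq> {}" unfolding IS_mono .
      have "((\<lambda>N. avg N (indicator (A N \<union> B N))) \<longlongrightarrow> mu A + mu B) U"
      proof (rule Lim_transform_eventually)
        show "((\<lambda>N. avg N (indicator (A N)) + avg N (indicator (B N))) \<longlongrightarrow> mu A + mu B) U"
          by (intro tendsto_add mu_lim)
        show "\<forall>\<^sub>F N in U. avg N (indicator (A N)) + avg N (indicator (B N)) = avg N (indicator (A N \<union> B N))"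
          using ev
        proof eventually_elim
          case (elim N)
          have "card ((A N \<union> B N) \<inter> V N) = card (A N \<inter> V N) + card (B N \<inter> V N)"
            unfolding Int_Un_distrib2 by (intro card_Un_disjoint) (use elim in auto)
          then show ?case by (simp add: avg_indicator add_divide_distrib)
        qed
      qed
      then have "mu (\<lambda>N. A N \<union> B N) = mu A + mu B" unfolding mu_def[of "\<lambda>N. A N \<union> B N"] by (rule ulim_unique)
      then show "f (a \<union> b) = f a + f b" by (simp add: AB IS_Un fI mu_nonneg)
    qed
    show "f a \<noteq> \<infinity>" if "a \<in> Alg J" for a by (simp add: f_def)
    fix S :: "nat \<Rightarrow> (nat \<Rightarrow> 'i \<Rightarrow> nat) set"
    assume S: "range S \<subseteq> Alg J" "decseq S" "(\<Inter>i. S i) = {}"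
    have "\<forall>i. \<exists>A. S i = IS A" using S(1) unfolding Alg_def by blast
    then obtain A where A: "\<And>i. S i = IS (A i)" by metis
    have "\<exists>k. (\<Inter>i\<le>k. IS (A i)) = {}" using saturation[of A] S(3) A by auto
    then obtain k where "(\<Inter>i\<le>k. S i) = {}" using A by auto
    moreover have "S k \<subseteq> (\<Inter>i\<le>k. S i)" using S(2) by (auto simp: decseq_def)
    ultimately have k: "S k = {}" by auto
    have "S i = {}" if "i \<ge> k" for i using S(2) that k by (auto simp: decseq_def)
    then have "\<forall>\<^sub>F i in sequentially. f (S i) = 0"
      using \<open>positive (Alg J) f\<close> by (auto simp: eventually_sequentially positive_def intro!: exI[of _ k])
    then show "(\<lambda>i. f (S i)) \<longlonglongrightarrow> 0" by (rule tendsto_eventually)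
  qed
  then obtain \<mu> where \<mu>: "\<forall>s \<in> Alg J. \<mu> s = f s" "measure_space Om (sigma_sets Om (Alg J)) \<mu>" by blast
  define M where "M = measure_of Om (Alg J) \<mu>"
  have sp: "space M = Om" and st: "sets M = sigma_sets Om (Alg J)"
    using space_closed by (auto simp: M_def)
  have em: "emeasure M (IS A) = ennreal (mu A)" for A
  proof -
    have "emeasure M (IS A) = \<mu> (IS A)"
    proof (rule emeasure_measure_of[OF M_def])
      show "Alg J \<subseteq> Pow Om" by (rule space_closed)
      show "IS A \<in> sets M" using IS_in_Alg_J by (auto simp: st)
      show "positive (sets M) \<mu>" "countably_additive (sets M) \<mu>"
        using \<mu>(2) by (auto simp: st measure_space_def)
    qed
    then show ?thesis using \<mu>(1) IS_in_Alg_J fI by simp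
  qed
  have "mu (\<lambda>N. UNIV) = 1" unfolding mu_def by (rule ulim_unique) (simp add: avg_def)
  then have "emeasure M (space M) = 1" using em[of "\<lambda>N. UNIV"] by (simp add: IS_UNIV sp)
  then have "prob_space M" by (rule prob_spaceI)
  then show ?thesis using sp st em mu_nonneg by (intro exI[of _ M]) (auto simp: measure_def)
qed

end

section \<open>Conditional independence of cylinder algebras\<close>

text \<open>The sets that can be approximated in measure from the algebra form a sigma-algebra: a
  countable union is truncated, and its finitely many remaining pieces are approximated.\<close>

lemma algebra_approx:
  assumes "finite_measure M" and alg: "algebra (space M) A" and sub: "sigma_sets (space M) A \<subseteq> sets M"
    and C: "C \<in> sigma_sets (space M) A" and "\<epsilon> > 0"
  shows "\<exists>B\<in>A. measure M ((C - B) \<union> (B - C)) < \<epsilon>"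
  using C \<open>\<epsilon> > 0\<close>
proof (induction arbitrary: \<epsilon> rule: sigma_sets.induct)
  case (Basic a) then show ?case by (intro bexI[of _ a]) auto
next
  case Empty
  interpret algebra "space M" A by (rule alg)
  show ?case using Empty by (intro bexI[of _ "{}"]) auto
next
  case (Compl a)
  interpret algebra "space M" A by (rule alg)
  obtain B where B: "B \<in> A" "measure M ((a - B) \<union> (B - a)) < \<epsilon>" using Compl by blast
  have "a \<subseteq> space M" using sigma_sets_into_sp[OF space_closed Compl(1)] .
  moreover have "B \<subseteq> space M" using B(1) sets_into_space by blast
  ultimately have "((space M - a) - (space M - B)) \<union> ((space M - B) - (space M - a)) = (a - B) \<union> (B - a)" by auto
  then show ?case using B by (intro bexI[of _ "space M - B"]) auto
next
  case (Union a)
  interpret algebra "space M" A by (rule alg)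
  interpret finite_measure M by fact
  have meas: "a i \<in> sets M" for i using Union(1) sub by auto
  define S where "S k = (\<Union>i<k. a i)" for k :: nat
  have S_meas: "S k \<in> sets M" for k using meas by (auto simp: S_def)
  have incS: "incseq S" unfolding incseq_def S_def by (intro allI impI UN_mono) auto
  have "(\<lambda>k. measure M (S k)) \<longlonglongrightarrow> measure M (\<Union>k. S k)"
    using S_meas incS by (intro finite_Lim_measure_incseq) auto
  moreover have "(\<Union>k. S k) = (\<Union>i. a i)" by (auto simp: S_def)
  ultimately have lim: "(\<lambda>k. measure M (S k)) \<longlonglongrightarrow> measure M (\<Union>i. a i)" by simp
  have "\<forall>\<^sub>F k in sequentially. dist (measure M (S k)) (measure M (\<Union>i. a i)) < \<epsilon> / 2"
    by (rule tendstoD[OF lim]) (use Union(3) in simp)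
  then obtain k where k: "\<bar>measure M (S k) - measure M (\<Union>i. a i)\<bar> < \<epsilon> / 2"
    unfolding eventually_sequentially dist_real_def by blast
  have S_le: "S k \<subseteq> (\<Union>i. a i)" by (auto simp: S_def)
  have eq: "measure M ((\<Union>i. a i) - S k) = measure M (\<Union>i. a i) - measure M (S k)"
    by (rule finite_measure_Diff[OF _ S_meas S_le]) (use meas in auto)
  have diff: "measure M ((\<Union>i. a i) - S k) < \<epsilon> / 2" using k unfolding eq by linarith
  have "\<exists>B\<in>A. measure M ((a i - B) \<union> (B - a i)) < \<epsilon> / (2 * (real k + 1))" for i
    by (rule Union(2)) (use Union(3) in simp)
  then obtain B where B: "\<And>i. B i \<in> A" "\<And>i. measure M ((a i - B i) \<union> (B i - a i)) < \<epsilon> / (2 * (real k + 1))" by metis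
  have Bm: "B i \<in> sets M" for i using B(1) sub by auto
  let ?B = "\<Union>i<k. B i"
  have "measure M (((\<Union>i. a i) - ?B) \<union> (?B - (\<Union>i. a i)))
     \<le> measure M (((\<Union>i. a i) - S k) \<union> (\<Union>i<k. ((a i - B i) \<union> (B i - a i))))"
    using meas Bm S_meas by (intro finite_measure_mono) (auto simp: S_def)
  also have "\<dots> \<le> measure M ((\<Union>i. a i) - S k) + measure M (\<Union>i<k. ((a i - B i) \<union> (B i - a i)))"
    using meas Bm S_meas by (intro measure_Un_le) auto
  also have "measure M (\<Union>i<k. ((a i - B i) \<union> (B i - a i))) \<le> (\<Sum>i<k. measure M ((a i - B i) \<union> (B i - a i)))"
    using meas Bm by (intro measure_UNION_le) auto
  also have "\<dots> \<le> (\<Sum>i<k. \<epsilon> / (2 * (real k + 1)))" using B(2) by (intro sum_mono less_imp_le) auto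
  also have "\<dots> \<le> \<epsilon> / 2" using Union(3) by (simp add: field_simps)
  finally have "measure M (((\<Union>i. a i) - ?B) \<union> (?B - (\<Union>i. a i))) < \<epsilon>" using diff by simp
  moreover have "?B \<in> A" using B(1) by auto
  ultimately show ?case by blast
qed

text \<open>Outer regularity by itself does not pass to complements. The induction therefore proves
  a symmetric statement: \<open>C\<close> and its complement lie in countable unions
  \<open>G\<close> and \<open>H\<close> of algebra sets whose intersection has measure at most
  \<epsilon>.\<close>

lemma algebra_outer_cover:
  assumes "finite_measure M" and alg: "algebra (space M) A" and sub: "sigma_sets (space M) A \<subseteq> sets M"
    and C: "C \<in> sigma_sets (space M) A" and "\<epsilon> > 0"
  shows "\<exists>B::nat \<Rightarrow> _. range B \<subseteq> A \<and> C \<subseteq> (\<Union>i. B i) \<and> measure M (\<Union>i. B i) \<le> measure M C + \<epsilon>"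
proof -
  interpret algebra "space M" A by (rule alg)
  interpret finite_measure M by fact
  define Op where "Op = {G. \<exists>B. range B \<subseteq> A \<and> G = (\<Union>i::nat. B i)}"
  have OpD: "\<exists>B. range B \<subseteq> A \<and> G = (\<Union>i::nat. B i)" if "G \<in> Op" for G using that by (simp add: Op_def)
  have Op_A: "a \<in> Op" if "a \<in> A" for a using that unfolding Op_def by (intro CollectI exI[of _ "\<lambda>_. a"]) auto
  have Op_UN: "(\<Union>i::nat. G i) \<in> Op" if "\<And>i. G i \<in> Op" for G
  proof -
    have "\<forall>i. \<exists>B. range B \<subseteq> A \<and> G i = (\<Union>j::nat. B j)" using OpD[OF that] by blast
    then obtain B where B: "\<And>i. range (B i) \<subseteq> A" "\<And>i. G i = (\<Union>j::nat. B i j)" by metis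
    define D where "D m = B (fst (prod_decode m)) (snd (prod_decode m))" for m
    have "(\<Union>m. D m) = (\<Union>i. G i)"
    proof -
      have "x \<in> (\<Union>m. D m)" if "x \<in> B i j" for x i j
        using that by (intro UN_I[of "prod_encode (i, j)"]) (auto simp: D_def)
      then show ?thesis by (auto simp: B(2) D_def)
    qed
    moreover have "range D \<subseteq> A" using B(1) by (auto simp: D_def)
    ultimately show ?thesis unfolding Op_def by blast
  qed
  have Op_Int: "G \<inter> H \<in> Op" if GO: "G \<in> Op" and HO: "H \<in> Op" for G H
  proof -
    obtain B where B: "range B \<subseteq> A" "G = (\<Union>j::nat. B j)" using OpD[OF GO] by (elim exE conjE)
    obtain D where D: "range D \<subseteq> A" "H = (\<Union>j::nat. D j)" using OpD[OF HO] by (elim exE conjE)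
    note BD = B D
    have BA: "B i \<in> A" "D i \<in> A" for i using B(1) D(1) by auto
    have "(\<Union>j. B i \<inter> D j) \<in> Op" for i by (intro Op_UN Op_A Int BA)
    then have "(\<Union>i. \<Union>j. B i \<inter> D j) \<in> Op" by (rule Op_UN)
    moreover have "(\<Union>i. \<Union>j. B i \<inter> D j) = G \<inter> H" using BD by auto
    ultimately show ?thesis by simp
  qed
  have Op_meas: "G \<in> sets M" if GO: "G \<in> Op" for G
  proof -
    obtain B where B: "range B \<subseteq> A" "G = (\<Union>j::nat. B j)" using OpD[OF GO] by (elim exE conjE)
    have "B i \<in> sets M" for i using B(1) sub by auto
    then show ?thesis unfolding B(2) by (intro sets.countable_UN) auto
  qed
  have "\<exists>G\<in>Op. \<exists>H\<in>Op. C \<subseteq> G \<and> space M - C \<subseteq> H \<and> measure M (G \<inter> H) \<le> \<epsilon>"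
    using C \<open>\<epsilon> > 0\<close>
  proof (induction arbitrary: \<epsilon> rule: sigma_sets.induct)
    case (Basic a)
    then show ?case by (intro bexI[of _ a] bexI[of _ "space M - a"]) (auto intro!: Op_A)
  next
    case Empty
    then show ?case by (intro bexI[of _ "{}"] bexI[of _ "space M"]) (auto intro!: Op_A)
  next
    case (Compl a)
    then obtain G H where GH: "G \<in> Op" "H \<in> Op" "a \<subseteq> G" "space M - a \<subseteq> H" "measure M (G \<inter> H) \<le> \<epsilon>" by meson
    show ?case using GH by (intro bexI[of _ H] bexI[of _ G]) (auto simp: Int_commute)
  next
    case (Union a)
    have "\<exists>G H. G \<in> Op \<and> H \<in> Op \<and> a i \<subseteq> G \<and> space M - a i \<subseteq> H \<and> measure M (G \<inter> H) \<le> \<epsilon> / 2 * (1/2)^Suc i" for i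
    proof -
      have "\<exists>G\<in>Op. \<exists>H\<in>Op. a i \<subseteq> G \<and> space M - a i \<subseteq> H \<and> measure M (G \<inter> H) \<le> \<epsilon> / 2 * (1/2)^Suc i"
        by (rule Union(2)) (use Union(3) in simp)
      then show ?thesis by blast
    qed
    then obtain G H where GH: "\<And>i. G i \<in> Op" "\<And>i. H i \<in> Op" "\<And>i. a i \<subseteq> G i"
      "\<And>i. space M - a i \<subseteq> H i" "\<And>i. measure M (G i \<inter> H i) \<le> \<epsilon> / 2 * (1/2)^Suc i" by metis
    define S where "S k = (\<Union>i<k. G i)" for k :: nat
    have Gm: "G i \<in> sets M" "H i \<in> sets M" for i using GH Op_meas by auto
    then have S_meas: "S k \<in> sets M" for k by (auto simp: S_def)
    have incS: "incseq S" unfolding incseq_def S_def by (intro allI impI UN_mono) auto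
    have "(\<lambda>k. measure M (S k)) \<longlonglongrightarrow> measure M (\<Union>k. S k)"
      using S_meas incS by (intro finite_Lim_measure_incseq) auto
    moreover have "(\<Union>k. S k) = (\<Union>i. G i)" by (auto simp: S_def)
    ultimately have lim: "(\<lambda>k. measure M (S k)) \<longlonglongrightarrow> measure M (\<Union>i. G i)" by simp
    have "\<forall>\<^sub>F k in sequentially. dist (measure M (S k)) (measure M (\<Union>i. G i)) < \<epsilon> / 2"
      by (rule tendstoD[OF lim]) (use Union(3) in simp)
    then obtain k where k: "\<bar>measure M (S k) - measure M (\<Union>i. G i)\<bar> < \<epsilon> / 2"
      unfolding eventually_sequentially dist_real_def by blast
    have S_le: "S k \<subseteq> (\<Union>i. G i)" by (auto simp: S_def)
    have eq: "measure M ((\<Union>i. G i) - S k) = measure M (\<Union>i. G i) - measure M (S k)"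
      by (rule finite_measure_Diff[OF _ S_meas S_le]) (use Gm in auto)
    have diff: "measure M ((\<Union>i. G i) - S k) < \<epsilon> / 2" using k unfolding eq by linarith
    \<comment> \<open>The complement of the union lies in the intersection of all
      \<open>H i\<close>, but \<open>Op\<close> is closed only under finite intersections. The first
      \<open>k\<close> sets suffice, because what \<open>\<Union>i. G i\<close> has beyond
      \<open>S k\<close> measures less than \<open>\<epsilon> / 2\<close>.\<close>
    define H' where "H' = space M \<inter> (\<Inter>i<k. H i)"
    have H'Op: "H' \<in> Op" unfolding H'_def
    proof (induction k)
      case 0 then show ?case by (auto intro!: Op_A)
    next
      case (Suc k)
      have "space M \<inter> (\<Inter>i<Suc k. H i) = (space M \<inter> (\<Inter>i<k. H i)) \<inter> H k" by (auto simp: lessThan_Suc)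
      then show ?case using Op_Int[OF Suc GH(2)[of k]] by simp
    qed
    have "measure M ((\<Union>i. G i) \<inter> H') \<le> measure M (((\<Union>i. G i) - S k) \<union> (\<Union>i<k. (G i \<inter> H i)))"
      using Gm S_meas by (intro finite_measure_mono) (auto simp: S_def H'_def)
    also have "\<dots> \<le> measure M ((\<Union>i. G i) - S k) + measure M (\<Union>i<k. (G i \<inter> H i))"
      using Gm S_meas by (intro measure_Un_le) auto
    also have "measure M (\<Union>i<k. (G i \<inter> H i)) \<le> (\<Sum>i<k. measure M (G i \<inter> H i))"
      using Gm by (intro measure_UNION_le) auto
    also have "\<dots> \<le> (\<Sum>i<k. \<epsilon> / 2 * (1/2)^Suc i)" using GH by (intro sum_mono) auto
    also have "\<dots> = \<epsilon> / 2 * (\<Sum>i<k. (1/2)^Suc i)" by (simp add: sum_distrib_left)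
    also have "(\<Sum>i<k. (1/2::real)^Suc i) \<le> 1"
    proof -
      have "(\<Sum>i<k. (1/2::real)^Suc i) = 1 - (1/2)^k" by (induction k) (auto simp: field_simps)
      then show ?thesis by simp
    qed
    finally have "measure M ((\<Union>i. G i) \<inter> H') \<le> \<epsilon>" using diff Union(3) by (simp add: field_simps)
    moreover have "(\<Union>i. G i) \<in> Op" using GH by (intro Op_UN)
    moreover have "(\<Union>i. a i) \<subseteq> (\<Union>i. G i)" using GH by blast
    moreover have "space M - (\<Union>i. a i) \<subseteq> H'" using GH(4) by (auto simp: H'_def)
    ultimately show ?case using H'Op by blast
  qed
  then obtain G H where GH: "G \<in> Op" "H \<in> Op" "C \<subseteq> G" "space M - C \<subseteq> H" "measure M (G \<inter> H) \<le> \<epsilon>" by blast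
  have Cm: "C \<in> sets M" using C sub by auto
  have Gm: "G \<in> sets M" "H \<in> sets M" using GH Op_meas by auto
  have "G \<subseteq> space M" using Gm sets.sets_into_space by blast
  then have "measure M G \<le> measure M (C \<union> (G \<inter> H))"
    using Gm Cm GH by (intro finite_measure_mono) auto
  also have "\<dots> \<le> measure M C + measure M (G \<inter> H)" using Gm Cm by (intro measure_Un_le) auto
  finally have "measure M G \<le> measure M C + \<epsilon>" using GH by simp
  then show ?thesis using OpD[OF GH(1)] GH(3) by auto
qed

section \<open>Sigma-algebras of coordinate sets and approximation by internal functions\<close>

locale loeb = ultraproduct +
  fixes M :: "(nat \<Rightarrow> 'a \<Rightarrow> nat) measure"
  assumes space_M: "space M = Om" and sets_M: "sets M = sigma_sets Om (Alg J)"
    and prob_M: "prob_space M" and measure_IS: "measure M (IS A) = mu A"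
begin

sublocale prob_space M by (rule prob_M)

text \<open>A family of coordinate sets generates in general less than its union does. This gap
  between \<open>Sg (Lo d e)\<close> and \<open>Sg {e}\<close> is what separates the levels of a
  hypergraph.\<close>

definition Sg :: "'a set set \<Rightarrow> (nat \<Rightarrow> 'a \<Rightarrow> nat) measure" where
  "Sg G = sigma Om (\<Union>\<gamma>\<in>G. Alg \<gamma>)"

lemma cyl_UNIV [simp]: "cyl e N UNIV" by (simp add: cyl_def)

lemma Alg_Pow: "Alg e \<subseteq> Pow Om" using IS_subset by (auto simp: Alg_def)

lemma space_Sg [simp]: "space (Sg G) = Om" unfolding Sg_def by (rule space_measure_of) (use Alg_Pow in blast)
lemma sets_Sg: "sets (Sg G) = sigma_sets Om (\<Union>\<gamma>\<in>G. Alg \<gamma>)" unfolding Sg_def by (rule sets_measure_of) (use Alg_Pow in blast)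
lemma sets_Sg1: "sets (Sg {e}) = sigma_sets Om (Alg e)" by (simp add: sets_Sg)

lemma Alg_sub_J: "Alg e \<subseteq> Alg J" using IS_in_Alg_J by (auto simp: Alg_def)

lemma Sg_sub_M: "sets (Sg G) \<subseteq> sets M"
  unfolding sets_Sg sets_M using Alg_sub_J by (intro sigma_sets_subseteq) auto

lemma subalg: "subalgebra M (Sg G)"
  using Sg_sub_M by (simp add: subalgebra_def space_M)

lemma Sg_mono: assumes "\<And>\<gamma>. \<gamma> \<in> G \<Longrightarrow> \<exists>\<gamma>'\<in>G'. \<gamma> \<subseteq> \<gamma>'" shows "sets (Sg G) \<subseteq> sets (Sg G')"
  unfolding sets_Sg
proof (rule sigma_sets_subseteq, rule subsetI)
  fix a assume "a \<in> (\<Union>\<gamma>\<in>G. Alg \<gamma>)"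
  then obtain \<gamma> where \<gamma>: "\<gamma> \<in> G" "a \<in> Alg \<gamma>" by blast
  obtain \<gamma>' where \<gamma>': "\<gamma>' \<in> G'" "\<gamma> \<subseteq> \<gamma>'" using assms[OF \<gamma>(1)] by blast
  have "a \<in> Alg \<gamma>'" using Alg_mono[OF \<gamma>'(2)] \<gamma>(2) by blast
  then show "a \<in> (\<Union>\<gamma>\<in>G'. Alg \<gamma>)" using \<gamma>'(1) by blast
qed

lemma fms: "finite_measure_subalgebra M (Sg G)"
  by (intro finite_measure_subalgebra.intro finite_measure_subalgebra_axioms.intro finite_measure_axioms subalg)

lemma IS_meas [measurable]: "IS A \<in> sets M" using IS_in_Alg_J by (auto simp: sets_M)

text \<open>A weak form of lifting to an internal function of the coordinates in \<open>e\<close>.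
  The error is tested against all internal sets \<open>D\<close> uniformly; this is all that the
  orthogonality argument needs, and it survives sums, multiples and limits in mean.\<close>

definition approximable :: "'a set \<Rightarrow> ((nat \<Rightarrow> 'a \<Rightarrow> nat) \<Rightarrow> real) \<Rightarrow> bool" where
  "approximable e u \<longleftrightarrow> (\<forall>\<epsilon>>0. \<exists>w C. (\<forall>N x. \<bar>w N x\<bar> \<le> C) \<and>
     (\<forall>N. \<forall>x\<in>V N. \<forall>y\<in>V N. (\<forall>j\<in>e. x j = y j) \<longrightarrow> w N x = w N y) \<and>
     (\<forall>D. \<bar>(LINT x:IS D|M. u x) - ulim (\<lambda>N. avg N (\<lambda>x. indicator (D N) x * w N x))\<bar> \<le> \<epsilon>))"

lemma ulim_avg:
  assumes "\<And>N x. \<bar>w N x\<bar> \<le> C"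
  shows "((\<lambda>N. avg N (\<lambda>x. indicator (D N) x * w N x)) \<longlongrightarrow> ulim (\<lambda>N. avg N (\<lambda>x. indicator (D N) x * w N x))) U"
proof (rule ulim)
  fix N
  have "0 \<le> C" using assms[of N undefined] by linarith
  then show "\<bar>avg N (\<lambda>x. indicator (D N) x * w N x)\<bar> \<le> C"
    using assms by (intro avg_bound) (auto simp: indicator_def)
qed

lemma approximable_indicator:
  assumes C: "C \<in> sets (Sg {e})" shows "approximable e (indicator C)"
  unfolding approximable_def
proof (intro allI impI)
  fix \<epsilon> :: real assume "\<epsilon> > 0"
  have "\<exists>B\<in>Alg e. measure M ((C - B) \<union> (B - C)) < \<epsilon>"
    using C \<open>\<epsilon> > 0\<close> Sg_sub_M[of "{e}"] Alg_algebra
    by (intro algebra_approx finite_measure_axioms) (auto simp: space_M sets_Sg1)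
  then obtain A where A: "\<And>N. cyl e N (A N)" "measure M ((C - IS A) \<union> (IS A - C)) < \<epsilon>" by (auto simp: Alg_def)
  have Cm[measurable]: "C \<in> sets M" using C Sg_sub_M by auto
  show "\<exists>w Ca. (\<forall>N x. \<bar>w N x\<bar> \<le> Ca) \<and>
     (\<forall>N. \<forall>x\<in>V N. \<forall>y\<in>V N. (\<forall>j\<in>e. x j = y j) \<longrightarrow> w N x = w N y) \<and>
     (\<forall>D. \<bar>(LINT x:IS D|M. indicator C x) - ulim (\<lambda>N. avg N (\<lambda>x. indicator (D N) x * w N x))\<bar> \<le> \<epsilon>)"
  proof (intro exI[of _ "\<lambda>N. indicator (A N)"] exI[of _ "1::real"] conjI allI)
    fix N x show "\<bar>indicator (A N) x :: real\<bar> \<le> 1" by (auto simp: indicator_def)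
  next
    fix N show "\<forall>x\<in>V N. \<forall>y\<in>V N. (\<forall>j\<in>e. x j = y j) \<longrightarrow> indicator (A N) x = (indicator (A N) y :: real)"
    proof (intro ballI impI)
      fix x y assume "x \<in> V N" "y \<in> V N" "\<forall>j\<in>e. x j = y j"
      then have "x \<in> A N \<longleftrightarrow> y \<in> A N" using A(1)[of N] unfolding cyl_def by blast
      then show "indicator (A N) x = (indicator (A N) y :: real)" by (simp add: indicator_def)
    qed
  next
    fix D
    have "(\<lambda>N. avg N (\<lambda>x. indicator (D N) x * indicator (A N) x)) = (\<lambda>N. avg N (indicator (D N \<inter> A N)))"
      by (intro ext arg_cong[where f="avg _"]) (auto simp: indicator_def)
    then have 1: "ulim (\<lambda>N. avg N (\<lambda>x. indicator (D N) x * indicator (A N) x)) = measure M (IS D \<inter> IS A)"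
      by (simp add: measure_IS mu_def IS_Int)
    have 2: "(LINT x:IS D|M. indicator C x) = measure M (IS D \<inter> C)"
      unfolding set_lebesgue_integral_def using IS_subset
      by (simp add: indicator_inter_arith[symmetric] space_M Int_absorb2 le_infI1)
    have "\<bar>measure M (IS D \<inter> C) - measure M (IS D \<inter> IS A)\<bar> \<le> measure M ((C - IS A) \<union> (IS A - C))"
    proof -
      have "measure M (IS D \<inter> C) \<le> measure M ((IS D \<inter> IS A) \<union> ((C - IS A) \<union> (IS A - C)))"
        by (intro finite_measure_mono) auto
      also have "\<dots> \<le> measure M (IS D \<inter> IS A) + measure M ((C - IS A) \<union> (IS A - C))" by (intro measure_Un_le) auto
      finally have a: "measure M (IS D \<inter> C) \<le> measure M (IS D \<inter> IS A) + measure M ((C - IS A) \<union> (IS A - C))" .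
      have "measure M (IS D \<inter> IS A) \<le> measure M ((IS D \<inter> C) \<union> ((C - IS A) \<union> (IS A - C)))"
        by (intro finite_measure_mono) auto
      also have "\<dots> \<le> measure M (IS D \<inter> C) + measure M ((C - IS A) \<union> (IS A - C))" by (intro measure_Un_le) auto
      finally show ?thesis using a by linarith
    qed
    then show "\<bar>(LINT x:IS D|M. indicator C x) - ulim (\<lambda>N. avg N (\<lambda>x. indicator (D N) x * indicator (A N) x))\<bar> \<le> \<epsilon>"
      using A(2) unfolding 1 2 by linarith
  qed
qed

lemma set_integrable_sub: "integrable M u \<Longrightarrow> A \<in> sets M \<Longrightarrow> set_integrable M A (u :: _ \<Rightarrow> real)"
  unfolding set_integrable_def by (rule integrable_mult_indicator)

lemma set_integral_bound:
  fixes u :: "_ \<Rightarrow> real"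
  assumes "integrable M u" shows "\<bar>LINT x:IS D|M. u x\<bar> \<le> (\<integral>x. \<bar>u x\<bar> \<partial>M)"
proof -
  have "\<bar>LINT x:IS D|M. u x\<bar> \<le> (\<integral>x. \<bar>indicator (IS D) x * u x\<bar> \<partial>M)"
    unfolding set_lebesgue_integral_def by simp
  also have "\<dots> \<le> (\<integral>x. \<bar>u x\<bar> \<partial>M)"
  proof (rule integral_mono)
    have "integrable M (\<lambda>x. indicator (IS D) x * u x)"
      using integrable_mult_indicator[OF IS_meas assms, of D] by simp
    then show "integrable M (\<lambda>x. \<bar>indicator (IS D) x * u x\<bar>)" by (rule integrable_abs)
    show "integrable M (\<lambda>x. \<bar>u x\<bar>)" using assms by (rule integrable_abs)
  qed (auto simp: indicator_def)
  finally show ?thesis .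
qed

lemma approximable_add:
  assumes u: "approximable e u" "integrable M u" and v: "approximable e v" "integrable M v"
  shows "approximable e (\<lambda>x. u x + v x)"
  unfolding approximable_def
proof (intro allI impI)
  fix \<epsilon> :: real assume "\<epsilon> > 0"
  then have e2: "\<epsilon> / 2 > 0" by simp
  obtain w C where w: "\<And>N x. \<bar>w N x\<bar> \<le> C"
     "\<And>N x y. x \<in> V N \<Longrightarrow> y \<in> V N \<Longrightarrow> (\<forall>j\<in>e. x j = y j) \<Longrightarrow> w N x = w N y"
     "\<And>D. \<bar>(LINT x:IS D|M. u x) - ulim (\<lambda>N. avg N (\<lambda>x. indicator (D N) x * w N x))\<bar> \<le> \<epsilon>/2"
    using u(1)[unfolded approximable_def, rule_format, OF e2] by blast
  obtain w' C' where w': "\<And>N x. \<bar>w' N x\<bar> \<le> C'"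
     "\<And>N x y. x \<in> V N \<Longrightarrow> y \<in> V N \<Longrightarrow> (\<forall>j\<in>e. x j = y j) \<Longrightarrow> w' N x = w' N y"
     "\<And>D. \<bar>(LINT x:IS D|M. v x) - ulim (\<lambda>N. avg N (\<lambda>x. indicator (D N) x * w' N x))\<bar> \<le> \<epsilon>/2"
    using v(1)[unfolded approximable_def, rule_format, OF e2] by blast
  show "\<exists>w C. (\<forall>N x. \<bar>w N x\<bar> \<le> C) \<and>
     (\<forall>N. \<forall>x\<in>V N. \<forall>y\<in>V N. (\<forall>j\<in>e. x j = y j) \<longrightarrow> w N x = w N y) \<and>
     (\<forall>D. \<bar>(LINT x:IS D|M. u x + v x) - ulim (\<lambda>N. avg N (\<lambda>x. indicator (D N) x * w N x))\<bar> \<le> \<epsilon>)"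
  proof (intro exI[of _ "\<lambda>N x. w N x + w' N x"] exI[of _ "C + C'"] conjI allI)
    fix N x show "\<bar>w N x + w' N x\<bar> \<le> C + C'" using w(1)[of N x] w'(1)[of N x] by linarith
  next
    fix N show "\<forall>x\<in>V N. \<forall>y\<in>V N. (\<forall>j\<in>e. x j = y j) \<longrightarrow> w N x + w' N x = w N y + w' N y"
      using w(2) w'(2) by metis
  next
    fix D
    have "((\<lambda>N. avg N (\<lambda>x. indicator (D N) x * (w N x + w' N x))) \<longlongrightarrow>
       ulim (\<lambda>N. avg N (\<lambda>x. indicator (D N) x * w N x)) + ulim (\<lambda>N. avg N (\<lambda>x. indicator (D N) x * w' N x))) U"
      using tendsto_add[OF ulim_avg[where w=w and C=C and D=D, OF w(1)] ulim_avg[where w=w' and C=C' and D=D, OF w'(1)]] by (simp add: distrib_left avg_add)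
    then have 1: "ulim (\<lambda>N. avg N (\<lambda>x. indicator (D N) x * (w N x + w' N x))) =
       ulim (\<lambda>N. avg N (\<lambda>x. indicator (D N) x * w N x)) + ulim (\<lambda>N. avg N (\<lambda>x. indicator (D N) x * w' N x))"
      by (rule ulim_unique)
    have 2: "(LINT x:IS D|M. u x + v x) = (LINT x:IS D|M. u x) + (LINT x:IS D|M. v x)"
      using u(2) v(2) by (intro set_integral_add) (auto intro!: set_integrable_sub)
    show "\<bar>(LINT x:IS D|M. u x + v x) - ulim (\<lambda>N. avg N (\<lambda>x. indicator (D N) x * (w N x + w' N x)))\<bar> \<le> \<epsilon>"
      unfolding 1 2 using w(3)[of D] w'(3)[of D] by linarith
  qed
qed

lemma approximable_cmult:
  assumes u: "approximable e u" 
  shows "approximable e (\<lambda>x. c * u x)"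
  unfolding approximable_def
proof (intro allI impI)
  fix \<epsilon> :: real assume "\<epsilon> > 0"
  then have e2: "\<epsilon> / (\<bar>c\<bar> + 1) > 0" by simp
  obtain w C where w: "\<And>N x. \<bar>w N x\<bar> \<le> C"
     "\<And>N x y. x \<in> V N \<Longrightarrow> y \<in> V N \<Longrightarrow> (\<forall>j\<in>e. x j = y j) \<Longrightarrow> w N x = w N y"
     "\<And>D. \<bar>(LINT x:IS D|M. u x) - ulim (\<lambda>N. avg N (\<lambda>x. indicator (D N) x * w N x))\<bar> \<le> \<epsilon> / (\<bar>c\<bar> + 1)"
    using u(1)[unfolded approximable_def, rule_format, OF e2] by blast
  show "\<exists>w C. (\<forall>N x. \<bar>w N x\<bar> \<le> C) \<and>
     (\<forall>N. \<forall>x\<in>V N. \<forall>y\<in>V N. (\<forall>j\<in>e. x j = y j) \<longrightarrow> w N x = w N y) \<and>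
     (\<forall>D. \<bar>(LINT x:IS D|M. c * u x) - ulim (\<lambda>N. avg N (\<lambda>x. indicator (D N) x * w N x))\<bar> \<le> \<epsilon>)"
  proof (intro exI[of _ "\<lambda>N x. c * w N x"] exI[of _ "\<bar>c\<bar> * C"] conjI allI)
    fix N x show "\<bar>c * w N x\<bar> \<le> \<bar>c\<bar> * C" using w(1)[of N x] by (simp add: abs_mult mult_left_mono)
  next
    fix N show "\<forall>x\<in>V N. \<forall>y\<in>V N. (\<forall>j\<in>e. x j = y j) \<longrightarrow> c * w N x = c * w N y"
      using w(2) by metis
  next
    fix D
    have "((\<lambda>N. avg N (\<lambda>x. indicator (D N) x * (c * w N x))) \<longlongrightarrow>
       c * ulim (\<lambda>N. avg N (\<lambda>x. indicator (D N) x * w N x))) U"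
      using tendsto_mult_left[OF ulim_avg[where w=w and C=C and D=D, OF w(1)], of c] by (simp add: avg_cmult[symmetric] mult_ac)
    then have 1: "ulim (\<lambda>N. avg N (\<lambda>x. indicator (D N) x * (c * w N x))) =
       c * ulim (\<lambda>N. avg N (\<lambda>x. indicator (D N) x * w N x))"
      by (rule ulim_unique)
    have "\<bar>(LINT x:IS D|M. c * u x) - c * ulim (\<lambda>N. avg N (\<lambda>x. indicator (D N) x * w N x))\<bar>
      = \<bar>c\<bar> * \<bar>(LINT x:IS D|M. u x) - ulim (\<lambda>N. avg N (\<lambda>x. indicator (D N) x * w N x))\<bar>"
      by (simp add: abs_mult[symmetric] right_diff_distrib)
    also have "\<dots> \<le> \<bar>c\<bar> * (\<epsilon> / (\<bar>c\<bar> + 1))" using w(3) by (intro mult_left_mono) auto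
    also have "\<dots> \<le> \<epsilon>" using \<open>\<epsilon> > 0\<close> by (simp add: field_simps)
    finally show "\<bar>(LINT x:IS D|M. c * u x) - ulim (\<lambda>N. avg N (\<lambda>x. indicator (D N) x * (c * w N x)))\<bar> \<le> \<epsilon>"
      unfolding 1 .
  qed
qed

lemma approximable_lim:
  assumes u: "integrable M u" and s: "\<And>i. approximable e (s i)" "\<And>i. integrable M (s i)"
    and lim: "(\<lambda>i. \<integral>x. \<bar>u x - s i x\<bar> \<partial>M) \<longlonglongrightarrow> 0"
  shows "approximable e u"
  unfolding approximable_def
proof (intro allI impI)
  fix \<epsilon> :: real assume "\<epsilon> > 0"
  then have e2: "\<epsilon> / 2 > 0" by simp
  have "\<forall>\<^sub>F i in sequentially. (\<integral>x. \<bar>u x - s i x\<bar> \<partial>M) < \<epsilon> / 2" using order_tendstoD(2)[OF lim e2] .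
  then obtain i where i: "(\<integral>x. \<bar>u x - s i x\<bar> \<partial>M) < \<epsilon> / 2" by (auto simp: eventually_sequentially)
  obtain w C where w: "\<And>N x. \<bar>w N x\<bar> \<le> C"
     "\<And>N x y. x \<in> V N \<Longrightarrow> y \<in> V N \<Longrightarrow> (\<forall>j\<in>e. x j = y j) \<Longrightarrow> w N x = w N y"
     "\<And>D. \<bar>(LINT x:IS D|M. s i x) - ulim (\<lambda>N. avg N (\<lambda>x. indicator (D N) x * w N x))\<bar> \<le> \<epsilon>/2"
    using s(1)[of i, unfolded approximable_def, rule_format, OF e2] by blast
  have "\<bar>(LINT x:IS D|M. u x) - ulim (\<lambda>N. avg N (\<lambda>x. indicator (D N) x * w N x))\<bar> \<le> \<epsilon>" for D
  proof -
    have "(LINT x:IS D|M. u x) - (LINT x:IS D|M. s i x) = (LINT x:IS D|M. u x - s i x)"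
      using u s(2) by (intro set_integral_diff(2)[symmetric]) (auto intro!: set_integrable_sub)
    moreover have "\<bar>LINT x:IS D|M. u x - s i x\<bar> \<le> (\<integral>x. \<bar>u x - s i x\<bar> \<partial>M)"
      using u s(2) by (intro set_integral_bound) auto
    ultimately show ?thesis using w(3)[of D] i by linarith
  qed
  then show "\<exists>w C. (\<forall>N x. \<bar>w N x\<bar> \<le> C) \<and>
     (\<forall>N. \<forall>x\<in>V N. \<forall>y\<in>V N. (\<forall>j\<in>e. x j = y j) \<longrightarrow> w N x = w N y) \<and>
     (\<forall>D. \<bar>(LINT x:IS D|M. u x) - ulim (\<lambda>N. avg N (\<lambda>x. indicator (D N) x * w N x))\<bar> \<le> \<epsilon>)"
    using w(1,2) by blast
qed

text \<open>Built up from indicators by sums and dominated limits. The induction runs in the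
  restriction of \<open>M\<close> to \<open>Sg {e}\<close>, so that all intermediate functions stay
  measurable for the coordinates in \<open>e\<close>.\<close>

lemma approximable_Sg:
  assumes "integrable M u" "u \<in> borel_measurable (Sg {e})"
  shows "approximable e u"
proof -
  let ?R = "restr_to_subalg M (Sg {e})"
  have R: "integrable ?R f \<Longrightarrow> integrable M f" for f :: "_ \<Rightarrow> real"
    using integrable_from_subalg[OF subalg] by blast
  have "integrable ?R u" using assms by (intro integrable_in_subalg subalg)
  then have "integrable ?R u \<and> approximable e u"
  proof (induction rule: integrable_induct)
    case (base A c)
    then have A: "A \<in> sets (Sg {e})" using sets_restr_to_subalg[OF subalg] by auto
    have "approximable e (\<lambda>x. c * indicator A x)" by (intro approximable_cmult approximable_indicator A)
    moreover have "integrable ?R (\<lambda>x. indicator A x * c)"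
      using base by (intro integrable_mult_left) (auto simp: integrable_indicator_iff top.not_eq_extremum)
    ultimately show ?case by (simp add: mult.commute)
  next
    case (add f \<gamma>)
    then show ?case using R by (auto intro: approximable_add)
  next
    case (lim f s)
    have im: "integrable M (s i)" "integrable M f" for i using lim R by auto
    have "(\<lambda>i. \<integral>x. \<bar>f x - s i x\<bar> \<partial>M) \<longlonglongrightarrow> (\<integral>x. 0 \<partial>M)"
    proof (rule integral_dominated_convergence[where w="\<lambda>x. 3 * \<bar>f x\<bar>"])
      show "integrable M (\<lambda>x. 3 * \<bar>f x\<bar>)" using im(2) by auto
      show "(\<lambda>x. 0) \<in> borel_measurable M" by simp
      show "(\<lambda>x. \<bar>f x - s i x\<bar>) \<in> borel_measurable M" for i using im by auto
      show "AE x in M. (\<lambda>i. \<bar>f x - s i x\<bar>) \<longlonglongrightarrow> 0"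
      proof (rule AE_I2)
        fix x assume "x \<in> space M"
        then have "(\<lambda>i. s i x) \<longlonglongrightarrow> f x" using lim(2)[of x] by (simp add: space_restr_to_subalg space_M)
        then have "(\<lambda>i. f x - s i x) \<longlonglongrightarrow> f x - f x" by (intro tendsto_diff tendsto_const)
        then show "(\<lambda>i. \<bar>f x - s i x\<bar>) \<longlonglongrightarrow> 0" using tendsto_rabs_zero by simp
      qed
      show "AE x in M. norm \<bar>f x - s i x\<bar> \<le> 3 * \<bar>f x\<bar>" for i
      proof (rule AE_I2)
        fix x assume "x \<in> space M"
        then have "\<bar>s i x\<bar> \<le> 2 * \<bar>f x\<bar>" using lim(3)[of x i] by (simp add: space_restr_to_subalg space_M)
        then show "norm \<bar>f x - s i x\<bar> \<le> 3 * \<bar>f x\<bar>" by simp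
      qed
    qed
    then have L: "(\<lambda>i. \<integral>x. \<bar>f x - s i x\<bar> \<partial>M) \<longlonglongrightarrow> 0" by simp
    have "approximable e f"
    proof (rule approximable_lim[where s=s])
      show "approximable e (s i)" for i using lim.IH[of i] by (rule conjunct2)
    qed (fact im L)+
    then show ?case using lim(4) by blast
  qed
  then show ?thesis by blast
qed

section \<open>Freezing coordinates\<close>

definition merge :: "'a set \<Rightarrow> ('a \<Rightarrow> nat) \<Rightarrow> ('a \<Rightarrow> nat) \<Rightarrow> 'a \<Rightarrow> nat" where
  "merge e x y = (\<lambda>j. if j \<in> e then x j else y j)"

lemma merge_V: "x \<in> V N \<Longrightarrow> y \<in> V N \<Longrightarrow> merge e x y \<in> V N"
  by (auto simp: V_def merge_def PiE_iff extensional_def)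

text \<open>Exchanging the coordinates outside \<open>e\<close> is an involution on pairs of points
  of \<open>V N\<close>, so merging two independent uniform points gives a uniform point.\<close>

lemma avg_merge: "avg N f = avg N (\<lambda>y. avg N (\<lambda>x. f (merge e x y)))"
proof -
  have "(\<Sum>y\<in>V N. \<Sum>x\<in>V N. f (merge e x y)) = (\<Sum>(y,x)\<in>V N \<times> V N. f (merge e x y))"
    by (simp add: sum.cartesian_product)
  also have "\<dots> = (\<Sum>(y,x)\<in>V N \<times> V N. f x)"
    by (rule sum.reindex_bij_witness[where i="\<lambda>(y,x). (merge e y x, merge e x y)" and j="\<lambda>(y,x). (merge e y x, merge e x y)"])
       (auto simp: merge_V, auto simp: merge_def fun_eq_iff)
  also have "\<dots> = real (card (V N)) * (\<Sum>x\<in>V N. f x)" by (simp add: sum.cartesian_product[symmetric])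
  finally show ?thesis by (simp add: avg_def sum_divide_distrib[symmetric])
qed

text \<open>Freezing the coordinates outside \<open>e\<close> turns a \<open>\<gamma>\<close>-cylinder into a \<open>\<gamma> \<inter> e\<close>-cylinder; orthogonality
  to all internal \<open>\<gamma> \<inter> e\<close>-cylinders is automatically uniform, because an offending sequence of
  cylinders would itself be internal.\<close>
lemma orthogonal_lift_basic:
  fixes u :: "_ \<Rightarrow> real"
  assumes u: "integrable M u" "u \<in> borel_measurable (Sg {e})"
    and G: "finite G"
    and orth: "\<And>D. D \<in> sets (Sg ((\<lambda>\<gamma>. \<gamma> \<inter> e) ` G)) \<Longrightarrow> (LINT x:D|M. u x) = 0"
    and A: "\<And>\<gamma> N. \<gamma> \<in> G \<Longrightarrow> cyl \<gamma> N (A \<gamma> N)"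
  shows "(LINT x:IS (\<lambda>N. \<Inter>\<gamma>\<in>G. A \<gamma> N)|M. u x) = 0"
proof -
  have "\<bar>LINT x:IS (\<lambda>N. \<Inter>\<gamma>\<in>G. A \<gamma> N)|M. u x\<bar> \<le> 0 + \<epsilon>" if "\<epsilon> > 0" for \<epsilon>
  proof -
    have e3: "\<epsilon> / 3 > 0" using that by simp
    obtain w C where w: "\<And>N x. \<bar>w N x\<bar> \<le> C"
     "\<And>N x y. x \<in> V N \<Longrightarrow> y \<in> V N \<Longrightarrow> (\<forall>j\<in>e. x j = y j) \<Longrightarrow> w N x = w N y"
     "\<And>D. \<bar>(LINT x:IS D|M. u x) - ulim (\<lambda>N. avg N (\<lambda>x. indicator (D N) x * w N x))\<bar> \<le> \<epsilon>/3"
      using approximable_Sg[OF u, unfolded approximable_def, rule_format, OF e3] by blast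
    \<comment> \<open>\<open>B N\<close> is chosen to exceed the threshold whenever some choice of
      cylinders in coordinate \<open>N\<close> does, so a bound for this one sequence holds for all
      cylinders. One third of \<epsilon> is spent on the approximation by \<open>w\<close>;
      orthogonality for the sequence \<open>B\<close> keeps the average below the remaining two
      thirds.\<close>
    let ?good = "\<lambda>N B. (\<forall>\<gamma>\<in>G. cyl (\<gamma> \<inter> e) N (B \<gamma>)) \<and> \<bar>avg N (\<lambda>x. indicator (\<Inter>\<gamma>\<in>G. B \<gamma>) x * w N x)\<bar> > 2*\<epsilon>/3"
    have "\<exists>B. (\<forall>\<gamma>\<in>G. cyl (\<gamma> \<inter> e) N (B \<gamma>)) \<and> ((\<exists>B'. ?good N B') \<longrightarrow> ?good N B)" for N
    proof (cases "\<exists>B'. ?good N B'")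
      case True then show ?thesis by blast
    next
      case False
      have "\<forall>\<gamma>\<in>G. cyl (\<gamma> \<inter> e) N UNIV" by (simp add: cyl_def)
      with False show ?thesis by (intro exI[of _ "\<lambda>\<gamma>. UNIV"]) blast
    qed
    then have "\<exists>B. \<forall>N. (\<forall>\<gamma>\<in>G. cyl (\<gamma> \<inter> e) N (B N \<gamma>)) \<and> ((\<exists>B'. ?good N B') \<longrightarrow> ?good N (B N))"
      by (intro choice allI)
    then obtain B where B: "\<forall>N. (\<forall>\<gamma>\<in>G. cyl (\<gamma> \<inter> e) N (B N \<gamma>)) \<and> ((\<exists>B'. ?good N B') \<longrightarrow> ?good N (B N))"
      by (elim exE)
    have B1: "cyl (\<gamma> \<inter> e) N (B N \<gamma>)" if "\<gamma> \<in> G" for \<gamma> N using B that by blast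
    have B0: "(\<exists>B'. ?good N B') \<longrightarrow> ?good N (B N)" for N using B by (rule allE[of _ N]) (erule conjunct2)
    have B2: "\<bar>avg N (\<lambda>x. indicator (\<Inter>\<gamma>\<in>G. B N \<gamma>) x * w N x)\<bar> > 2*\<epsilon>/3" if "?good N B'" for N B'
      using B0[of N] that by blast
    let ?D = "\<lambda>N. \<Inter>\<gamma>\<in>G. B N \<gamma>"
    have IS_Inter: "IS (\<lambda>N. \<Inter>\<gamma>\<in>G'. B N \<gamma>) \<in> sets (Sg ((\<lambda>\<gamma>. \<gamma> \<inter> e) ` G))" if "G' \<subseteq> G" for G'
      using finite_subset[OF that G] that
    proof (induction G' rule: finite_induct)
      case empty
      then show ?case using sets.top[of "Sg ((\<lambda>\<gamma>. \<gamma> \<inter> e) ` G)"] by (simp add: IS_UNIV)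
    next
      case (insert \<gamma> G')
      have "IS (\<lambda>N. B N \<gamma>) \<in> Alg (\<gamma> \<inter> e)" using B1 insert by (auto simp: Alg_def)
      then have "IS (\<lambda>N. B N \<gamma>) \<in> sets (Sg ((\<lambda>\<gamma>. \<gamma> \<inter> e) ` G))" using insert by (auto simp: sets_Sg)
      then have "IS (\<lambda>N. B N \<gamma>) \<inter> IS (\<lambda>N. \<Inter>\<gamma>\<in>G'. B N \<gamma>) \<in> sets (Sg ((\<lambda>\<gamma>. \<gamma> \<inter> e) ` G))" using insert by auto
      then show ?case by (simp add: IS_Int)
    qed
    have "(LINT x:IS ?D|M. u x) = 0" using orth IS_Inter[of G] by blast
    then have "\<bar>ulim (\<lambda>N. avg N (\<lambda>x. indicator (?D N) x * w N x))\<bar> < 2*\<epsilon>/3" using w(3)[of ?D] that by auto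
    then have ev: "\<forall>\<^sub>F N in U. \<bar>avg N (\<lambda>x. indicator (?D N) x * w N x)\<bar> < 2*\<epsilon>/3"
      using order_tendstoD(2)[OF tendsto_rabs[OF ulim_avg[where w=w and C=C and D="?D", OF w(1)]]] by blast
    let ?A = "\<lambda>N. \<Inter>\<gamma>\<in>G. A \<gamma> N"
    have "\<forall>\<^sub>F N in U. \<bar>avg N (\<lambda>x. indicator (?A N) x * w N x)\<bar> \<le> 2*\<epsilon>/3"
      using ev
    proof eventually_elim
      case (elim N)
      have "\<bar>avg N (\<lambda>x. indicator (?A N) (merge e x y) * w N (merge e x y))\<bar> \<le> 2*\<epsilon>/3" if y: "y \<in> V N" for y
      proof -
        define B' where "B' \<gamma> = {x. merge e x y \<in> A \<gamma> N}" for \<gamma>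
        have cB': "cyl (\<gamma> \<inter> e) N (B' \<gamma>)" if "\<gamma> \<in> G" for \<gamma>
          unfolding cyl_def
        proof (intro ballI impI)
          fix x x' assume x: "x \<in> V N" "x' \<in> V N" "\<forall>j\<in>\<gamma> \<inter> e. x j = x' j"
          then have "\<forall>j\<in>\<gamma>. merge e x y j = merge e x' y j" by (auto simp: merge_def)
          then show "x \<in> B' \<gamma> \<longleftrightarrow> x' \<in> B' \<gamma>"
            using A[OF that, of N] merge_V[OF x(1) y] merge_V[OF x(2) y] by (auto simp: B'_def cyl_def)
        qed
        have "avg N (\<lambda>x. indicator (?A N) (merge e x y) * w N (merge e x y)) = avg N (\<lambda>x. indicator (\<Inter>\<gamma>\<in>G. B' \<gamma>) x * w N x)"
        proof -
          have "w N (merge e x y) = w N x" if "x \<in> V N" for x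
            by (rule w(2)) (use that y merge_V in \<open>auto simp: merge_def\<close>)
          then show ?thesis unfolding avg_def
            by (intro arg_cong2[where f="(/)"] sum.cong refl) (auto simp: B'_def indicator_def)
        qed
        moreover have "\<not> \<bar>avg N (\<lambda>x. indicator (\<Inter>\<gamma>\<in>G. B' \<gamma>) x * w N x)\<bar> > 2*\<epsilon>/3"
          using B2[of N B'] cB' elim by auto
        ultimately show ?thesis by simp
      qed
      then have "\<bar>avg N (\<lambda>y. avg N (\<lambda>x. indicator (?A N) (merge e x y) * w N (merge e x y)))\<bar> \<le> 2*\<epsilon>/3"
        by (rule avg_bound)
      then show ?case using avg_merge[of N "\<lambda>x. indicator (?A N) x * w N x" e] by simp
    qed
    then have "\<bar>ulim (\<lambda>N. avg N (\<lambda>x. indicator (?A N) x * w N x))\<bar> \<le> 2*\<epsilon>/3"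
      using tendsto_upperbound[OF tendsto_rabs[OF ulim_avg[where w=w and C=C and D="?A", OF w(1)]]] U_nontriv by blast
    then show ?thesis using w(3)[of ?A] by linarith
  qed
  then have "\<bar>LINT x:IS (\<lambda>N. \<Inter>\<gamma>\<in>G. A \<gamma> N)|M. u x\<bar> \<le> 0" by (rule field_le_epsilon)
  then show ?thesis by simp
qed

text \<open>Intersections of internal cylinders, one for each member of \<open>G\<close>, are stable
  under intersection and generate \<open>Sg G\<close>; the sets over which \<open>u\<close>
  integrates to 0 are closed under complements and disjoint unions.\<close>

lemma orthogonal_lift:
  fixes u :: "_ \<Rightarrow> real"
  assumes u: "integrable M u" "u \<in> borel_measurable (Sg {e})"
    and G: "finite G"
    and orth: "\<And>D. D \<in> sets (Sg ((\<lambda>\<gamma>. \<gamma> \<inter> e) ` G)) \<Longrightarrow> (LINT x:D|M. u x) = 0"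
    and D: "D \<in> sets (Sg G)"
  shows "(LINT x:D|M. u x) = 0"
proof -
  define P where "P = {IS (\<lambda>N. \<Inter>\<gamma>\<in>G. A \<gamma> N) | A. \<forall>\<gamma>\<in>G. \<forall>N. cyl \<gamma> N (A \<gamma> N)}"
  have P_Pow: "P \<subseteq> Pow Om" unfolding P_def using IS_subset by blast
  have Int_P: "Int_stable P"
  proof (rule Int_stableI)
    fix a b assume "a \<in> P" "b \<in> P"
    then obtain A B where AB: "a = IS (\<lambda>N. \<Inter>\<gamma>\<in>G. A \<gamma> N)" "\<forall>\<gamma>\<in>G. \<forall>N. cyl \<gamma> N (A \<gamma> N)"
      "b = IS (\<lambda>N. \<Inter>\<gamma>\<in>G. B \<gamma> N)" "\<forall>\<gamma>\<in>G. \<forall>N. cyl \<gamma> N (B \<gamma> N)" by (auto simp: P_def)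
    have "a \<inter> b = IS (\<lambda>N. \<Inter>\<gamma>\<in>G. A \<gamma> N \<inter> B \<gamma> N)" by (simp add: AB IS_Int INT_Int_distrib)
    moreover have "\<forall>\<gamma>\<in>G. \<forall>N. cyl \<gamma> N (A \<gamma> N \<inter> B \<gamma> N)" using AB unfolding cyl_def by blast
    ultimately show "a \<inter> b \<in> P" unfolding P_def by (intro CollectI exI[of _ "\<lambda>\<gamma> N. A \<gamma> N \<inter> B \<gamma> N"]) auto
  qed
  have "sets (Sg G) \<subseteq> sigma_sets Om P"
    unfolding sets_Sg
  proof (rule sigma_sets_mono, rule subsetI)
    fix a assume "a \<in> (\<Union>\<gamma>\<in>G. Alg \<gamma>)"
    then obtain \<gamma> A where A: "\<gamma> \<in> G" "a = IS A" "\<forall>N. cyl \<gamma> N (A N)" by (auto simp: Alg_def)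
    have "(\<Inter>h\<in>G. if h = \<gamma> then A N else UNIV) = A N" for N using A(1) by (auto split: if_splits)
    then have "a = IS (\<lambda>N. \<Inter>h\<in>G. if h = \<gamma> then A N else UNIV)" by (simp add: A)
    moreover have "\<forall>h\<in>G. \<forall>N. cyl h N (if h = \<gamma> then A N else UNIV)" using A(3) by simp
    ultimately have "a \<in> P" unfolding P_def by (intro CollectI exI[of _ "\<lambda>h N. if h = \<gamma> then A N else UNIV"]) auto
    then show "a \<in> sigma_sets Om P" by auto
  qed
  then have DP: "D \<in> sigma_sets Om P" using D by auto
  have sub: "sigma_sets Om P \<subseteq> sets M"
    unfolding sets_M using IS_in_Alg_J by (intro sigma_sets_subseteq) (auto simp: P_def)
  have si: "set_integrable M A u" if "A \<in> sets M" for A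
    using that u(1) by (intro set_integrable_sub)
  have basic: "(LINT x:a|M. u x) = 0" if "a \<in> P" for a
  proof -
    obtain A where A: "a = IS (\<lambda>N. \<Inter>\<gamma>\<in>G. A \<gamma> N)" "\<forall>\<gamma>\<in>G. \<forall>N. cyl \<gamma> N (A \<gamma> N)"
      using \<open>a \<in> P\<close> unfolding P_def by blast
    show ?thesis unfolding A(1) using A(2) by (intro orthogonal_lift_basic[OF u G orth]) blast+
  qed
  have OmP: "Om \<in> P" unfolding P_def
    by (intro CollectI exI[of _ "\<lambda>\<gamma> N. UNIV"]) (auto simp: IS_UNIV)
  show ?thesis
    using DP
  proof (induction rule: sigma_sets_induct_disjoint[OF Int_P P_Pow, consumes 1])
    case (1 A) then show ?case by (rule basic)
  next
    case 2 then show ?case by (simp add: set_lebesgue_integral_def)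
  next
    case (3 A)
    have Am: "A \<in> sets M" using 3 sub by auto
    have Ao: "A \<subseteq> Om" using sets.sets_into_space[OF Am] by (simp add: space_M)
    have Om_m: "Om \<in> sets M" using sets.top[of M] by (simp add: space_M)
    have "(LINT x:A \<union> (Om - A)|M. u x) = (LINT x:A|M. u x) + (LINT x:(Om - A)|M. u x)"
      using Am Om_m by (intro set_integral_Un si) auto
    moreover have "A \<union> (Om - A) = Om" using Ao by auto
    ultimately show ?case using 3 basic[OF OmP] by simp
  next
    case (4 A)
    have Am: "A i \<in> sets M" for i using 4 sub by auto
    have "(LINT x:(\<Union>i. A i)|M. u x) = (\<Sum>i. (LINT x:(A i)|M. u x))"
      using Am 4(1) by (intro lebesgue_integral_countable_add si) (auto simp: disjoint_family_on_def)
    then show ?case using 4 by simp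
  qed
qed

section \<open>Conditional expectations on traces\<close>

abbreviation cexp :: "'a set set \<Rightarrow> ((nat \<Rightarrow> 'a \<Rightarrow> nat) \<Rightarrow> real) \<Rightarrow> (nat \<Rightarrow> 'a \<Rightarrow> nat) \<Rightarrow> real" where
  "cexp G \<equiv> real_cond_exp M (Sg G)"

lemma cexp_meas: "cexp G f \<in> borel_measurable (Sg G)" by (rule borel_measurable_cond_exp)

text \<open>The indicator of \<open>C\<close> minus its conditional expectation on the traces
  depends only on coordinates in \<open>e\<close> and is orthogonal to the traces, hence by
  \<open>orthogonal_lift\<close> to all of \<open>Sg G\<close>. Conditioning \<open>C\<close> on
  \<open>Sg G\<close> thus yields nothing beyond the traces.\<close>

lemma relative_independence:
  assumes C: "C \<in> sets (Sg {e})" and G: "finite G"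
    and h: "h \<in> borel_measurable (Sg G)" "\<And>x. \<bar>h x\<bar> \<le> b"
  shows "(\<integral>x. h x * indicator C x \<partial>M) = (\<integral>x. h x * cexp ((\<lambda>\<gamma>. \<gamma> \<inter> e) ` G) (indicator C) x \<partial>M)"
proof -
  let ?G = "(\<lambda>\<gamma>. \<gamma> \<inter> e) ` G"
  interpret FG: finite_measure_subalgebra M "Sg G" by (rule fms)
  interpret FH: finite_measure_subalgebra M "Sg ?G" by (rule fms)
  have Cm[measurable]: "C \<in> sets M" using C Sg_sub_M by auto
  have ic: "integrable M (indicator C :: _ \<Rightarrow> real)" by (simp add: finite_measure_axioms less_top[symmetric])
  have ip: "integrable M (cexp ?G (indicator C))" using FH.real_cond_exp_int(1)[OF ic] .
  have pe: "cexp ?G (indicator C) \<in> borel_measurable (Sg {e})"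
    by (rule measurable_from_subalg[OF _ cexp_meas])
       (use Sg_mono[of ?G "{e}"] in \<open>auto simp: subalgebra_def\<close>)
  have pG: "cexp ?G (indicator C) \<in> borel_measurable (Sg G)"
    by (rule measurable_from_subalg[OF _ cexp_meas])
       (use Sg_mono[of ?G "G"] in \<open>auto simp: subalgebra_def\<close>)
  let ?u = "\<lambda>x. indicator C x - cexp ?G (indicator C) x"
  have sic: "set_integrable M A (indicator C :: _ \<Rightarrow> real)" "set_integrable M A (cexp ?G (indicator C))"
    if "A \<in> sets M" for A
    using that ic ip by (auto intro!: set_integrable_sub)
  have u0: "(LINT x:A|M. ?u x) = (LINT x:A|M. indicator C x) - (LINT x:A|M. cexp ?G (indicator C) x)"
    if "A \<in> sets M" for A by (rule set_integral_diff(2)[OF sic[OF that]])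
  have "(LINT x:D|M. ?u x) = 0" if "D \<in> sets (Sg G)" for D
  proof (rule orthogonal_lift[OF _ _ G _ that])
    show "integrable M ?u" using ic ip by auto
    show "?u \<in> borel_measurable (Sg {e})" using C pe by auto
    show "(LINT x:A|M. ?u x) = 0" if "A \<in> sets (Sg ?G)" for A
      using u0[of A] FH.real_cond_exp_intA[OF ic that] that Sg_sub_M by auto
  qed
  then have A: "(LINT x:D|M. indicator C x) = (LINT x:D|M. cexp ?G (indicator C) x)" if "D \<in> sets (Sg G)" for D
    using u0[of D] that Sg_sub_M by auto
  have "AE x in M. cexp G (indicator C) x = cexp ?G (indicator C) x"
    by (rule FG.real_cond_exp_charact[OF _ ic ip pG]) (use A in \<open>auto simp: set_lebesgue_integral_def\<close>)
  moreover have hm[measurable]: "h \<in> borel_measurable M" using h(1) measurable_from_subalg[OF subalg] by blast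
  ultimately have "(\<integral>x. h x * cexp G (indicator C) x \<partial>M) = (\<integral>x. h x * cexp ?G (indicator C) x \<partial>M)"
    by (intro integral_cong_AE) auto
  moreover have "(\<integral>x. h x * cexp G (indicator C) x \<partial>M) = (\<integral>x. h x * indicator C x \<partial>M)"
  proof (rule FG.real_cond_exp_intg(2)[OF _ h(1)])
    show "integrable M (\<lambda>x. h x * indicator C x)"
      by (rule integrable_const_bound[where B=b])
         (use h(2) in \<open>auto simp: indicator_def intro: order_trans[OF abs_ge_zero]\<close>)
  qed simp
  ultimately show ?thesis by simp
qed

end

section \<open>Replacing events by their densities\<close>

lemma prod_indicator:
  "finite I \<Longrightarrow> (\<Prod>f\<in>I. indicator (Q f) x :: real) = indicator {x. \<forall>f\<in>I. x \<in> Q f} x"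
  by (induction I rule: finite_induct) (auto simp: indicator_def)

context loeb
begin

text \<open>A conditional probability is fixed only up to null sets. Truncation to the unit interval
  gives a version whose bounds hold at every point, so that products of densities can be compared
  pointwise.\<close>

definition cp :: "'a set set \<Rightarrow> (nat \<Rightarrow> 'a \<Rightarrow> nat) set \<Rightarrow> (nat \<Rightarrow> 'a \<Rightarrow> nat) \<Rightarrow> real" where
  "cp G C x = max 0 (min 1 (cexp G (indicator C) x))"

lemma cp_bounds: "0 \<le> cp G C x" "cp G C x \<le> 1" "\<bar>cp G C x\<bar> \<le> 1" by (auto simp: cp_def)

lemma cp_meas [measurable]: "cp G C \<in> borel_measurable (Sg G)"
proof -
  have [measurable]: "cexp G (indicator C) \<in> borel_measurable (Sg G)" by (rule cexp_meas)
  show ?thesis unfolding cp_def[abs_def] by measurable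
qed

lemma Sg_meas_mono:
  assumes "f \<in> borel_measurable (Sg G)" "\<And>\<gamma>. \<gamma> \<in> G \<Longrightarrow> \<exists>\<gamma>'\<in>G'. \<gamma> \<subseteq> \<gamma>'"
  shows "f \<in> borel_measurable (Sg G')"
  by (rule measurable_from_subalg[OF _ assms(1)]) (use Sg_mono[OF assms(2)] in \<open>simp add: subalgebra_def\<close>)

lemma Sg_meas_M: "f \<in> borel_measurable (Sg G) \<Longrightarrow> f \<in> borel_measurable M"
  by (rule measurable_from_subalg[OF subalg])

lemma cp_AE:
  assumes "C \<in> sets M" shows "AE x in M. cexp G (indicator C) x = cp G C x"
proof -
  interpret FG: finite_measure_subalgebra M "Sg G" by (rule fms)
  have ic: "integrable M (indicator C :: _ \<Rightarrow> real)" using assms by (simp add: less_top[symmetric])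
  have "AE x in M. cexp G (indicator C) x \<ge> 0"
    by (rule FG.real_cond_exp_ge_c[OF ic]) (auto simp: indicator_def)
  moreover have "AE x in M. cexp G (indicator C) x \<le> 1"
    by (rule FG.real_cond_exp_le_c[OF ic]) (auto simp: indicator_def)
  ultimately show ?thesis by eventually_elim (simp add: cp_def)
qed

lemma integral_cp:
  assumes C: "C \<in> sets (Sg {e})" and G: "finite G" and G': "(\<lambda>\<gamma>. \<gamma> \<inter> e) ` G = G'"
    and h: "h \<in> borel_measurable (Sg G)" "\<And>x. \<bar>h x\<bar> \<le> b"
  shows "(\<integral>x. h x * indicator C x \<partial>M) = (\<integral>x. h x * cp G' C x \<partial>M)"
proof -
  have Cm: "C \<in> sets M" using C Sg_sub_M by auto
  have [measurable]: "h \<in> borel_measurable M" "cexp G' (indicator C) \<in> borel_measurable M" "cp G' C \<in> borel_measurable M"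
    using Sg_meas_M h(1) cexp_meas cp_meas by blast+
  have "(\<integral>x. h x * indicator C x \<partial>M) = (\<integral>x. h x * cexp G' (indicator C) x \<partial>M)"
    using relative_independence[OF C G h] G' by simp
  also have "\<dots> = (\<integral>x. h x * cp G' C x \<partial>M)"
    by (rule integral_cong_AE) (use cp_AE[OF Cm, of G'] in \<open>auto elim: eventually_mono\<close>)
  finally show ?thesis .
qed

text \<open>The strict bound makes \<open>Lo 0 e\<close> empty, which starts the induction at the
  trivial sigma-algebra; for a \<open>d\<close>-set \<open>f\<close>, \<open>Lo d f\<close> consists
  of its proper subsets.\<close>

abbreviation Lo :: "nat \<Rightarrow> 'a set \<Rightarrow> 'a set set" where
  "Lo d e \<equiv> {\<gamma>. \<gamma> \<subseteq> e \<and> card \<gamma> < d}"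

lemma finite_Pow_J: "H \<subseteq> Pow J \<Longrightarrow> finite H" using finite_J finite_subset by blast

lemma integral_cp_low:
  assumes C: "C \<in> sets (Sg {e})" and e: "e \<subseteq> J"
    and w: "w \<in> borel_measurable (Sg (Lo d J))" "\<And>x. \<bar>w x\<bar> \<le> b"
  shows "(\<integral>x. w x * indicator C x \<partial>M) = (\<integral>x. w x * cp (Lo d e) C x \<partial>M)"
proof (rule integral_cp[OF C _ _ w])
  show "finite (Lo d J)" by (rule finite_Pow_J) auto
  show "(\<lambda>\<gamma>. \<gamma> \<inter> e) ` Lo d J = Lo d e"
  proof (intro equalityI subsetI)
    fix h assume "h \<in> (\<lambda>\<gamma>. \<gamma> \<inter> e) ` Lo d J"
    then obtain \<gamma> where \<gamma>: "\<gamma> \<subseteq> J" "card \<gamma> < d" "h = \<gamma> \<inter> e" by auto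
    have "card (\<gamma> \<inter> e) \<le> card \<gamma>" using \<gamma> finite_J finite_subset by (intro card_mono) auto
    then show "h \<in> Lo d e" using \<gamma> by auto
  next
    fix h assume h: "h \<in> Lo d e"
    then have "h = h \<inter> e" by auto
    then show "h \<in> (\<lambda>\<gamma>. \<gamma> \<inter> e) ` Lo d J" using h e by blast
  qed
qed

text \<open>The factors are exchanged one at a time. Two distinct \<open>d\<close>-sets meet in
  fewer than \<open>d\<close> points and no member of \<open>H\<close> contains \<open>f\<close>, so
  everything else leaves only proper subsets of \<open>f\<close> as traces. \<open>H\<close> may
  contain sets larger than \<open>d\<close>; this is used with \<open>J - {i}\<close>.\<close>

lemma integral_prod_cp:
  assumes fin: "finite \<Phi>" and \<Phi>: "\<And>f. f \<in> \<Phi> \<Longrightarrow> f \<subseteq> J \<and> card f = d \<and> Q f \<in> sets (Sg {f})"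
    and H: "H \<subseteq> Pow J" "Lo d J \<subseteq> H" "\<And>f \<gamma>. f \<in> \<Phi> \<Longrightarrow> \<gamma> \<in> H \<Longrightarrow> \<not> f \<subseteq> \<gamma>"
    and w: "w \<in> borel_measurable (Sg H)" "\<And>x. \<bar>w x\<bar> \<le> b"
  shows "(\<integral>x. w x * (\<Prod>f\<in>\<Phi>. indicator (Q f) x) \<partial>M) = (\<integral>x. w x * (\<Prod>f\<in>\<Phi>. cp (Lo d f) (Q f) x) \<partial>M)"
  using fin \<Phi> H(3) w
proof (induction \<Phi> arbitrary: w rule: finite_induct)
  case empty then show ?case by simp
next
  case (insert f \<Phi>)
  have b: "0 \<le> b" using insert(7)[of undefined] by linarith
  have fJ: "f \<subseteq> J" "card f = d" "Q f \<in> sets (Sg {f})" using insert by auto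
  have finf: "finite f" using fJ finite_J finite_subset by blast
  let ?h = "\<lambda>x. w x * (\<Prod>f\<in>\<Phi>. indicator (Q f) x)"
  let ?G = "H \<union> \<Phi>"
  have indm: "(indicator (Q f') :: _ \<Rightarrow> real) \<in> borel_measurable (Sg ?G)" if "f' \<in> \<Phi>" for f'
  proof -
    have "Q f' \<in> sets (Sg {f'})" using insert that by auto
    then have "(indicator (Q f') :: _ \<Rightarrow> real) \<in> borel_measurable (Sg {f'})" by simp
    then show ?thesis by (rule Sg_meas_mono) (use that in auto)
  qed
  have hm: "?h \<in> borel_measurable (Sg ?G)"
  proof (intro borel_measurable_times borel_measurable_prod indm)
    show "w \<in> borel_measurable (Sg ?G)" by (rule Sg_meas_mono[OF insert(6)]) auto
  qed
  have hb: "\<bar>?h x\<bar> \<le> b" for x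
    unfolding prod_indicator[OF insert(1)] using insert(7)[of x] b by (auto simp: indicator_def abs_mult)
  have "(\<integral>x. w x * (\<Prod>f\<in>insert f \<Phi>. indicator (Q f) x) \<partial>M) = (\<integral>x. ?h x * indicator (Q f) x \<partial>M)"
    using insert(1,2) by (simp add: mult_ac)
  also have "\<dots> = (\<integral>x. ?h x * cp (Lo d f) (Q f) x \<partial>M)"
  proof (rule integral_cp[OF fJ(3) _ _ hm hb])
    have "f' \<subseteq> J" if "f' \<in> \<Phi>" for f' using insert(4)[of f'] that by blast
    then show "finite ?G" using H(1) by (intro finite_Pow_J) blast
    show "(\<lambda>\<gamma>. \<gamma> \<inter> f) ` ?G = Lo d f"
    proof (intro equalityI subsetI)
      fix h assume "h \<in> (\<lambda>\<gamma>. \<gamma> \<inter> f) ` ?G"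
      then obtain \<gamma> where \<gamma>: "\<gamma> \<in> ?G" "h = \<gamma> \<inter> f" by auto
      have "\<not> f \<subseteq> \<gamma>"
      proof (cases "\<gamma> \<in> H")
        case True then show ?thesis using insert(5) by auto
      next
        case False
        then have "\<gamma> \<in> \<Phi>" using \<gamma> by auto
        then have "card \<gamma> = d" "\<gamma> \<subseteq> J" "\<gamma> \<noteq> f" using insert by auto
        then show ?thesis using card_subset_eq[of \<gamma> f] fJ finite_J finite_subset by metis
      qed
      then have "\<gamma> \<inter> f \<subset> f" by auto
      then have "card (\<gamma> \<inter> f) < d" using psubset_card_mono[OF finf] fJ by auto
      then show "h \<in> Lo d f" using \<gamma> by auto
    next
      fix h assume h: "h \<in> Lo d f"
      then have "h \<in> ?G" "h = h \<inter> f" using H(2) fJ by auto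
      then show "h \<in> (\<lambda>\<gamma>. \<gamma> \<inter> f) ` ?G" by blast
    qed
  qed
  also have "\<dots> = (\<integral>x. (w x * cp (Lo d f) (Q f) x) * (\<Prod>f\<in>\<Phi>. indicator (Q f) x) \<partial>M)" by (simp add: mult_ac)
  also have "\<dots> = (\<integral>x. (w x * cp (Lo d f) (Q f) x) * (\<Prod>f\<in>\<Phi>. cp (Lo d f) (Q f) x) \<partial>M)"
  proof (rule insert(3))
    have "cp (Lo d f) (Q f) \<in> borel_measurable (Sg H)"
      by (rule Sg_meas_mono[OF cp_meas]) (use H(2) fJ in blast)
    then show "(\<lambda>x. w x * cp (Lo d f) (Q f) x) \<in> borel_measurable (Sg H)" using insert(6) by simp
    show "\<bar>w x * cp (Lo d f) (Q f) x\<bar> \<le> b" for x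
    proof -
      have "\<bar>w x\<bar> * \<bar>cp (Lo d f) (Q f) x\<bar> \<le> b * 1" using insert(7) cp_bounds b by (intro mult_mono) auto
      then show ?thesis by (simp add: abs_mult)
    qed
  qed (use insert in auto)
  finally show ?case using insert(1,2) by (simp add: mult_ac)
qed

text \<open>Level \<open>d\<close> in discretised form: finitely many colours for the
  \<open>d\<close>-subsets of \<open>e\<close>, and for each colour pattern a set of lower order.
  The value 0 on all other sets makes the pattern a function with finitely many possible
  values.\<close>

definition simple :: "nat \<Rightarrow> 'a set \<Rightarrow> ('a set \<Rightarrow> (nat \<Rightarrow> 'a \<Rightarrow> nat) \<Rightarrow> nat) \<Rightarrow>
    (('a set \<Rightarrow> nat) \<Rightarrow> (nat \<Rightarrow> 'a \<Rightarrow> nat) set) \<Rightarrow> bool" where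
  "simple d e c S \<longleftrightarrow> finite (\<Union>f. range (c f)) \<and> (\<forall>f a. {x\<in>Om. c f x = a} \<in> sets (Sg {f})) \<and>
     (\<forall>f x. f \<notin> {f. f \<subseteq> e \<and> card f = d} \<longrightarrow> c f x = 0) \<and> (\<forall>\<alpha>. S \<alpha> \<in> sets (Sg (Lo d e)))"

definition sset :: "('a set \<Rightarrow> (nat \<Rightarrow> 'a \<Rightarrow> nat) \<Rightarrow> nat) \<Rightarrow>
    (('a set \<Rightarrow> nat) \<Rightarrow> (nat \<Rightarrow> 'a \<Rightarrow> nat) set) \<Rightarrow> (nat \<Rightarrow> 'a \<Rightarrow> nat) set" where
  "sset c S = {x \<in> Om. x \<in> S (\<lambda>f. c f x)}"

lemma sset_meas:
  assumes e: "e \<subseteq> J" and s: "simple d e c S" shows "sset c S \<in> sets M"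
proof -
  let ?\<Phi> = "{f. f \<subseteq> e \<and> card f = d}"
  let ?R = "\<Union>f. range (c f)"
  have fin\<Phi>: "finite ?\<Phi>" by (rule finite_Pow_J) (use e in auto)
  let ?A = "{\<alpha>. \<forall>f. (f \<in> ?\<Phi> \<longrightarrow> \<alpha> f \<in> ?R) \<and> (f \<notin> ?\<Phi> \<longrightarrow> \<alpha> f = 0)}"
  have "finite ?A" using s fin\<Phi> by (intro finite_set_of_finite_funs) (auto simp: simple_def)
  have "sset c S = (\<Union>\<alpha>\<in>?A. S \<alpha> \<inter> (Om \<inter> (\<Inter>f\<in>?\<Phi>. {x\<in>Om. c f x = \<alpha> f})))"
  proof (intro equalityI subsetI)
    fix x assume x: "x \<in> sset c S"
    have "(\<lambda>f. c f x) \<in> ?A" using s unfolding simple_def by blast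
    then show "x \<in> (\<Union>\<alpha>\<in>?A. S \<alpha> \<inter> (Om \<inter> (\<Inter>f\<in>?\<Phi>. {x\<in>Om. c f x = \<alpha> f})))"
      using x by (intro UN_I[of "\<lambda>f. c f x"]) (auto simp: sset_def)
  next
    fix x assume "x \<in> (\<Union>\<alpha>\<in>?A. S \<alpha> \<inter> (Om \<inter> (\<Inter>f\<in>?\<Phi>. {x\<in>Om. c f x = \<alpha> f})))"
    then obtain \<alpha> where a: "\<alpha> \<in> ?A" "x \<in> S \<alpha>" "x \<in> Om" "\<And>f. f \<in> ?\<Phi> \<Longrightarrow> c f x = \<alpha> f" by blast
    have "\<alpha> f = c f x" for f
    proof (cases "f \<in> ?\<Phi>")
      case True then show ?thesis using a(4) by simp
    next
      case False
      then have "\<alpha> f = 0" using a(1) by blast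
      moreover have "c f x = 0" using s False unfolding simple_def by blast
      ultimately show ?thesis by simp
    qed
    then have "\<alpha> = (\<lambda>f. c f x)" by auto
    then show "x \<in> sset c S" using a(2,3) by (simp add: sset_def)
  qed
  moreover have "\<dots> \<in> sets M"
  proof (intro sets.finite_UN \<open>finite ?A\<close>)
    have Om_m: "Om \<in> sets M" using sets.top[of M] by (simp add: space_M)
    fix \<alpha>
    have "S \<alpha> \<in> sets (Sg (Lo d e))" using s by (simp add: simple_def)
    then have Sm: "S \<alpha> \<in> sets M" using Sg_sub_M by blast
    have m: "{x\<in>Om. c f x = \<alpha> f} \<in> sets M" for f
    proof -
      have "{x\<in>Om. c f x = \<alpha> f} \<in> sets (Sg {f})" using s by (simp add: simple_def)
      then show ?thesis using Sg_sub_M by blast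
    qed
    have "Om \<inter> (\<Inter>f\<in>?\<Phi>. {x\<in>Om. c f x = \<alpha> f}) \<in> sets M"
    proof (cases "?\<Phi> = {}")
      case True then show ?thesis using Om_m by (simp only: True) simp
    next
      case False
      then show ?thesis using m Om_m fin\<Phi> by (intro sets.Int sets.finite_INT) auto
    qed
    then show "S \<alpha> \<inter> (Om \<inter> (\<Inter>f\<in>?\<Phi>. {x\<in>Om. c f x = \<alpha> f})) \<in> sets M" by (rule sets.Int[OF Sm])
  qed
  ultimately show ?thesis by simp
qed

text \<open>For a union the two colourings are merged into one by pairs of colours, coded as
  numbers, from which both patterns can be read off.\<close>

lemma simple_algebra: "algebra Om {sset c S | c S. simple d e c S}"
  unfolding algebra_iff_Un
proof (intro conjI ballI)
  let ?A = "{sset c S | c S. simple d e c S}"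
  show "?A \<subseteq> Pow Om" by (auto simp: sset_def)
  have OmS: "Om \<in> sets (Sg G)" "{} \<in> sets (Sg G)" for G using sets.top[of "Sg G"] by auto
  have "simple d e (\<lambda>f x. 0) (\<lambda>\<alpha>. {})" using OmS by (auto simp: simple_def)
  then show "{} \<in> ?A" by (intro CollectI exI[of _ "\<lambda>f x. 0"] exI[of _ "\<lambda>\<alpha>. {}"]) (simp add: sset_def)
  fix a assume "a \<in> ?A"
  then obtain c S where a: "a = sset c S" "simple d e c S" by blast
  have "simple d e c (\<lambda>\<alpha>. Om - S \<alpha>)" using a(2) sets.compl_sets[of _ "Sg (Lo d e)"] by (simp add: simple_def)
  moreover have "Om - a = sset c (\<lambda>\<alpha>. Om - S \<alpha>)" by (auto simp: a sset_def)
  ultimately show "Om - a \<in> ?A" by blast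
  fix b assume "b \<in> ?A"
  then obtain c' S' where b: "b = sset c' S'" "simple d e c' S'" by blast
  define c2 where "c2 f x = prod_encode (c f x, c' f x)" for f x
  define S2 where "S2 \<alpha> = S (\<lambda>f. fst (prod_decode (\<alpha> f))) \<union> S' (\<lambda>f. snd (prod_decode (\<alpha> f)))" for \<alpha>
  have "simple d e c2 S2"
    unfolding simple_def
  proof (intro conjI allI impI)
    have "(\<Union>f. range (c2 f)) \<subseteq> prod_encode ` ((\<Union>f. range (c f)) \<times> (\<Union>f. range (c' f)))"
      by (auto simp: c2_def)
    moreover have "finite (prod_encode ` ((\<Union>f. range (c f)) \<times> (\<Union>f. range (c' f))))"
      using a(2) b(2) by (intro finite_imageI finite_cartesian_product) (simp_all add: simple_def)
    ultimately show "finite (\<Union>f. range (c2 f))" by (rule finite_subset)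
    fix f y
    have "{x \<in> Om. c2 f x = y} = {x\<in>Om. c f x = fst (prod_decode y)} \<inter> {x\<in>Om. c' f x = snd (prod_decode y)}"
      unfolding c2_def by (auto; metis fst_conv snd_conv prod_encode_inverse prod_decode_inverse prod.collapse)
    moreover have "{x\<in>Om. c f x = fst (prod_decode y)} \<in> sets (Sg {f})" "{x\<in>Om. c' f x = snd (prod_decode y)} \<in> sets (Sg {f})"
      using a(2) b(2) by (simp_all add: simple_def)
    ultimately show "{x \<in> Om. c2 f x = y} \<in> sets (Sg {f})" by simp
  next
    fix f x assume "f \<notin> {f. f \<subseteq> e \<and> card f = d}"
    then have "c f x = 0" "c' f x = 0" using a(2) b(2) unfolding simple_def by blast+
    then show "c2 f x = 0" by (simp add: c2_def prod_encode_def)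
  next
    fix \<alpha>
    have "S \<alpha> \<in> sets (Sg (Lo d e))" "S' \<alpha> \<in> sets (Sg (Lo d e))" for \<alpha>
      using a(2) b(2) by (simp_all add: simple_def)
    then show "S2 \<alpha> \<in> sets (Sg (Lo d e))" unfolding S2_def by (intro sets.Un)
  qed
  moreover have "a \<union> b = sset c2 S2" by (auto simp: a b sset_def c2_def S2_def)
  ultimately show "a \<union> b \<in> ?A" by blast
qed

text \<open>The generators of \<open>Sg (Lo (Suc d) e)\<close> are themselves simple: a cylinder
  over a \<open>d\<close>-set uses a colouring with two values, one over a smaller set uses no
  colours. The rest is approximation from an algebra.\<close>

lemma simple_approx:
  assumes e: "e \<subseteq> J" and E: "E \<in> sets (Sg (Lo (Suc d) e))" and "\<epsilon> > 0"
  shows "\<exists>c S. simple d e c S \<and> measure M ((E - sset c S) \<union> (sset c S - E)) < \<epsilon>"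
proof -
  let ?A = "{sset c S | c S. simple d e c S}"
  have "\<exists>B\<in>?A. measure M ((E - B) \<union> (B - E)) < \<epsilon>"
  proof (rule algebra_approx[OF finite_measure_axioms])
    show "algebra (space M) ?A" unfolding space_M by (rule simple_algebra)
    show "sigma_sets (space M) ?A \<subseteq> sets M"
      by (rule sets.sigma_sets_subset) (use sset_meas[OF e] in auto)
    have "sets (Sg (Lo (Suc d) e)) \<subseteq> sigma_sets Om ?A"
      unfolding sets_Sg
    proof (rule sigma_sets_subseteq, rule subsetI)
      fix a assume "a \<in> (\<Union>\<gamma>\<in>Lo (Suc d) e. Alg \<gamma>)"
      then obtain \<gamma> where \<gamma>: "\<gamma> \<subseteq> e" "card \<gamma> < Suc d" "a \<in> Alg \<gamma>" by blast
      have OmS: "Om \<in> sets (Sg G)" "{} \<in> sets (Sg G)" for G using sets.top[of "Sg G"] by auto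
      have aO: "a \<subseteq> Om" using \<gamma>(3) Alg_Pow by blast
      show "a \<in> ?A"
      proof (cases "card \<gamma> = d")
        case True
        have ag: "a \<in> sets (Sg {\<gamma>})" using \<gamma>(3) by (auto simp: sets_Sg)
        define c where "c f x = (if f = \<gamma> \<and> x \<in> a then 1 else 0::nat)" for f x
        define S where "S \<alpha> = (if \<alpha> \<gamma> = (1::nat) then Om else {})" for \<alpha> :: "'a set \<Rightarrow> nat"
        have "simple d e c S" unfolding simple_def
        proof (intro conjI allI impI)
          have "(\<Union>f. range (c f)) \<subseteq> {0,1}" by (auto simp: c_def)
          then show "finite (\<Union>f. range (c f))" by (rule finite_subset) simp
          fix f y
          have "{x \<in> Om. c f x = y} = (if f = \<gamma> then (if y = 1 then a else if y = 0 then Om - a else {}) else if y = 0 then Om else {})"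
            using aO by (auto simp: c_def)
          then show "{x \<in> Om. c f x = y} \<in> sets (Sg {f})"
            using ag OmS sets.compl_sets[OF ag] by simp
        next
          fix f x assume "f \<notin> {f. f \<subseteq> e \<and> card f = d}"
          then show "c f x = 0" using \<gamma>(1) True by (auto simp: c_def)
        next
          fix \<alpha> show "S \<alpha> \<in> sets (Sg (Lo d e))" using OmS by (simp add: S_def)
        qed
        moreover have "a = sset c S" using aO by (auto simp: sset_def c_def S_def split: if_splits)
        ultimately show ?thesis by blast
      next
        case False
        then have "card \<gamma> < d" using \<gamma> by simp
        then have "a \<in> sets (Sg (Lo d e))" using \<gamma> by (auto simp: sets_Sg)
        then have "simple d e (\<lambda>f x. 0) (\<lambda>\<alpha>. a)" using OmS by (auto simp: simple_def)
        moreover have "a = sset (\<lambda>f x. 0) (\<lambda>\<alpha>. a)" using aO by (auto simp: sset_def)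
        ultimately show ?thesis by blast
      qed
    qed
    then show "E \<in> sigma_sets (space M) ?A" using E space_M by auto
  qed fact
  then show ?thesis by blast
qed

end

section \<open>Simplex removal\<close>

context loeb
begin

section \<open>Reducing a hypergraph by one level\<close>

definition Fi :: "nat \<Rightarrow> 'a \<Rightarrow> 'a set set" where "Fi d i = {f. f \<subseteq> J - {i} \<and> card f = d}"

definition QE :: "nat \<Rightarrow> ('a set \<Rightarrow> (nat \<Rightarrow> 'a \<Rightarrow> nat) set) \<Rightarrow> 'a \<Rightarrow> (nat \<Rightarrow> 'a \<Rightarrow> nat) set" where
  "QE d Q i = {x \<in> Om. \<forall>f\<in>Fi d i. x \<in> Q f}"

text \<open>\<open>QE d Q i\<close> is a cell of colours on the facet \<open>J - {i}\<close>, and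
  the product is its conditional density. Kept are the lower order positions at which
  \<open>E i\<close> misses at most the fraction \<open>1 / (2 * card J)\<close> of the cell and no
  colour has density 0. The result lies one level below \<open>E i\<close>, which drives the
  induction.\<close>

definition Ered :: "nat \<Rightarrow> ('a \<Rightarrow> (nat \<Rightarrow> 'a \<Rightarrow> nat) set) \<Rightarrow> ('a set \<Rightarrow> (nat \<Rightarrow> 'a \<Rightarrow> nat) set) \<Rightarrow> 'a \<Rightarrow> (nat \<Rightarrow> 'a \<Rightarrow> nat) set" where
  "Ered d E Q i = {x \<in> Om. cp (Lo d (J - {i})) (QE d Q i - E i) x \<le> (\<Prod>f\<in>Fi d i. cp (Lo d f) (Q f) x) / (2 * real (card J))
      \<and> (\<forall>f\<in>Fi d i. cp (Lo d f) (Q f) x > 0)}"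

lemma finite_Fi [simp]: "finite (Fi d i)" by (rule finite_Pow_J) (auto simp: Fi_def)

lemma Om_Sg [simp]: "Om \<in> sets (Sg G)" using sets.top[of "Sg G"] by simp
lemma Om_M [simp]: "Om \<in> sets M" using sets.top[of M] by (simp add: space_M)

lemma QE_meas:
  assumes Q: "\<And>f. f \<in> Fi d i \<Longrightarrow> Q f \<in> sets (Sg {f})"
  shows "QE d Q i \<in> sets (Sg {J - {i}})"
proof -
  have "Q f \<in> sets (Sg {J - {i}})" if "f \<in> Fi d i" for f
    using Q[OF that] Sg_mono[of "{f}" "{J - {i}}"] that by (auto simp: Fi_def)
  moreover have "QE d Q i = (if Fi d i = {} then Om else Om \<inter> (\<Inter>f\<in>Fi d i. Q f))" by (auto simp: QE_def)
  ultimately show ?thesis by (auto intro!: sets.Int sets.finite_INT)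
qed

lemma cp_meas_up: "e \<subseteq> e' \<Longrightarrow> cp (Lo d e) C \<in> borel_measurable (Sg (Lo d e'))"
  by (rule Sg_meas_mono[OF cp_meas]) blast

lemma Fi_cp_meas: "f \<in> Fi d i \<Longrightarrow> cp (Lo d f) C \<in> borel_measurable (Sg (Lo d (J - {i})))"
  by (rule cp_meas_up) (auto simp: Fi_def)

lemma Ered_meas: "Ered d E Q i \<in> sets (Sg (Lo d (J - {i})))"
proof -
  have [measurable]: "cp (Lo d f) C \<in> borel_measurable (Sg (Lo d (J - {i})))" if "f \<in> Fi d i" for f C
    using that by (rule Fi_cp_meas)
  have [measurable]: "(\<lambda>x. \<Prod>f\<in>Fi d i. cp (Lo d f) (Q f) x) \<in> borel_measurable (Sg (Lo d (J - {i})))"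
    by (intro borel_measurable_prod Fi_cp_meas)
  have [measurable]: "cp (Lo d (J - {i})) C \<in> borel_measurable (Sg (Lo d (J - {i})))" for C by (rule cp_meas)
  have 1: "{x \<in> space (Sg (Lo d (J - {i}))). cp (Lo d (J - {i})) (QE d Q i - E i) x \<le> (\<Prod>f\<in>Fi d i. cp (Lo d f) (Q f) x) / (2 * real (card J))}
     \<in> sets (Sg (Lo d (J - {i})))" by measurable
  have 2: "{x \<in> space (Sg (Lo d (J - {i}))). \<forall>f\<in>Fi d i. cp (Lo d f) (Q f) x > 0} \<in> sets (Sg (Lo d (J - {i})))"
  proof (rule sets.sets_Collect_finite_All)
    fix f assume "f \<in> Fi d i"
    then have [measurable]: "cp (Lo d f) (Q f) \<in> borel_measurable (Sg (Lo d (J - {i})))" by (rule Fi_cp_meas)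
    show "{x \<in> space (Sg (Lo d (J - {i}))). cp (Lo d f) (Q f) x > 0} \<in> sets (Sg (Lo d (J - {i})))" by measurable
  qed simp
  have "Ered d E Q i = {x \<in> space (Sg (Lo d (J - {i}))). cp (Lo d (J - {i})) (QE d Q i - E i) x \<le> (\<Prod>f\<in>Fi d i. cp (Lo d f) (Q f) x) / (2 * real (card J))}
     \<inter> {x \<in> space (Sg (Lo d (J - {i}))). \<forall>f\<in>Fi d i. cp (Lo d f) (Q f) x > 0}" by (auto simp: Ered_def)
  then show ?thesis using sets.Int[OF 1 2] by simp
qed

lemma integral_indicator_M: "A \<in> sets M \<Longrightarrow> (\<integral>x. indicator A x \<partial>M) = measure M A"
  using sets.sets_into_space[of A M] by (simp add: Int_absorb2)

text \<open>Over the event \<open>W\<close> that all reduced sets hold, the cell of all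
  \<open>d\<close>-sets has measure \<open>P\<close>, the integral of the product of densities. Each
  \<open>E i\<close> misses at most \<open>P / (2 * card J)\<close> of it, all together at most
  \<open>P / 2\<close>. As the \<open>E i\<close> have null intersection,
  \<open>P \<le> P / 2\<close>, so \<open>P = 0\<close>; the densities are positive on
  \<open>W\<close>, so \<open>W\<close> is null.\<close>

lemma Ered_null:
  assumes Jne: "J \<noteq> {}"
    and Q: "\<And>f i. i \<in> J \<Longrightarrow> f \<in> Fi d i \<Longrightarrow> Q f \<in> sets (Sg {f})"
    and E: "\<And>i. i \<in> J \<Longrightarrow> E i \<in> sets (Sg {J - {i}})"
    and null: "measure M {x \<in> Om. \<forall>i\<in>J. x \<in> E i} = 0"
  shows "measure M {x \<in> Om. \<forall>i\<in>J. x \<in> Ered d E Q i} = 0"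
proof -
  define \<Phi> where "\<Phi> = (\<Union>i\<in>J. Fi d i)"
  define W where "W = {x \<in> Om. \<forall>i\<in>J. x \<in> Ered d E Q i}"
  define w :: "_ \<Rightarrow> real" where "w = indicator W"
  define \<gamma> where "\<gamma> f = cp (Lo d f) (Q f)" for f
  have fin\<Phi>: "finite \<Phi>" using finite_J by (auto simp: \<Phi>_def)
  have \<Phi>: "f \<subseteq> J \<and> card f = d \<and> Q f \<in> sets (Sg {f})" if "f \<in> \<Phi>" for f
    using that Q by (auto simp: \<Phi>_def Fi_def)
  have card_J: "card J > 0" using Jne finite_J by (simp add: card_gt_0_iff)
  have E1: "Ered d E Q i \<in> sets (Sg (Lo d J))" for i
  proof -
    have "sets (Sg (Lo d (J - {i}))) \<subseteq> sets (Sg (Lo d J))" by (rule Sg_mono) blast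
    then show ?thesis using Ered_meas[of d E Q i] by blast
  qed
  have W: "W \<in> sets (Sg (Lo d J))"
  proof -
    have "W = Om \<inter> (\<Inter>i\<in>J. Ered d E Q i)" by (auto simp: W_def)
    then show ?thesis using E1 finite_J Jne by (auto intro!: sets.Int sets.finite_INT)
  qed
  have Wm: "W \<in> sets M" using W Sg_sub_M by blast
  have wm: "w \<in> borel_measurable (Sg (Lo d J))" using W by (simp add: w_def)
  have w01: "0 \<le> w x" "w x \<le> 1" "\<bar>w x\<bar> \<le> 1" for x by (auto simp: w_def indicator_def)
  have Qm: "Q f \<in> sets M" if "f \<in> \<Phi>" for f using \<Phi>[OF that] Sg_sub_M by blast
  have Em: "E i \<in> sets M" if "i \<in> J" for i using E[OF that] Sg_sub_M by blast
  have QEs: "QE d Q i \<in> sets (Sg {J - {i}})" if "i \<in> J" for i using QE_meas Q that by blast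
  have QEm: "QE d Q i \<in> sets M" if "i \<in> J" for i using QEs[OF that] Sg_sub_M by blast
  have gm: "\<gamma> f \<in> borel_measurable (Sg (Lo d J))" if "f \<in> \<Phi>" for f
    unfolding \<gamma>_def using \<Phi>[OF that] by (intro cp_meas_up) auto
  have gM: "\<gamma> f \<in> borel_measurable M" for f unfolding \<gamma>_def by (rule Sg_meas_M[OF cp_meas])
  have g01: "0 \<le> \<gamma> f x" "\<gamma> f x \<le> 1" for f x unfolding \<gamma>_def by (rule cp_bounds)+
  have pg01: "0 \<le> (\<Prod>f\<in>F. \<gamma> f x)" "(\<Prod>f\<in>F. \<gamma> f x) \<le> 1" for F x
    using g01 by (auto intro: prod_nonneg prod_le_1)
  define A where "A = {x. \<forall>f\<in>\<Phi>. x \<in> Q f}"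
  have AW: "W \<inter> A \<in> sets M"
  proof -
    have "W \<inter> A = (if \<Phi> = {} then W else W \<inter> (\<Inter>f\<in>\<Phi>. Q f))" by (auto simp: A_def)
    then show ?thesis using Wm Qm fin\<Phi> by (auto intro!: sets.Int sets.finite_INT)
  qed
  define P where "P = (\<integral>x. w x * (\<Prod>f\<in>\<Phi>. \<gamma> f x) \<partial>M)"
  have int_wg: "integrable M (\<lambda>x. w x * (\<Prod>f\<in>F. \<gamma> f x))" for F
  proof (rule integrable_const_bound[where B=1])
    show "AE x in M. norm (w x * (\<Prod>f\<in>F. \<gamma> f x)) \<le> 1"
      using w01 pg01 by (intro AE_I2) (auto simp: abs_mult intro!: mult_le_one)
    show "(\<lambda>x. w x * (\<Prod>f\<in>F. \<gamma> f x)) \<in> borel_measurable M"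
      using gM Sg_meas_M[OF wm] by (intro borel_measurable_times borel_measurable_prod)
  qed
  have "measure M (W \<inter> A) = (\<integral>x. w x * (\<Prod>f\<in>\<Phi>. indicator (Q f) x) \<partial>M)"
  proof -
    have "w x * (\<Prod>f\<in>\<Phi>. indicator (Q f) x) = indicator (W \<inter> A) x" for x
      unfolding prod_indicator[OF fin\<Phi>] by (auto simp: w_def A_def indicator_def)
    then show ?thesis using integral_indicator_M[OF AW] by simp
  qed
  also have "\<dots> = P"
    unfolding P_def \<gamma>_def
  proof (rule integral_prod_cp[OF fin\<Phi> \<Phi> _ _ _ wm w01(3)])
    fix f h assume "f \<in> \<Phi>" "h \<in> Lo d J"
    then have "card h < card f" "finite h" using \<Phi> finite_J finite_subset by auto
    then show "\<not> f \<subseteq> h" using card_mono[of h f] by auto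
  qed auto
  finally have WA: "measure M (W \<inter> A) = P" .
  have part: "measure M (W \<inter> A - E i) \<le> P / (2 * real (card J))" if i: "i \<in> J" for i
  proof -
    define C where "C = QE d Q i - E i"
    have Cs: "C \<in> sets (Sg {J - {i}})" unfolding C_def using QEs[OF i] E[OF i] by blast
    have Cm: "C \<in> sets M" using Cs Sg_sub_M by blast
    \<comment> \<open>The \<open>d\<close>-sets left over all contain \<open>i\<close>, so none lies
      within \<open>J - {i}\<close>. Therefore \<open>C\<close>, which depends on
      \<open>J - {i}\<close>, may be treated as part of the weight while their indicators become
      densities; afterwards \<open>C\<close> itself is replaced by its density.\<close>
    let ?R = "\<Phi> - Fi d i"
    have finR: "finite ?R" using fin\<Phi> by simp
    have sub: "Fi d i \<subseteq> \<Phi>" using i by (auto simp: \<Phi>_def)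
    have eqi: "w x * indicator C x * (\<Prod>f\<in>?R. indicator (Q f) x) = indicator (W \<inter> A - E i) x" for x
      unfolding prod_indicator[OF finR] using sub
      by (auto simp: w_def A_def C_def QE_def indicator_def W_def split: if_splits)
    have "measure M (W \<inter> A - E i) = (\<integral>x. w x * indicator C x * (\<Prod>f\<in>?R. indicator (Q f) x) \<partial>M)"
      unfolding eqi using integral_indicator_M[of "W \<inter> A - E i"] AW Em[OF i] by simp
    also have "\<dots> = (\<integral>x. w x * indicator C x * (\<Prod>f\<in>?R. \<gamma> f x) \<partial>M)"
      unfolding \<gamma>_def
    proof (rule integral_prod_cp[where H="insert (J - {i}) (Lo d J)" and b=1, OF finR])
      show "f \<subseteq> J \<and> card f = d \<and> Q f \<in> sets (Sg {f})" if "f \<in> ?R" for f using \<Phi> that by blast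
      show "insert (J - {i}) (Lo d J) \<subseteq> Pow J" by auto
      show "Lo d J \<subseteq> insert (J - {i}) (Lo d J)" by auto
      fix f h assume f: "f \<in> ?R" and h: "h \<in> insert (J - {i}) (Lo d J)"
      show "\<not> f \<subseteq> h"
      proof (cases "h = J - {i}")
        case True then show ?thesis using f \<Phi>[of f] by (auto simp: Fi_def)
      next
        case False
        then have "card h < card f" "finite h" using f h \<Phi> finite_J finite_subset by auto
        then show ?thesis using card_mono[of h f] by auto
      qed
    next
      have "w \<in> borel_measurable (Sg (insert (J - {i}) (Lo d J)))" by (rule Sg_meas_mono[OF wm]) blast
      moreover have "(indicator C :: _ \<Rightarrow> real) \<in> borel_measurable (Sg (insert (J - {i}) (Lo d J)))"
      proof (rule Sg_meas_mono)
        show "(indicator C :: _ \<Rightarrow> real) \<in> borel_measurable (Sg {J - {i}})" using Cs by simp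
      qed blast
      ultimately show "(\<lambda>x. w x * indicator C x) \<in> borel_measurable (Sg (insert (J - {i}) (Lo d J)))" by simp
      show "\<bar>w x * indicator C x\<bar> \<le> 1" for x using w01[of x] by (auto simp: indicator_def)
    qed
    also have "\<dots> = (\<integral>x. (w x * (\<Prod>f\<in>?R. \<gamma> f x)) * indicator C x \<partial>M)" by (simp add: mult_ac)
    also have "\<dots> = (\<integral>x. (w x * (\<Prod>f\<in>?R. \<gamma> f x)) * cp (Lo d (J - {i})) C x \<partial>M)"
    proof (rule integral_cp_low[OF Cs, where b=1])
      show "(\<lambda>x. w x * (\<Prod>f\<in>?R. \<gamma> f x)) \<in> borel_measurable (Sg (Lo d J))"
        using wm gm by (intro borel_measurable_times borel_measurable_prod) auto
      show "\<bar>w x * (\<Prod>f\<in>?R. \<gamma> f x)\<bar> \<le> 1" for x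
        using w01 pg01 by (auto simp: abs_mult intro!: mult_le_one)
    qed auto
    also have "\<dots> \<le> (\<integral>x. (w x * (\<Prod>f\<in>\<Phi>. \<gamma> f x)) / (2 * real (card J)) \<partial>M)"
    proof (rule integral_mono)
      show "integrable M (\<lambda>x. (w x * (\<Prod>f\<in>\<Phi>. \<gamma> f x)) / (2 * real (card J)))"
        using int_wg by simp
      show "integrable M (\<lambda>x. (w x * (\<Prod>f\<in>?R. \<gamma> f x)) * cp (Lo d (J - {i})) C x)"
      proof (rule integrable_const_bound[where B=1])
        show "AE x in M. norm ((w x * (\<Prod>f\<in>?R. \<gamma> f x)) * cp (Lo d (J - {i})) C x) \<le> 1"
          using w01 pg01 cp_bounds by (intro AE_I2) (auto simp: abs_mult intro!: mult_le_one)
        show "(\<lambda>x. (w x * (\<Prod>f\<in>?R. \<gamma> f x)) * cp (Lo d (J - {i})) C x) \<in> borel_measurable M"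
          using gM Sg_meas_M[OF wm] Sg_meas_M[OF cp_meas] by (intro borel_measurable_times borel_measurable_prod)
      qed
      fix x
      have prod_split: "(\<Prod>f\<in>\<Phi>. \<gamma> f x) = (\<Prod>f\<in>?R. \<gamma> f x) * (\<Prod>f\<in>Fi d i. \<gamma> f x)"
        using prod.subset_diff[OF sub fin\<Phi>, of "\<lambda>f. \<gamma> f x"] by simp
      show "(w x * (\<Prod>f\<in>?R. \<gamma> f x)) * cp (Lo d (J - {i})) C x \<le> (w x * (\<Prod>f\<in>\<Phi>. \<gamma> f x)) / (2 * real (card J))"
      proof (cases "x \<in> W")
        case True
        then have "x \<in> Ered d E Q i" using i by (auto simp: W_def)
        then have "cp (Lo d (J - {i})) C x \<le> (\<Prod>f\<in>Fi d i. \<gamma> f x) / (2 * real (card J))"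
          by (simp add: Ered_def C_def \<gamma>_def)
        then have "(\<Prod>f\<in>?R. \<gamma> f x) * cp (Lo d (J - {i})) C x \<le> (\<Prod>f\<in>?R. \<gamma> f x) * ((\<Prod>f\<in>Fi d i. \<gamma> f x) / (2 * real (card J)))"
          using pg01 by (intro mult_left_mono) auto
        then show ?thesis using True by (simp add: w_def prod_split)
      next
        case False then show ?thesis by (simp add: w_def)
      qed
    qed
    finally show ?thesis by (simp add: P_def)
  qed
  let ?Z = "{x \<in> Om. \<forall>i\<in>J. x \<in> E i}"
  have Zm: "?Z \<in> sets M"
  proof -
    have "?Z = Om \<inter> (\<Inter>i\<in>J. E i)" by auto
    then show ?thesis using Em finite_J Jne by (auto intro!: sets.Int sets.finite_INT)
  qed
  have UNm: "(\<Union>i\<in>J. W \<inter> A - E i) \<in> sets M"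
    using AW Em finite_J by (intro sets.finite_UN sets.Diff)
  have "P \<le> measure M (?Z \<union> (\<Union>i\<in>J. W \<inter> A - E i))"
    unfolding WA[symmetric]
  proof (rule finite_measure_mono)
    show "W \<inter> A \<subseteq> ?Z \<union> (\<Union>i\<in>J. W \<inter> A - E i)" by (auto simp: W_def)
  qed (intro sets.Un Zm UNm)
  also have "\<dots> \<le> measure M ?Z + measure M (\<Union>i\<in>J. W \<inter> A - E i)"
    using Zm UNm by (intro measure_Un_le)
  also have "measure M (\<Union>i\<in>J. W \<inter> A - E i) \<le> (\<Sum>i\<in>J. measure M (W \<inter> A - E i))"
    using AW Em finite_J by (intro measure_UNION_le) auto
  also have "\<dots> \<le> (\<Sum>i\<in>J. P / (2 * real (card J)))" using part by (intro sum_mono)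
  also have "\<dots> = P / 2" using card_J by simp
  finally have "P \<le> 0" using null by simp
  moreover have "P \<ge> 0" unfolding P_def using w01 pg01 by (intro Bochner_Integration.integral_nonneg) auto
  ultimately have "P = 0" by simp
  then have AE0: "AE x in M. w x * (\<Prod>f\<in>\<Phi>. \<gamma> f x) = 0"
    unfolding P_def using integral_nonneg_eq_0_iff_AE[OF int_wg] w01 pg01 by simp
  have gpos: "(\<Prod>f\<in>\<Phi>. \<gamma> f x) > 0" if "x \<in> W" for x
    using that by (intro prod_pos) (auto simp: W_def Ered_def \<gamma>_def \<Phi>_def)
  have "AE x in M. x \<notin> W"
    using AE0
  proof eventually_elim
    case (elim x)
    show ?case
    proof
      assume "x \<in> W"
      then show False using elim gpos[of x] by (simp add: w_def)
    qed
  qed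
  then have "W \<in> null_sets M" using Wm by (simp add: AE_iff_null_sets)
  then show ?thesis unfolding W_def[symmetric] by (simp add: measure_eq_0_null_sets)
qed

text \<open>A Markov type estimate: where the fraction bound fails, the cell weighs at most
  \<open>2 * card J\<close> times the part of it missed by \<open>E i\<close>; where a density
  vanishes, the colour class itself is null. The weight \<open>S\<close> lets the bound be applied
  to each pattern of a simple set.\<close>

lemma Ered_loss:
  assumes i: "i \<in> J"
    and Q: "\<And>f. f \<in> Fi d i \<Longrightarrow> Q f \<in> sets (Sg {f})"
    and E: "E i \<in> sets (Sg {J - {i}})"
    and S: "S \<in> sets (Sg (Lo d (J - {i})))"
  shows "measure M (S \<inter> QE d Q i - Ered d E Q i) \<le> 2 * real (card J) * measure M (S \<inter> QE d Q i - E i)"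
proof -
  define \<gamma> where "\<gamma> f = cp (Lo d f) (Q f)" for f
  define r where "r = cp (Lo d (J - {i})) (QE d Q i - E i)"
  have card_J: "card J > 0" using i finite_J by (auto simp: card_gt_0_iff)
  have low: "sets (Sg (Lo d (J - {i}))) \<subseteq> sets (Sg (Lo d J))" by (rule Sg_mono) blast
  have Sm: "S \<in> sets M" using S Sg_sub_M by blast
  have SOm: "S \<subseteq> Om" using sets.sets_into_space[OF S] by simp
  have Qm: "Q f \<in> sets M" if "f \<in> Fi d i" for f using Q[OF that] Sg_sub_M by blast
  have Em: "E i \<in> sets M" using E Sg_sub_M by blast
  have QEs: "QE d Q i \<in> sets (Sg {J - {i}})" using QE_meas Q by blast
  have QEm: "QE d Q i \<in> sets M" using QEs Sg_sub_M by blast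
  have Cs: "QE d Q i - E i \<in> sets (Sg {J - {i}})" using QEs E by blast
  have gi: "\<gamma> f \<in> borel_measurable (Sg (Lo d (J - {i})))" if "f \<in> Fi d i" for f
    unfolding \<gamma>_def using that by (rule Fi_cp_meas)
  have ri: "r \<in> borel_measurable (Sg (Lo d (J - {i})))" unfolding r_def by (rule cp_meas)
  have g01: "0 \<le> \<gamma> f x" "\<gamma> f x \<le> 1" for f x unfolding \<gamma>_def by (rule cp_bounds)+
  have pg01: "0 \<le> (\<Prod>f\<in>F. \<gamma> f x)" "(\<Prod>f\<in>F. \<gamma> f x) \<le> 1" for F x
    using g01 by (auto intro: prod_nonneg prod_le_1)
  have gM: "\<gamma> f \<in> borel_measurable M" for f unfolding \<gamma>_def by (rule Sg_meas_M[OF cp_meas])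
  have rM: "r \<in> borel_measurable M" unfolding r_def by (rule Sg_meas_M[OF cp_meas])
  define D where "D = S \<inter> {x \<in> Om. r x > (\<Prod>f\<in>Fi d i. \<gamma> f x) / (2 * real (card J))}"
  have D: "D \<in> sets (Sg (Lo d (J - {i})))"
  proof -
    have [measurable]: "(\<lambda>x. \<Prod>f\<in>Fi d i. \<gamma> f x) \<in> borel_measurable (Sg (Lo d (J - {i})))"
      by (intro borel_measurable_prod gi)
    note ri[measurable]
    have "{x \<in> space (Sg (Lo d (J - {i}))). r x > (\<Prod>f\<in>Fi d i. \<gamma> f x) / (2 * real (card J))} \<in> sets (Sg (Lo d (J - {i})))"
      by measurable
    then show ?thesis unfolding D_def using S by simp
  qed
  have DJ: "D \<in> sets (Sg (Lo d J))" using D low by blast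
  have Dm: "D \<in> sets M" using D Sg_sub_M by blast
  have DOm: "D \<subseteq> Om" by (auto simp: D_def)
  have indD: "(indicator D :: _ \<Rightarrow> real) \<in> borel_measurable (Sg (Lo d J))" using DJ by simp
  have b1: "\<bar>indicator D x :: real\<bar> \<le> 1" for x by (auto simp: indicator_def)
  have 1: "measure M (D \<inter> QE d Q i) = (\<integral>x. indicator D x * (\<Prod>f\<in>Fi d i. \<gamma> f x) \<partial>M)"
  proof -
    have "indicator D x * (\<Prod>f\<in>Fi d i. indicator (Q f) x) = (indicator (D \<inter> QE d Q i) x :: real)" for x
      unfolding prod_indicator[OF finite_Fi] using DOm by (auto simp: QE_def indicator_def)
    then have "measure M (D \<inter> QE d Q i) = (\<integral>x. indicator D x * (\<Prod>f\<in>Fi d i. indicator (Q f) x) \<partial>M)"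
      using integral_indicator_M[of "D \<inter> QE d Q i"] Dm QEm by simp
    also have "\<dots> = (\<integral>x. indicator D x * (\<Prod>f\<in>Fi d i. \<gamma> f x) \<partial>M)"
      unfolding \<gamma>_def
    proof (rule integral_prod_cp[OF finite_Fi _ _ _ _ indD b1])
      show "f \<subseteq> J \<and> card f = d \<and> Q f \<in> sets (Sg {f})" if "f \<in> Fi d i" for f
        using that Q by (auto simp: Fi_def)
      fix f h assume "f \<in> Fi d i" "h \<in> Lo d J"
      then have "card h < card f" "finite h" using finite_J finite_subset by (auto simp: Fi_def)
      then show "\<not> f \<subseteq> h" using card_mono[of h f] by auto
    qed auto
    finally show ?thesis .
  qed
  also have "\<dots> \<le> (\<integral>x. 2 * real (card J) * (indicator D x * r x) \<partial>M)"
  proof (rule integral_mono)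
    show "integrable M (\<lambda>x. indicator D x * (\<Prod>f\<in>Fi d i. \<gamma> f x))"
    proof (rule integrable_const_bound[where B=1])
      show "AE x in M. norm (indicator D x * (\<Prod>f\<in>Fi d i. \<gamma> f x)) \<le> 1"
        using pg01 by (intro AE_I2) (auto simp: indicator_def)
      show "(\<lambda>x. indicator D x * (\<Prod>f\<in>Fi d i. \<gamma> f x)) \<in> borel_measurable M"
        using gM Dm by (intro borel_measurable_times borel_measurable_prod) auto
    qed
    have "integrable M (\<lambda>x. indicator D x * r x)"
    proof (rule integrable_const_bound[where B=1])
      show "AE x in M. norm (indicator D x * r x) \<le> 1"
        unfolding r_def using cp_bounds by (intro AE_I2) (auto simp: indicator_def)
      show "(\<lambda>x. indicator D x * r x) \<in> borel_measurable M"
        using rM Dm by (intro borel_measurable_times) auto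
    qed
    then show "integrable M (\<lambda>x. 2 * real (card J) * (indicator D x * r x))" by simp
    fix x show "indicator D x * (\<Prod>f\<in>Fi d i. \<gamma> f x) \<le> 2 * real (card J) * (indicator D x * r x)"
      using card_J by (auto simp: D_def indicator_def field_simps)
  qed
  also have "\<dots> = 2 * real (card J) * (\<integral>x. indicator D x * r x \<partial>M)" by simp
  also have "(\<integral>x. indicator D x * r x \<partial>M) = (\<integral>x. indicator D x * indicator (QE d Q i - E i) x \<partial>M)"
    unfolding r_def by (rule integral_cp_low[OF Cs _ indD b1, symmetric]) auto
  also have "\<dots> = measure M (D \<inter> (QE d Q i - E i))"
    using integral_indicator_M[of "D \<inter> (QE d Q i - E i)"] Dm QEm Em by (simp add: indicator_inter_arith)
  also have "\<dots> \<le> measure M (S \<inter> QE d Q i - E i)"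
    using Sm QEm Em by (intro finite_measure_mono) (auto simp: D_def)
  finally have main: "measure M (D \<inter> QE d Q i) \<le> 2 * real (card J) * measure M (S \<inter> QE d Q i - E i)"
    using card_J by (simp add: mult_left_mono)
  define Z where "Z f = Q f \<inter> {x \<in> Om. \<gamma> f x \<le> 0}" for f
  have Zm: "Z f \<in> sets M" if "f \<in> Fi d i" for f
  proof -
    have "{x \<in> space M. \<gamma> f x \<le> 0} \<in> sets M" using gM[of f] by simp
    then show ?thesis unfolding Z_def using Qm[OF that] by (simp add: space_M)
  qed
  have Z0: "measure M (Z f) = 0" if f: "f \<in> Fi d i" for f
  proof -
    let ?N = "{x \<in> Om. \<gamma> f x \<le> 0}"
    have "{x \<in> space (Sg (Lo d (J - {i}))). \<gamma> f x \<le> 0} \<in> sets (Sg (Lo d (J - {i})))"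
      using borel_measurable_le[OF gi[OF f] borel_measurable_const[of 0]] by simp
    then have N: "?N \<in> sets (Sg (Lo d J))" using low by auto
    have Nm: "?N \<in> sets M" using N Sg_sub_M by blast
    have iN: "(indicator ?N :: _ \<Rightarrow> real) \<in> borel_measurable (Sg (Lo d J))" using N by simp
    have "measure M (Z f) = (\<integral>x. indicator ?N x * indicator (Q f) x \<partial>M)"
      using integral_indicator_M[OF Zm[OF f]] by (simp add: Z_def indicator_inter_arith mult.commute)
    also have "\<dots> = (\<integral>x. indicator ?N x * \<gamma> f x \<partial>M)"
      unfolding \<gamma>_def
      by (rule integral_cp_low[OF Q[OF f] _ iN[unfolded \<gamma>_def], where b=1]) (use f in \<open>auto simp: Fi_def indicator_def\<close>)
    also have "\<dots> = 0"
    proof -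
      have "indicator ?N x * \<gamma> f x = 0" for x using g01(1)[of f x] by (auto simp: indicator_def)
      then have "(\<lambda>x. indicator ?N x * \<gamma> f x) = (\<lambda>x. 0)" by (intro ext)
      then show ?thesis by (simp only: Bochner_Integration.integral_zero)
    qed
    finally show ?thesis .
  qed
  have UZ: "(\<Union>f\<in>Fi d i. Z f) \<in> sets M" using Zm by (intro sets.finite_UN) auto
  have DQ: "D \<inter> QE d Q i \<in> sets M" using Dm QEm by blast
  have "measure M (S \<inter> QE d Q i - Ered d E Q i) \<le> measure M ((D \<inter> QE d Q i) \<union> (\<Union>f\<in>Fi d i. Z f))"
  proof (rule finite_measure_mono)
    show "S \<inter> QE d Q i - Ered d E Q i \<subseteq> (D \<inter> QE d Q i) \<union> (\<Union>f\<in>Fi d i. Z f)"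
      using SOm by (auto simp: D_def Z_def QE_def Ered_def \<gamma>_def r_def not_less not_le)
    show "(D \<inter> QE d Q i) \<union> (\<Union>f\<in>Fi d i. Z f) \<in> sets M" using DQ UZ by blast
  qed
  also have "\<dots> \<le> measure M (D \<inter> QE d Q i) + measure M (\<Union>f\<in>Fi d i. Z f)"
    using DQ UZ by (intro measure_Un_le)
  also have "measure M (\<Union>f\<in>Fi d i. Z f) \<le> (\<Sum>f\<in>Fi d i. measure M (Z f))"
    using Zm by (intro measure_UNION_le) auto
  also have "\<dots> = 0" using Z0 by simp
  finally show ?thesis using main by simp
qed


lemma QE_cong: "(\<And>f. f \<in> Fi d i \<Longrightarrow> Q f = Q' f) \<Longrightarrow> QE d Q i = QE d Q' i"
  by (simp add: QE_def)

lemma Ered_cong: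
  assumes "\<And>f. f \<in> Fi d i \<Longrightarrow> Q f = Q' f" shows "Ered d E Q i = Ered d E Q' i"
proof -
  have "(\<Prod>f\<in>Fi d i. cp (Lo d f) (Q f) x) = (\<Prod>f\<in>Fi d i. cp (Lo d f) (Q' f) x)" for x
    using assms by (intro prod.cong) auto
  then show ?thesis unfolding Ered_def using QE_cong[OF assms] assms by simp
qed

text \<open>Induction on the level; the final intersection is empty, not merely null. Each
  \<open>E i\<close> is approximated by a simple set. For every colour pattern the reduced sets lie
  one level lower and have null intersection, so the induction hypothesis supplies exceptional sets
  for them; besides these, one removes the points of \<open>E i\<close> lost by the reduction. At
  level 0 the sets are trivial and one of them must be empty.\<close>

lemma removal:
  assumes "J \<noteq> {}" "\<And>i. i \<in> J \<Longrightarrow> E i \<in> sets (Sg (Lo d (J - {i})))"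
    "measure M {x \<in> Om. \<forall>i\<in>J. x \<in> E i} = 0" "\<epsilon> > 0"
  shows "\<exists>F. (\<forall>i\<in>J. F i \<in> sets (Sg {J - {i}}) \<and> measure M (F i) \<le> \<epsilon>) \<and>
     {x \<in> Om. \<forall>i\<in>J. x \<in> E i - F i} = {}"
  using assms
proof (induction d arbitrary: E \<epsilon>)
  case 0
  have triv: "E i = {} \<or> E i = Om" if "i \<in> J" for i
    using 0(2)[OF that] by (simp add: sets_Sg sigma_sets_empty_eq)
  have "\<exists>i\<in>J. E i = {}"
  proof (rule ccontr)
    assume "\<not> ?thesis"
    then have "\<forall>i\<in>J. E i = Om" using triv by blast
    then have "{x \<in> Om. \<forall>i\<in>J. x \<in> E i} = space M" by (auto simp: space_M)
    then show False using 0(3) prob_space by simp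
  qed
  then show ?case using 0(4) by (intro exI[of _ "\<lambda>_. {}"]) auto
next
  case (Suc d)
  \<comment> \<open>The loss in passing to reduced sets will be at most
    \<open>\<nu> + 2 * real (card J) * \<nu>\<close>, which is
    \<open>\<epsilon> / 4\<close>.\<close>
  define \<nu> where "\<nu> = \<epsilon> / (4 * (1 + 2 * real (card J)))"
  have \<nu>: "\<nu> > 0" using Suc(5) by (simp add: \<nu>_def add_pos_nonneg)
  have "\<forall>i\<in>J. \<exists>p. simple d (J - {i}) (fst p) (snd p) \<and>
      measure M ((E i - sset (fst p) (snd p)) \<union> (sset (fst p) (snd p) - E i)) < \<nu>"
  proof
    fix i assume i: "i \<in> J"
    obtain c S where cS: "simple d (J - {i}) c S" "measure M ((E i - sset c S) \<union> (sset c S - E i)) < \<nu>"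
      using simple_approx[OF _ Suc(3)[OF i] \<nu>] by blast
    then show "\<exists>p. simple d (J - {i}) (fst p) (snd p) \<and>
      measure M ((E i - sset (fst p) (snd p)) \<union> (sset (fst p) (snd p) - E i)) < \<nu>"
      by (intro exI[of _ "(c, S)"]) simp
  qed
  then have "\<exists>p. \<forall>i\<in>J. simple d (J - {i}) (fst (p i)) (snd (p i)) \<and>
      measure M ((E i - sset (fst (p i)) (snd (p i))) \<union> (sset (fst (p i)) (snd (p i)) - E i)) < \<nu>"
    by (rule bchoice)
  then obtain p where p: "\<forall>i\<in>J. simple d (J - {i}) (fst (p i)) (snd (p i)) \<and>
      measure M ((E i - sset (fst (p i)) (snd (p i))) \<union> (sset (fst (p i)) (snd (p i)) - E i)) < \<nu>" by (elim exE)
  define c where "c i = fst (p i)" for i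
  define S where "S i = snd (p i)" for i
  define Et where "Et i = sset (c i) (S i)" for i
  have simp_c: "simple d (J - {i}) (c i) (S i)" if "i \<in> J" for i
    using p that unfolding c_def S_def by blast
  have Et_close: "measure M ((E i - Et i) \<union> (Et i - E i)) < \<nu>" if "i \<in> J" for i
    using p that unfolding c_def S_def Et_def by blast
  have Etm: "Et i \<in> sets M" if "i \<in> J" for i
    unfolding Et_def by (rule sset_meas[OF _ simp_c[OF that]]) auto
  have c0: "c i f x = 0" if "i \<in> J" "f \<notin> Fi d i" for i f x
    using simp_c[OF that(1)] that(2) unfolding simple_def Fi_def by blast
  have Sm: "S i \<beta> \<in> sets (Sg (Lo d (J - {i})))" if "i \<in> J" for i \<beta>
    using simp_c[OF that] unfolding simple_def by blast
  \<comment> \<open>The pattern of a point under all approximating colourings at once. Only finitely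
    many occur, so the induction hypothesis may be used once for each.\<close>
  define ax where "ax x = (\<lambda>i f. if i \<in> J then c i f x else 0)" for x
  define AA where "AA = ax ` Om"
  define Q where "Q \<alpha> f = {x \<in> Om. \<forall>i\<in>J. c i f x = \<alpha> i f}" for \<alpha> f
  have finAA: "finite AA"
  proof -
    let ?R = "insert 0 (\<Union>i\<in>J. \<Union>f. range (c i f))"
    have finR: "finite ?R" using simp_c finite_J by (auto simp: simple_def)
    let ?B = "{\<beta>. \<forall>f. (f \<in> Pow J \<longrightarrow> \<beta> f \<in> ?R) \<and> (f \<notin> Pow J \<longrightarrow> \<beta> f = 0)}"
    have finB: "finite ?B" using finR finite_J by (intro finite_set_of_finite_funs) auto
    let ?A = "{\<alpha>. \<forall>i. (i \<in> J \<longrightarrow> \<alpha> i \<in> ?B) \<and> (i \<notin> J \<longrightarrow> \<alpha> i = (\<lambda>_. 0))}"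
    have "finite ?A" by (rule finite_set_of_finite_funs[OF finite_J finB])
    moreover have "AA \<subseteq> ?A"
    proof
      fix \<alpha> assume "\<alpha> \<in> AA"
      then obtain x where x: "\<alpha> = ax x" by (auto simp: AA_def)
      have "c i f x = 0" if "i \<in> J" "f \<notin> Pow J" for i f
        by (rule c0[OF that(1)]) (use that(2) in \<open>auto simp: Fi_def\<close>)
      moreover have "c i f x \<in> ?R" if "i \<in> J" for i f using that by blast
      ultimately show "\<alpha> \<in> ?A" unfolding x ax_def by simp
    qed
    ultimately show ?thesis by (rule finite_subset[rotated])
  qed
  have Qs: "Q \<alpha> f \<in> sets (Sg {f})" for \<alpha> f
  proof -
    have "{x \<in> Om. c i f x = \<alpha> i f} \<in> sets (Sg {f})" if "i \<in> J" for i
      using simp_c[OF that] unfolding simple_def by blast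
    moreover have "Q \<alpha> f = Om \<inter> (\<Inter>i\<in>J. {x \<in> Om. c i f x = \<alpha> i f})" by (auto simp: Q_def)
    ultimately show ?thesis using finite_J Suc(2) by (auto intro!: sets.Int sets.finite_INT)
  qed
  have Es: "E i \<in> sets (Sg {J - {i}})" if "i \<in> J" for i
  proof -
    have "sets (Sg (Lo (Suc d) (J - {i}))) \<subseteq> sets (Sg {J - {i}})" by (rule Sg_mono) auto
    then show ?thesis using Suc(3)[OF that] by blast
  qed
  have Em: "E i \<in> sets M" if "i \<in> J" for i using Es[OF that] Sg_sub_M by blast
  have QEs: "QE d (Q \<alpha>) i \<in> sets (Sg {J - {i}})" for \<alpha> i by (rule QE_meas) (rule Qs)
  have QEm: "QE d (Q \<alpha>) i \<in> sets M" for \<alpha> i using QEs Sg_sub_M by blast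
  have Er: "Ered d E (Q \<alpha>) i \<in> sets (Sg (Lo d (J - {i})))" for \<alpha> i by (rule Ered_meas)
  have Ers: "Ered d E (Q \<alpha>) i \<in> sets (Sg {J - {i}})" for \<alpha> i
  proof -
    have "sets (Sg (Lo d (J - {i}))) \<subseteq> sets (Sg {J - {i}})" by (rule Sg_mono) auto
    then show ?thesis using Er by blast
  qed
  have Erm: "Ered d E (Q \<alpha>) i \<in> sets M" for \<alpha> i using Er Sg_sub_M by blast
  define \<epsilon>' where "\<epsilon>' = \<epsilon> / (2 * (real (card AA) + 1))"
  have \<epsilon>': "\<epsilon>' > 0" using Suc(5) by (simp add: \<epsilon>'_def add_nonneg_pos)
  have "\<forall>\<alpha>\<in>AA. \<exists>F. (\<forall>i\<in>J. F i \<in> sets (Sg {J - {i}}) \<and> measure M (F i) \<le> \<epsilon>') \<and>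
     {x \<in> Om. \<forall>i\<in>J. x \<in> Ered d E (Q \<alpha>) i - F i} = {}"
  proof
    fix \<alpha>
    show "\<exists>F. (\<forall>i\<in>J. F i \<in> sets (Sg {J - {i}}) \<and> measure M (F i) \<le> \<epsilon>') \<and>
     {x \<in> Om. \<forall>i\<in>J. x \<in> Ered d E (Q \<alpha>) i - F i} = {}"
      by (rule Suc(1)[OF Suc(2) Er Ered_null[OF Suc(2) Qs Es Suc(4)] \<epsilon>'])
  qed
  then have "\<exists>F. \<forall>\<alpha>\<in>AA. (\<forall>i\<in>J. F \<alpha> i \<in> sets (Sg {J - {i}}) \<and> measure M (F \<alpha> i) \<le> \<epsilon>') \<and>
     {x \<in> Om. \<forall>i\<in>J. x \<in> Ered d E (Q \<alpha>) i - F \<alpha> i} = {}" by (rule bchoice)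
  then obtain F where F: "\<forall>\<alpha>\<in>AA. (\<forall>i\<in>J. F \<alpha> i \<in> sets (Sg {J - {i}}) \<and> measure M (F \<alpha> i) \<le> \<epsilon>') \<and>
     {x \<in> Om. \<forall>i\<in>J. x \<in> Ered d E (Q \<alpha>) i - F \<alpha> i} = {}" by (elim exE)
  have F1: "F \<alpha> i \<in> sets (Sg {J - {i}})" "measure M (F \<alpha> i) \<le> \<epsilon>'" if "\<alpha> \<in> AA" "i \<in> J" for \<alpha> i
    using F that by blast+
  have F2: "{x \<in> Om. \<forall>i\<in>J. x \<in> Ered d E (Q \<alpha>) i - F \<alpha> i} = {}" if "\<alpha> \<in> AA" for \<alpha>
    using F that by blast
  define F0 where "F0 i = (\<Union>\<alpha>\<in>AA. E i \<inter> QE d (Q \<alpha>) i - Ered d E (Q \<alpha>) i)" for i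
  have F0_small: "measure M (F0 i) \<le> \<epsilon> / 4" if i: "i \<in> J" for i
  proof -
    \<comment> \<open>From the facet \<open>J - {i}\<close> only colours of its own
      \<open>d\<close>-subsets are visible. Forgetting all others makes the cells of distinct
      patterns disjoint, so the losses add up to a single multiple of the measure of
      \<open>Et i - E i\<close>.\<close>
    define rho where "rho \<alpha> = (\<lambda>i' f. if f \<in> Fi d i then \<alpha> i' f else (0::nat))" for \<alpha> :: "'a \<Rightarrow> 'a set \<Rightarrow> nat"
    define BB where "BB = rho ` AA"
    have finBB: "finite BB" using finAA by (simp add: BB_def)
    have Qrho: "Q (rho \<alpha>) f = Q \<alpha> f" if "f \<in> Fi d i" for \<alpha> f using that by (simp add: Q_def rho_def)
    have e1: "QE d (Q (rho \<alpha>)) i = QE d (Q \<alpha>) i" for \<alpha> by (rule QE_cong) (rule Qrho)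
    have e2: "Ered d E (Q (rho \<alpha>)) i = Ered d E (Q \<alpha>) i" for \<alpha> by (rule Ered_cong) (rule Qrho)
    have F0: "F0 i = (\<Union>\<beta>\<in>BB. E i \<inter> QE d (Q \<beta>) i - Ered d E (Q \<beta>) i)"
      by (simp add: F0_def BB_def e1 e2)
    have QEc: "\<beta> i' f = c i' f x" if "x \<in> QE d (Q \<beta>) i" "i' \<in> J" "f \<in> Fi d i" for \<beta> x i' f
      using that by (simp add: QE_def Q_def)
    have BBz: "\<beta> i' f = 0" if "\<beta> \<in> BB" "i' \<notin> J \<or> f \<notin> Fi d i" for \<beta> i' f
      using that by (auto simp: BB_def rho_def AA_def ax_def)
    have EtS: "Et i \<inter> QE d (Q \<beta>) i = S i (\<beta> i) \<inter> QE d (Q \<beta>) i" if b: "\<beta> \<in> BB" for \<beta>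
    proof -
      have "(\<lambda>f. c i f x) = \<beta> i" if x: "x \<in> QE d (Q \<beta>) i" for x
      proof
        fix f show "c i f x = \<beta> i f"
          using QEc[OF x i, of f] BBz[OF b, of i f] c0[OF i, of f x] by (cases "f \<in> Fi d i") auto
      qed
      then show ?thesis by (auto simp: Et_def sset_def QE_def)
    qed
    have disj: "disjoint_family_on (\<lambda>\<beta>. QE d (Q \<beta>) i) BB"
      unfolding disjoint_family_on_def
    proof (intro ballI impI)
      fix \<beta> \<beta>' assume b: "\<beta> \<in> BB" "\<beta>' \<in> BB" "\<beta> \<noteq> \<beta>'"
      show "QE d (Q \<beta>) i \<inter> QE d (Q \<beta>') i = {}"
      proof (rule ccontr)
        assume "\<not> ?thesis"
        then obtain x where x: "x \<in> QE d (Q \<beta>) i" "x \<in> QE d (Q \<beta>') i" by blast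
        have "\<beta> i' f = \<beta>' i' f" for i' f
          using QEc[OF x(1), of i' f] QEc[OF x(2), of i' f] BBz[OF b(1), of i' f] BBz[OF b(2), of i' f]
          by (cases "i' \<in> J \<and> f \<in> Fi d i") auto
        then show False using b(3) by blast
      qed
    qed
    have a0: "measure M (Et i \<inter> QE d (Q \<beta>) i - Ered d E (Q \<beta>) i)
        \<le> 2 * real (card J) * measure M (QE d (Q \<beta>) i \<inter> (Et i - E i))" if b: "\<beta> \<in> BB" for \<beta>
    proof -
      have "measure M (S i (\<beta> i) \<inter> QE d (Q \<beta>) i - Ered d E (Q \<beta>) i)
        \<le> 2 * real (card J) * measure M (S i (\<beta> i) \<inter> QE d (Q \<beta>) i - E i)"
        by (rule Ered_loss[where E=E, OF i _ Es[OF i] Sm[OF i]]) (rule Qs)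
      moreover have "S i (\<beta> i) \<inter> QE d (Q \<beta>) i - E i = QE d (Q \<beta>) i \<inter> (Et i - E i)"
        using EtS[OF b] by blast
      ultimately show ?thesis using EtS[OF b] by simp
    qed
    have UNm: "(\<Union>\<beta>\<in>BB. Et i \<inter> QE d (Q \<beta>) i - Ered d E (Q \<beta>) i) \<in> sets M"
      using finBB Etm[OF i] QEm Erm by (intro sets.finite_UN sets.Diff sets.Int)
    have dif: "E i - Et i \<in> sets M" "Et i - E i \<in> sets M" using Em[OF i] Etm[OF i] by auto
    have close: "measure M (E i - Et i) \<le> \<nu>" "measure M (Et i - E i) \<le> \<nu>"
    proof -
      have "measure M (E i - Et i) \<le> measure M ((E i - Et i) \<union> (Et i - E i))"
        "measure M (Et i - E i) \<le> measure M ((E i - Et i) \<union> (Et i - E i))"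
        using dif by (auto intro!: finite_measure_mono)
      then show "measure M (E i - Et i) \<le> \<nu>" "measure M (Et i - E i) \<le> \<nu>" using Et_close[OF i] by auto
    qed
    have "measure M (F0 i) \<le> measure M ((E i - Et i) \<union> (\<Union>\<beta>\<in>BB. Et i \<inter> QE d (Q \<beta>) i - Ered d E (Q \<beta>) i))"
      unfolding F0 by (rule finite_measure_mono) (use dif UNm in auto)
    also have "\<dots> \<le> measure M (E i - Et i) + measure M (\<Union>\<beta>\<in>BB. Et i \<inter> QE d (Q \<beta>) i - Ered d E (Q \<beta>) i)"
      using dif UNm by (intro measure_Un_le)
    also have "measure M (\<Union>\<beta>\<in>BB. Et i \<inter> QE d (Q \<beta>) i - Ered d E (Q \<beta>) i)
        \<le> (\<Sum>\<beta>\<in>BB. measure M (Et i \<inter> QE d (Q \<beta>) i - Ered d E (Q \<beta>) i))"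
      using finBB Etm[OF i] QEm Erm by (intro measure_UNION_le sets.Diff sets.Int)
    also have "\<dots> \<le> (\<Sum>\<beta>\<in>BB. 2 * real (card J) * measure M (QE d (Q \<beta>) i \<inter> (Et i - E i)))"
      using a0 by (rule sum_mono)
    also have "\<dots> = 2 * real (card J) * (\<Sum>\<beta>\<in>BB. measure M (QE d (Q \<beta>) i \<inter> (Et i - E i)))"
      by (simp add: sum_distrib_left)
    also have "(\<Sum>\<beta>\<in>BB. measure M (QE d (Q \<beta>) i \<inter> (Et i - E i))) = measure M (\<Union>\<beta>\<in>BB. QE d (Q \<beta>) i \<inter> (Et i - E i))"
    proof (rule finite_measure_finite_Union[OF finBB, symmetric])
      show "(\<lambda>\<beta>. QE d (Q \<beta>) i \<inter> (Et i - E i)) ` BB \<subseteq> sets M" using dif QEm by blast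
      show "disjoint_family_on (\<lambda>\<beta>. QE d (Q \<beta>) i \<inter> (Et i - E i)) BB"
        using disj unfolding disjoint_family_on_def by blast
    qed
    also have "\<dots> \<le> measure M (Et i - E i)" using dif by (intro finite_measure_mono) auto
    finally have "measure M (F0 i) \<le> measure M (E i - Et i) + 2 * real (card J) * measure M (Et i - E i)"
      by (simp add: mult_left_mono)
    moreover have "2 * real (card J) * measure M (Et i - E i) \<le> 2 * real (card J) * \<nu>"
      by (rule mult_left_mono[OF close(2)]) simp
    ultimately have "measure M (F0 i) \<le> \<nu> + 2 * real (card J) * \<nu>" using close(1) by linarith
    also have "\<dots> = (1 + 2 * real (card J)) * \<nu>" by (simp add: algebra_simps)
    also have "\<dots> = \<epsilon> / 4"
    proof -
      have "1 + 2 * real (card J) > 0" by (simp add: add_pos_nonneg)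
      then show ?thesis unfolding \<nu>_def by (simp add: field_simps)
    qed
    finally show ?thesis .
  qed
  have F0s: "F0 i \<in> sets (Sg {J - {i}})" if "i \<in> J" for i
    unfolding F0_def using Es[OF that] QEs Ers finAA by (intro sets.finite_UN sets.Diff sets.Int)
  define FF where "FF i = F0 i \<union> (\<Union>\<alpha>\<in>AA. F \<alpha> i)" for i
  have "FF i \<in> sets (Sg {J - {i}}) \<and> measure M (FF i) \<le> \<epsilon>" if i: "i \<in> J" for i
  proof
    have us: "(\<Union>\<alpha>\<in>AA. F \<alpha> i) \<in> sets (Sg {J - {i}})" using F1(1)[OF _ i] finAA by (intro sets.finite_UN)
    then show "FF i \<in> sets (Sg {J - {i}})" unfolding FF_def using F0s[OF i] by blast
    have Fm: "F \<alpha> i \<in> sets M" if "\<alpha> \<in> AA" for \<alpha> using F1(1)[OF that i] Sg_sub_M by blast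
    have "measure M (FF i) \<le> measure M (F0 i) + measure M (\<Union>\<alpha>\<in>AA. F \<alpha> i)"
      unfolding FF_def using F0s[OF i] us Sg_sub_M by (intro measure_Un_le) blast+
    also have "measure M (\<Union>\<alpha>\<in>AA. F \<alpha> i) \<le> (\<Sum>\<alpha>\<in>AA. measure M (F \<alpha> i))"
      using Fm finAA by (intro measure_UNION_le)
    also have "\<dots> \<le> (\<Sum>\<alpha>\<in>AA. \<epsilon>')" using F1(2)[OF _ i] by (intro sum_mono)
    also have "\<dots> \<le> \<epsilon> / 2" using Suc(5) by (simp add: \<epsilon>'_def field_simps)
    finally show "measure M (FF i) \<le> \<epsilon>" using F0_small[OF i] Suc(5) by simp
  qed
  moreover have "{x \<in> Om. \<forall>i\<in>J. x \<in> E i - FF i} = {}"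
  proof (rule ccontr)
    assume "\<not> ?thesis"
    then obtain x where x: "x \<in> Om" "\<forall>i\<in>J. x \<in> E i - FF i" by blast
    have a: "ax x \<in> AA" using x by (auto simp: AA_def)
    have "x \<in> Ered d E (Q (ax x)) i - F (ax x) i" if i: "i \<in> J" for i
    proof -
      have "x \<in> QE d (Q (ax x)) i" using x(1) by (auto simp: QE_def Q_def ax_def)
      then show ?thesis using x(2) i a unfolding FF_def F0_def by blast
    qed
    then have "x \<in> {x \<in> Om. \<forall>i\<in>J. x \<in> Ered d E (Q (ax x)) i - F (ax x) i}" using x(1) by blast
    then show False using F2[OF a] x(1) \<open>\<And>i. i \<in> J \<Longrightarrow> x \<in> Ered d E (Q (ax x)) i - F (ax x) i\<close> by blast
  qed
  ultimately show ?case by blast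
qed

end

text \<open>A sequence of counterexamples with \<delta> tending to 0 gives facet cylinders with null
  intersection in the ultraproduct. Every member of \<open>T\<close> lies in all of them, so after
  removal and \<open>compactness\<close> it lies in one of finitely many internal cylinders of small
  measure. By injectivity each member accounts for \<open>n\<close> points of such a cylinder, so
  \<open>T\<close> would be too small.\<close>

theorem simplex_removal:
  fixes J :: "'a set" and c :: real
  assumes finJ: "finite J" and Jne: "J \<noteq> {}" and c: "c > 0"
  shows "\<exists>\<delta>>0. \<forall>n>0. \<forall>T. T \<subseteq> PiE J (\<lambda>_. {..<n}) \<longrightarrow>
     (\<forall>i\<in>J. inj_on (\<lambda>x. restrict x (J - {i})) T) \<longrightarrow> c * real n ^ (card J - 1) \<le> real (card T) \<longrightarrow>
     \<delta> * real n ^ card J \<le> real (card {x \<in> PiE J (\<lambda>_. {..<n}). \<forall>i\<in>J. \<exists>t\<in>T. \<forall>j\<in>J - {i}. t j = x j})"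
proof (rule ccontr)
  assume neg: "\<not> ?thesis"
  define W where "W n T = {x \<in> PiE J (\<lambda>_. {..<n}). \<forall>i\<in>J. \<exists>t\<in>T. \<forall>j\<in>J - {i}. t j = x j}" for n :: nat and T
  have "\<exists>p. fst p > 0 \<and> snd p \<subseteq> PiE J (\<lambda>_. {..<fst p}) \<and>
     (\<forall>i\<in>J. inj_on (\<lambda>x. restrict x (J - {i})) (snd p)) \<and> c * real (fst p) ^ (card J - 1) \<le> real (card (snd p)) \<and>
     real (card (W (fst p) (snd p))) < 1 / real (Suc N) * real (fst p) ^ card J" for N
  proof -
    have "1 / real (Suc N) > 0" by simp
    then have "\<not> (\<forall>n>0. \<forall>T. T \<subseteq> PiE J (\<lambda>_. {..<n}) \<longrightarrow>
     (\<forall>i\<in>J. inj_on (\<lambda>x. restrict x (J - {i})) T) \<longrightarrow> c * real n ^ (card J - 1) \<le> real (card T) \<longrightarrow>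
     1 / real (Suc N) * real n ^ card J \<le> real (card (W n T)))"
      using neg unfolding W_def by blast
    then obtain n T where "n > 0" "T \<subseteq> PiE J (\<lambda>_. {..<n})" "\<forall>i\<in>J. inj_on (\<lambda>x. restrict x (J - {i})) T"
      "c * real n ^ (card J - 1) \<le> real (card T)" "real (card (W n T)) < 1 / real (Suc N) * real n ^ card J"
      by (auto simp: not_le)
    then show ?thesis by (intro exI[of _ "(n, T)"]) simp
  qed
  then obtain p where p: "\<And>N. fst (p N) > 0" "\<And>N. snd (p N) \<subseteq> PiE J (\<lambda>_. {..<fst (p N)})"
     "\<And>N. \<forall>i\<in>J. inj_on (\<lambda>x. restrict x (J - {i})) (snd (p N))"
     "\<And>N. c * real (fst (p N)) ^ (card J - 1) \<le> real (card (snd (p N)))"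
     "\<And>N. real (card (W (fst (p N)) (snd (p N)))) < 1 / real (Suc N) * real (fst (p N)) ^ card J"
    by metis
  define n where "n N = fst (p N)" for N
  define T where "T N = snd (p N)" for N
  obtain U :: "nat filter" where U: "U \<le> sequentially" "U \<noteq> bot"
    "\<And>P. eventually P U \<or> eventually (\<lambda>x. \<not> P x) U" by (rule free_ultrafilter_exists) blast
  interpret ultraproduct J n U
    using finJ p(1) U by unfold_locales (auto simp: n_def)
  obtain M where M: "space M = Om" "sets M = sigma_sets Om (Alg J)" "prob_space M" "\<And>A. measure M (IS A) = mu A"
    using ex_loeb_measure by blast
  interpret loeb J n U M
    by (intro loeb.intro ultraproduct_axioms loeb_axioms.intro M)
  have TV: "T N \<subseteq> V N" for N using p(2) by (simp add: T_def V_def n_def)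
  have Tinj: "inj_on (\<lambda>x. restrict x (J - {i})) (T N)" if "i \<in> J" for i N using p(3) that by (simp add: T_def)
  have Tcard: "c * real (n N) ^ (card J - 1) \<le> real (card (T N))" for N using p(4) by (simp add: T_def n_def)
  define A where "A i N = {x. \<exists>t\<in>T N. \<forall>j\<in>J - {i}. t j = x j}" for i N
  have cylA: "cyl (J - {i}) N (A i N)" for i N
    unfolding cyl_def A_def by simp
  have cJ: "card J > 0" using finJ Jne by (simp add: card_gt_0_iff)
  define E where "E i = IS (A i)" for i
  have Es: "E i \<in> sets (Sg (Lo (card J) (J - {i})))" if "i \<in> J" for i
  proof -
    have "E i \<in> Alg (J - {i})" using cylA by (auto simp: E_def Alg_def)
    moreover have "card (J - {i}) < card J" using that finJ by (intro psubset_card_mono) auto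
    ultimately show ?thesis unfolding sets_Sg by blast
  qed
  have null: "measure M {x \<in> Om. \<forall>i\<in>J. x \<in> E i} = 0"
  proof -
    let ?B = "\<lambda>N. {x. \<forall>i\<in>J. x \<in> A i N}"
    have "{x \<in> Om. \<forall>i\<in>J. x \<in> E i} = IS ?B"
      unfolding E_def IS_def using finJ by (auto simp: eventually_ball_finite_distrib)
    then have 1: "measure M {x \<in> Om. \<forall>i\<in>J. x \<in> E i} = mu ?B" using M(4) by simp
    have le: "avg N (indicator (?B N)) \<le> 1 / real (Suc N)" for N
    proof -
      have "?B N \<inter> V N = W (n N) (T N)" by (auto simp: W_def V_def A_def)
      then have "real (card (?B N \<inter> V N)) \<le> 1 / real (Suc N) * real (card (V N))"
        using p(5)[of N] by (simp add: n_def T_def card_V less_imp_le)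
      then show ?thesis unfolding avg_indicator
        using card_V_pos[of N] by (simp add: pos_divide_le_eq del: card_V_pos)
    qed
    have "(\<lambda>N. 1 / real (Suc N)) \<longlonglongrightarrow> 0" using LIMSEQ_inverse_real_of_nat by (simp add: inverse_eq_divide)
    then have "((\<lambda>N. 1 / real (Suc N)) \<longlongrightarrow> 0) U" by (rule tendsto_mono[OF U_le])
    then have "mu ?B \<le> 0" using tendsto_le[OF U_nontriv _ mu_lim[of ?B]] le by auto
    then show ?thesis using 1 mu_nonneg[of ?B] by simp
  qed
  \<comment> \<open>The covers below have measure at most \<open>2 * \<epsilon>\<close> each, hence
    at most \<open>c / 2\<close> in total.\<close>
  define \<epsilon> where "\<epsilon> = c / (4 * real (card J))"
  have \<epsilon>: "\<epsilon> > 0" using c cJ by (simp add: \<epsilon>_def)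
  obtain F where F: "\<And>i. i \<in> J \<Longrightarrow> F i \<in> sets (Sg {J - {i}})" "\<And>i. i \<in> J \<Longrightarrow> measure M (F i) \<le> \<epsilon>"
    "{x \<in> Om. \<forall>i\<in>J. x \<in> E i - F i} = {}"
    using removal[OF Jne Es null \<epsilon>] by blast
  have "\<forall>i\<in>J. \<exists>D. (\<forall>m N. cyl (J - {i}) N (D m N)) \<and> F i \<subseteq> (\<Union>m::nat. IS (D m)) \<and>
      measure M (\<Union>m. IS (D m)) \<le> 2 * \<epsilon>"
  proof
    fix i assume i: "i \<in> J"
    have "\<exists>B::nat \<Rightarrow> _. range B \<subseteq> Alg (J - {i}) \<and> F i \<subseteq> (\<Union>m. B m) \<and> measure M (\<Union>m. B m) \<le> measure M (F i) + \<epsilon>"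
      using F(1)[OF i] Alg_algebra[of "J - {i}"] Sg_sub_M[of "{J - {i}}"]
      by (intro algebra_outer_cover[OF finite_measure_axioms _ _ _ \<epsilon>]) (simp_all add: M(1) sets_Sg1)
    then obtain B where B: "range B \<subseteq> Alg (J - {i})" "F i \<subseteq> (\<Union>m::nat. B m)" "measure M (\<Union>m. B m) \<le> measure M (F i) + \<epsilon>"
      by blast
    have "\<forall>m. \<exists>D. B m = IS D \<and> (\<forall>N. cyl (J - {i}) N (D N))" using B(1) unfolding Alg_def by blast
    then obtain D where D: "\<And>m. B m = IS (D m)" "\<And>m N. cyl (J - {i}) N (D m N)" by metis
    show "\<exists>D. (\<forall>m N. cyl (J - {i}) N (D m N)) \<and> F i \<subseteq> (\<Union>m::nat. IS (D m)) \<and> measure M (\<Union>m. IS (D m)) \<le> 2 * \<epsilon>"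
    proof (intro exI[of _ D] conjI allI D(2))
      show "F i \<subseteq> (\<Union>m. IS (D m))" using B(2) D(1) by simp
      show "measure M (\<Union>m. IS (D m)) \<le> 2 * \<epsilon>" using B(3) F(2)[OF i] D(1) by simp
    qed
  qed
  then have "\<exists>D. \<forall>i\<in>J. (\<forall>m N. cyl (J - {i}) N (D i m N)) \<and> F i \<subseteq> (\<Union>m::nat. IS (D i m)) \<and>
      measure M (\<Union>m. IS (D i m)) \<le> 2 * \<epsilon>" by (rule bchoice)
  then obtain D where D: "\<forall>i\<in>J. (\<forall>m N. cyl (J - {i}) N (D i m N)) \<and> F i \<subseteq> (\<Union>m::nat. IS (D i m)) \<and>
      measure M (\<Union>m. IS (D i m)) \<le> 2 * \<epsilon>" by (elim exE)
  have D1: "cyl (J - {i}) N (D i m N)" if "i \<in> J" for i m N using D that by blast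
  have D2: "F i \<subseteq> (\<Union>m::nat. IS (D i m))" if "i \<in> J" for i using D that by blast
  have D3: "measure M (\<Union>m. IS (D i m)) \<le> 2 * \<epsilon>" if "i \<in> J" for i using D that by blast
  have "IS T \<subseteq> (\<Union>m. IS (\<lambda>N. \<Union>i\<in>J. D i m N))"
  proof
    fix x assume x: "x \<in> IS T"
    then have xO: "x \<in> Om" using IS_subset by blast
    have "x \<in> E i" for i
    proof -
      have "IS T \<subseteq> IS (A i)" unfolding IS_mono A_def by (rule always_eventually) blast
      then show ?thesis using x by (auto simp: E_def)
    qed
    then obtain i where i: "i \<in> J" "x \<in> F i" using F(3) xO by blast
    then obtain m where "x \<in> IS (D i m)" using D2 by blast
    moreover have "IS (D i m) \<subseteq> IS (\<lambda>N. \<Union>i\<in>J. D i m N)"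
      unfolding IS_mono using i(1) by (intro always_eventually) blast
    ultimately show "x \<in> (\<Union>m. IS (\<lambda>N. \<Union>i\<in>J. D i m N))" by blast
  qed
  then obtain k where k: "IS T \<subseteq> (\<Union>m\<le>k. IS (\<lambda>N. \<Union>i\<in>J. D i m N))" by (rule compactness)
  define G where "G i N = (\<Union>m\<le>k. D i m N)" for i N
  have "IS T \<subseteq> IS (\<lambda>N. \<Union>i\<in>J. G i N)"
  proof
    fix x assume "x \<in> IS T"
    then obtain m where m: "m \<le> k" "x \<in> IS (\<lambda>N. \<Union>i\<in>J. D i m N)" using k by blast
    have "IS (\<lambda>N. \<Union>i\<in>J. D i m N) \<subseteq> IS (\<lambda>N. \<Union>i\<in>J. G i N)"
      unfolding IS_mono G_def using m(1) by (intro always_eventually) blast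
    then show "x \<in> IS (\<lambda>N. \<Union>i\<in>J. G i N)" using m(2) by blast
  qed
  then have ev: "\<forall>\<^sub>F N in U. T N \<inter> V N \<subseteq> (\<Union>i\<in>J. G i N)" unfolding IS_mono .
  have cylG: "cyl (J - {i}) N (G i N)" if "i \<in> J" for i N
    using D1[OF that] unfolding G_def cyl_def by blast
  \<comment> \<open>Membership in \<open>G i\<close> ignores the coordinate \<open>i\<close>, so all
    \<open>n N\<close> points \<open>t(i := a)\<close> stay inside. They are distinct for distinct
    \<open>t\<close>, since members of \<open>T N\<close> already differ off
    \<open>i\<close>.\<close>
  have count: "real (card (T N \<inter> G i N)) \<le> avg N (indicator (G i N)) * real (n N) ^ (card J - 1)" if i: "i \<in> J" for i N
  proof -
    have finT: "finite (T N)" using TV finite_V finite_subset by blast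
    have "inj_on (\<lambda>(t, a). t(i := a)) ((T N \<inter> G i N) \<times> {..<n N})"
    proof (rule inj_onI, clarify)
      fix t a t' a' assume t: "t \<in> T N" "t' \<in> T N" and eq: "t(i := a) = t'(i := a')"
      have "restrict t (J - {i}) = restrict t' (J - {i})"
      proof
        fix j show "restrict t (J - {i}) j = restrict t' (J - {i}) j"
          using fun_cong[OF eq, of j] by (auto simp: restrict_def split: if_splits)
      qed
      then have "t = t'" using Tinj[OF i, of N] t by (auto dest: inj_onD)
      moreover have "a = a'" using fun_cong[OF eq, of i] by simp
      ultimately show "t = t' \<and> a = a'" by simp
    qed
    moreover have "(\<lambda>(t, a). t(i := a)) ` ((T N \<inter> G i N) \<times> {..<n N}) \<subseteq> G i N \<inter> V N"
    proof
      fix y assume "y \<in> (\<lambda>(t, a). t(i := a)) ` ((T N \<inter> G i N) \<times> {..<n N})"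
      then obtain t a where t: "t \<in> T N" "t \<in> G i N" "a \<in> {..<n N}" and y: "y = t(i := a)" by auto
      have tV: "t \<in> V N" using t TV by blast
      have tV': "t(i := a) \<in> V N" using tV t(3) i by (auto simp: V_def PiE_iff extensional_def)
      have "\<forall>j\<in>J - {i}. t j = (t(i := a)) j" by simp
      then have "t(i := a) \<in> G i N" using cylG[OF i, of N] t(2) tV tV' unfolding cyl_def by blast
      then show "y \<in> G i N \<inter> V N" using tV' y by blast
    qed
    ultimately have "card ((T N \<inter> G i N) \<times> {..<n N}) \<le> card (G i N \<inter> V N)"
      using card_inj_on_le[of "\<lambda>(t, a). t(i := a)"] finite_V by blast
    then have "card (T N \<inter> G i N) * n N \<le> card (G i N \<inter> V N)" by (simp add: card_cartesian_product)
    then have le: "real (card (T N \<inter> G i N)) * real (n N) \<le> real (card (G i N \<inter> V N))"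
      by (metis of_nat_le_iff of_nat_mult)
    have pw: "real (n N) ^ card J = real (n N) * real (n N) ^ (card J - 1)"
      using cJ by (metis Suc_diff_1 power_Suc)
    have "avg N (indicator (G i N)) * real (n N) ^ (card J - 1) = real (card (G i N \<inter> V N)) / real (n N)"
      unfolding avg_indicator card_V of_nat_power pw using n_pos[of N] by (simp add: field_simps)
    then show ?thesis using le n_pos[of N] by (simp add: pos_le_divide_eq)
  qed
  have "\<forall>\<^sub>F N in U. c \<le> (\<Sum>i\<in>J. avg N (indicator (G i N)))"
    using ev
  proof eventually_elim
    case (elim N)
    have finT: "finite (T N)" using TV finite_V finite_subset by blast
    have "T N = (\<Union>i\<in>J. T N \<inter> G i N)" using elim TV[of N] by blast
    then have "card (T N) \<le> (\<Sum>i\<in>J. card (T N \<inter> G i N))" using card_UN_le[OF finJ, of "\<lambda>i. T N \<inter> G i N"] by simp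
    then have "real (card (T N)) \<le> (\<Sum>i\<in>J. real (card (T N \<inter> G i N)))" by (metis of_nat_le_iff of_nat_sum)
    also have "\<dots> \<le> (\<Sum>i\<in>J. avg N (indicator (G i N)) * real (n N) ^ (card J - 1))" using count by (rule sum_mono)
    also have "\<dots> = (\<Sum>i\<in>J. avg N (indicator (G i N))) * real (n N) ^ (card J - 1)" by (simp add: sum_distrib_right)
    finally have "c * real (n N) ^ (card J - 1) \<le> (\<Sum>i\<in>J. avg N (indicator (G i N))) * real (n N) ^ (card J - 1)"
      using Tcard[of N] by linarith
    then show ?case using n_pos[of N] by simp
  qed
  moreover have "((\<lambda>N. \<Sum>i\<in>J. avg N (indicator (G i N))) \<longlongrightarrow> (\<Sum>i\<in>J. mu (G i))) U"
    by (intro tendsto_sum mu_lim)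
  ultimately have "c \<le> (\<Sum>i\<in>J. mu (G i))" using tendsto_lowerbound U_nontriv by blast
  also have "\<dots> \<le> (\<Sum>i\<in>J. 2 * \<epsilon>)"
  proof (rule sum_mono)
    fix i assume i: "i \<in> J"
    have "IS (\<lambda>N. \<Union>m\<le>k. D i m N) \<subseteq> (\<Union>m. IS (D i m))"
    proof (induction k)
      case 0 then show ?case by auto
    next
      case (Suc k)
      have "IS (\<lambda>N. \<Union>m\<le>Suc k. D i m N) = IS (\<lambda>N. \<Union>m\<le>k. D i m N) \<union> IS (D i (Suc k))"
        unfolding IS_Un by (simp add: atMost_Suc Un_commute)
      then show ?case using Suc by blast
    qed
    then have "measure M (IS (G i)) \<le> measure M (\<Union>m. IS (D i m))"
      unfolding G_def by (intro finite_measure_mono) auto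
    then show "mu (G i) \<le> 2 * \<epsilon>" using D3[OF i] M(4) by simp
  qed
  also have "\<dots> = c / 2" using cJ by (simp add: \<epsilon>_def field_simps)
  finally show False using c by simp
qed

section \<open>Copies of configurations\<close>

text \<open>The excess \<open>k\<close> is the natural exponent: among \<open>n ^ 4\<close>
  quadruples about \<open>n ^ 2\<close> are edges, so each edge costs a factor \<open>n ^ 2\<close>
  and heuristically \<open>n ^ k\<close> copies are expected.\<close>

definition config :: "'a set set \<Rightarrow> nat \<Rightarrow> bool" where
  "config E k \<longleftrightarrow> finite E \<and> (\<forall>e\<in>E. card e = 4) \<and> card (\<Union>E) = 2 * card E + k"

definition copies :: "'a set set \<Rightarrow> nat set set \<Rightarrow> nat \<Rightarrow> ('a \<Rightarrow> nat) set" where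
  "copies E H n = {\<phi> \<in> PiE (\<Union>E) (\<lambda>_. {..<n}). inj_on \<phi> (\<Union>E) \<and> (\<forall>e\<in>E. \<phi> ` e \<in> H)}"

text \<open>If \<open>config E k\<close>, \<open>card A = k\<close> and \<open>hall E A\<close>, then outside any vertex set containing \<open>A\<close> a copy has
  at most twice as many private vertices as private edges; so a large sunflower of copies that agree on \<open>A\<close> is
  a \<open>good\<close> set.\<close>

definition hall :: "'a set set \<Rightarrow> 'a set \<Rightarrow> bool" where
  "hall E A \<longleftrightarrow> (\<forall>E'\<subseteq>E. 2 * card E' \<le> card (\<Union>E' - A))"

text \<open>Lets a configuration be cut down to any number of edges with a controlled surplus of
  vertices, so that a prescribed vertex budget can be met.\<close>

definition flex :: "'a set set \<Rightarrow> nat \<Rightarrow> bool" where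
  "flex E h \<longleftrightarrow> (\<forall>j\<le>card E. \<exists>E'\<subseteq>E. card E' = j \<and> card (\<Union>E') \<le> 2 * j + h)"

text \<open>The degree bound ensures that discarding the edges which meet a bounded vertex set costs
  only O(n) of the order of \<open>n ^ 2\<close> edges.\<close>

definition big :: "real \<Rightarrow> nat \<Rightarrow> nat set set \<Rightarrow> bool" where
  "big \<epsilon> n H \<longleftrightarrow> H \<subseteq> {e. e \<subseteq> {..<n} \<and> card e = 4} \<and> (\<forall>y. card {e \<in> H. y \<in> e} \<le> n) \<and>
     \<epsilon> * real n ^ 2 \<le> real (card H)"

definition good :: "nat \<Rightarrow> nat \<Rightarrow> nat set set \<Rightarrow> bool" where
  "good p D H \<longleftrightarrow> (\<exists>J\<subseteq>H. finite J \<and> card (\<Union>J) \<le> p \<and> p \<le> 2 * card J + D)"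

text \<open>Hosts with a \<open>good\<close> set are exempt, as nothing remains to be shown for
  them. Only under this exemption can fibres be bounded and the recursion continue.\<close>

definition abundant :: "nat \<Rightarrow> nat \<Rightarrow> 'a set set \<Rightarrow> nat \<Rightarrow> bool" where
  "abundant p D E k \<longleftrightarrow> (\<forall>\<epsilon>>0. \<exists>\<delta>>0. \<exists>n0. \<forall>n\<ge>n0. \<forall>H. big \<epsilon> n H \<longrightarrow> \<not> good p D H \<longrightarrow>
     \<delta> * real n ^ k \<le> real (card (copies E H n)))"

definition bounded_fibres :: "nat \<Rightarrow> nat \<Rightarrow> 'a set set \<Rightarrow> nat \<Rightarrow> bool" where
  "bounded_fibres p D E k \<longleftrightarrow> (\<forall>\<epsilon>>0. \<exists>L n0. \<forall>n\<ge>n0. \<forall>H. big \<epsilon> n H \<longrightarrow> \<not> good p D H \<longrightarrow>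
     (\<forall>A a. A \<subseteq> \<Union>E \<longrightarrow> card A = k \<longrightarrow> hall E A \<longrightarrow>
        card {\<phi> \<in> copies E H n. \<forall>w\<in>A. \<phi> w = a w} \<le> L))"

section \<open>Sunflowers of copies and bounded fibres\<close>

lemma config_finite:
  assumes "config E k" shows "finite E" "finite (\<Union>E)" "\<And>e. e \<in> E \<Longrightarrow> finite e" "\<And>e. e \<in> E \<Longrightarrow> card e = 4"
proof -
  show "finite E" "\<And>e. e \<in> E \<Longrightarrow> card e = 4" using assms by (auto simp: config_def)
  then show f: "finite e" if "e \<in> E" for e using that card.infinite[of e] by fastforce
  then show "finite (\<Union>E)" using \<open>finite E\<close> by blast
qed

lemma finite_copies: "finite (\<Union>E) \<Longrightarrow> finite (copies E H n)"
  unfolding copies_def by (rule finite_subset[of _ "PiE (\<Union>E) (\<lambda>_. {..<n})"]) (auto intro: finite_PiE)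

lemma copy_image:
  assumes \<phi>: "\<phi> \<in> copies E H n" and E': "E' \<subseteq> E" "finite (\<Union>E)"
  shows "(`) \<phi> ` E' \<subseteq> H" "card ((`) \<phi> ` E') = card E'" "\<Union>((`) \<phi> ` E') = \<phi> ` \<Union>E'"
    "card (\<phi> ` \<Union>E') = card (\<Union>E')"
proof -
  have inj: "inj_on \<phi> (\<Union>E)" using \<phi> by (simp add: copies_def)
  show "(`) \<phi> ` E' \<subseteq> H" using \<phi> E' by (auto simp: copies_def)
  have "inj_on ((`) \<phi>) E'"
  proof (rule inj_onI)
    fix e e' assume e: "e \<in> E'" "e' \<in> E'" "\<phi> ` e = \<phi> ` e'"
    then have "e \<subseteq> \<Union>E" "e' \<subseteq> \<Union>E" using E'(1) by auto
    then show "e = e'" using inj_on_image_eq_iff[OF inj] e(3) by simp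
  qed
  then show "card ((`) \<phi> ` E') = card E'" by (rule card_image)
  show "\<Union>((`) \<phi> ` E') = \<phi> ` \<Union>E'" by auto
  show "card (\<phi> ` \<Union>E') = card (\<Union>E')"
    by (rule card_image) (use inj E' in \<open>auto intro: inj_on_subset\<close>)
qed

lemma big_finite: "big \<epsilon> n H \<Longrightarrow> finite H"
  unfolding big_def by (rule finite_subset[of _ "Pow {..<n}"]) auto

text \<open>Take half of \<open>r - h\<close> edges, rounded down; the summand 1 pays for the
  rounding. For \<open>r < h\<close> the empty set will do.\<close>

lemma flex_pick:
  assumes "flex E h" "r \<le> 2 * card E + h"
  obtains E' where "E' \<subseteq> E" "card (\<Union>E') \<le> r" "r \<le> 2 * card E' + h + 1"
proof (cases "r < h")
  case True then show thesis using that[of "{}"] by simp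
next
  case False
  define j where "j = (r - h) div 2"
  have j: "j \<le> card E" using assms(2) by (simp add: j_def)
  obtain E' where E': "E' \<subseteq> E" "card E' = j" "card (\<Union>E') \<le> 2 * j + h" using assms(1) j unfolding flex_def by blast
  have "2 * j + h \<le> r" "r \<le> 2 * j + h + 1" using False by (auto simp: j_def)
  then show thesis using that[OF E'(1)] E' by simp
qed

text \<open>A single copy is enough: \<open>flex\<close> cuts it down to at most \<open>p\<close>
  vertices, losing \<open>h + 1\<close>.\<close>

lemma abundant_good:
  assumes ab: "abundant p D E k" and E: "config E k" "flex E h" and p: "p \<le> 2 * card E + h" and D: "h + 1 \<le> D"
    and "\<epsilon> > 0"
  shows "\<exists>n0. \<forall>n\<ge>n0. \<forall>H. big \<epsilon> n H \<longrightarrow> good p D H"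
proof -
  obtain \<delta> n0 where \<delta>: "\<delta> > 0" and n0: "\<And>n H. n \<ge> n0 \<Longrightarrow> big \<epsilon> n H \<Longrightarrow> \<not> good p D H \<Longrightarrow>
     \<delta> * real n ^ k \<le> real (card (copies E H n))" using ab \<open>\<epsilon> > 0\<close> unfolding abundant_def by blast
  have "good p D H" if n: "n \<ge> max n0 1" and H: "big \<epsilon> n H" for n H
  proof (rule ccontr)
    assume ng: "\<not> good p D H"
    have "0 < \<delta> * real n ^ k" using \<delta> n by simp
    also have "\<dots> \<le> real (card (copies E H n))" using n0[OF _ H ng] n by simp
    finally have "copies E H n \<noteq> {}" by auto
    then obtain \<phi> where \<phi>: "\<phi> \<in> copies E H n" by blast
    obtain E' where E': "E' \<subseteq> E" "card (\<Union>E') \<le> p" "p \<le> 2 * card E' + h + 1" using flex_pick[OF E(2) p] .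
    note ci = copy_image[OF \<phi> E'(1) config_finite(2)[OF E(1)]]
    have "finite E'" using E'(1) config_finite(1)[OF E(1)] finite_subset by blast
    then have "good p D H" unfolding good_def
      using ci E' D by (intro exI[of _ "(`) \<phi> ` E'"]) auto
    then show False using ng by simp
  qed
  then show ?thesis by blast
qed

text \<open>The images of \<open>Suc Q\<close> chosen maps occupy at most
  \<open>Suc Q * card P\<close> values, and at most \<open>card P * L\<close> maps pass through a
  given one of them; some map of \<open>C\<close> avoids them all.\<close>

lemma greedy_disjoint:
  fixes C :: "('a \<Rightarrow> nat) set"
  assumes fin: "finite C" "finite P" "P \<noteq> {}"
    and L: "\<And>w y. w \<in> P \<Longrightarrow> card {\<phi> \<in> C. \<phi> w = y} \<le> L"
    and big: "card C > Q * card P * card P * L"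
  shows "\<exists>S\<subseteq>C. card S = Suc Q \<and> (\<forall>\<phi>\<in>S. \<forall>\<psi>\<in>S. \<phi> \<noteq> \<psi> \<longrightarrow> \<phi> ` P \<inter> \<psi> ` P = {})"
  using big
proof (induction Q)
  case 0
  then have "C \<noteq> {}" by auto
  then obtain \<phi> where "\<phi> \<in> C" by blast
  then show ?case by (intro exI[of _ "{\<phi>}"]) auto
next
  case (Suc Q)
  have "Q * card P * card P * L \<le> Suc Q * card P * card P * L" by simp
  then have "Q * card P * card P * L < card C" using Suc(2) by linarith
  from Suc(1)[OF this] obtain S where S0: "S \<subseteq> C \<and> card S = Suc Q \<and> (\<forall>\<phi>\<in>S. \<forall>\<psi>\<in>S. \<phi> \<noteq> \<psi> \<longrightarrow> \<phi> ` P \<inter> \<psi> ` P = {})"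
    by (elim exE)
  then have S: "S \<subseteq> C" "card S = Suc Q" by blast+
  have S3: "\<phi> ` P \<inter> \<psi> ` P = {}" if "\<phi> \<in> S" "\<psi> \<in> S" "\<phi> \<noteq> \<psi>" for \<phi> \<psi> using S0 that by blast
  have finS: "finite S" using S(1) fin(1) finite_subset by blast
  define Y where "Y = (\<Union>\<phi>\<in>S. \<phi> ` P)"
  have finY: "finite Y" using finS fin(2) by (simp add: Y_def)
  have "card Y \<le> (\<Sum>\<phi>\<in>S. card (\<phi> ` P))" unfolding Y_def by (rule card_UN_le[OF finS])
  also have "\<dots> \<le> (\<Sum>\<phi>\<in>S. card P)" by (rule sum_mono) (rule card_image_le[OF fin(2)])
  finally have cY: "card Y \<le> Suc Q * card P" using S(2) by simp
  let ?B = "\<Union>(w,y)\<in>P \<times> Y. {\<phi> \<in> C. \<phi> w = y}"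
  have "card ?B \<le> (\<Sum>x\<in>P \<times> Y. card (case x of (w,y) \<Rightarrow> {\<phi> \<in> C. \<phi> w = y}))"
    by (rule card_UN_le) (use fin(2) finY in simp)
  also have "\<dots> \<le> (\<Sum>x\<in>P \<times> Y. L)" by (rule sum_mono) (use L in auto)
  also have "\<dots> = card P * card Y * L" by (simp add: card_cartesian_product)
  also have "\<dots> \<le> card P * (Suc Q * card P) * L" using cY by simp
  also have "\<dots> = Suc Q * card P * card P * L" by (simp only: mult_ac)
  also have "\<dots> < card C" using Suc(2) .
  finally have lt: "card ?B < card C" .
  have "\<not> C \<subseteq> ?B"
  proof
    assume "C \<subseteq> ?B"
    moreover have "finite ?B" by (rule finite_subset[OF _ fin(1)]) auto
    ultimately have "card C \<le> card ?B" by (intro card_mono)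
    then show False using lt by simp
  qed
  then obtain \<psi> where \<psi>: "\<psi> \<in> C" "\<psi> \<notin> ?B" by blast
  have disj: "\<psi> ` P \<inter> Y = {}" using \<psi> by auto
  have "\<psi> \<notin> S"
  proof
    assume "\<psi> \<in> S"
    then have "\<psi> ` P \<subseteq> Y" by (auto simp: Y_def)
    then show False using disj fin(3) by auto
  qed
  then have "card (insert \<psi> S) = Suc (Suc Q)" using finS S(2) by simp
  moreover have "\<phi> ` P \<inter> \<psi>' ` P = {}" if "\<phi> \<in> insert \<psi> S" "\<psi>' \<in> insert \<psi> S" "\<phi> \<noteq> \<psi>'" for \<phi> \<psi>'
  proof -
    have "\<psi> ` P \<inter> t ` P = {}" if "t \<in> S" for t using disj that by (auto simp: Y_def)
    then show ?thesis using that S3 by blast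
  qed
  ultimately show ?case using S(1) \<psi>(1) by (intro exI[of _ "insert \<psi> S"]) blast
qed

text \<open>Edges inside the kernel \<open>K\<close> count once, and by \<open>hall\<close> there
  are at most half of \<open>card K - k\<close> of them. As \<open>E\<close> has excess
  \<open>k\<close>, the vertices outside \<open>K\<close> then number at most twice the edges not
  inside \<open>K\<close>, so further petals do not raise the excess above \<open>k\<close>.\<close>

lemma sunflower_count:
  assumes conf: "config E k" and K: "K \<subseteq> \<Union>E" "K \<noteq> \<Union>E" and b: "\<And>\<phi>. \<phi> \<in> S \<Longrightarrow> \<phi> \<in> copies E H n \<and> (\<forall>w\<in>K. \<phi> w = b w)"
    and disj: "\<And>\<phi> \<psi>. \<phi> \<in> S \<Longrightarrow> \<psi> \<in> S \<Longrightarrow> \<phi> \<noteq> \<psi> \<Longrightarrow> \<phi> ` (\<Union>E - K) \<inter> \<psi> ` (\<Union>E - K) = {}"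
    and S: "finite S" "S \<noteq> {}" and A: "A \<subseteq> K" "card A = k" "hall E A"
  defines "J \<equiv> (\<Union>\<phi>\<in>S. (`) \<phi> ` E)"
  shows "J \<subseteq> H" "finite J" "card (\<Union>J) \<le> card K + card S * (card (\<Union>E) - card K)"
    "card K + card S * (card (\<Union>E) - card K) \<le> 2 * card J + k"
proof -
  note fin = config_finite[OF conf]
  let ?W = "\<Union>E"
  let ?EK = "{e \<in> E. e \<subseteq> K}"
  have finK: "finite K" using K(1) fin(2) finite_subset by blast
  have inj: "inj_on \<phi> ?W" if "\<phi> \<in> S" for \<phi> using b[OF that] by (simp add: copies_def)
  show "J \<subseteq> H" using b by (auto simp: J_def copies_def)
  show finJ: "finite J" using S fin by (simp add: J_def)
  have UJ: "\<Union>J \<subseteq> b ` K \<union> (\<Union>\<phi>\<in>S. \<phi> ` (?W - K))"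
  proof
    fix y assume "y \<in> \<Union>J"
    then obtain \<phi> e w where *: "\<phi> \<in> S" "e \<in> E" "w \<in> e" "y = \<phi> w" by (auto simp: J_def)
    show "y \<in> b ` K \<union> (\<Union>\<phi>\<in>S. \<phi> ` (?W - K))"
    proof (cases "w \<in> K")
      case True then show ?thesis using * b by auto
    next
      case False then show ?thesis using * by blast
    qed
  qed
  have cWK: "card (?W - K) = card ?W - card K" using K finK by (simp add: card_Diff_subset)
  have "card (\<Union>J) \<le> card (b ` K \<union> (\<Union>\<phi>\<in>S. \<phi> ` (?W - K)))"
    using finK S fin by (intro card_mono[OF _ UJ]) auto
  also have "\<dots> \<le> card (b ` K) + card (\<Union>\<phi>\<in>S. \<phi> ` (?W - K))" by (rule card_Un_le)
  also have "card (b ` K) \<le> card K" by (rule card_image_le[OF finK])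
  also have "card (\<Union>\<phi>\<in>S. \<phi> ` (?W - K)) \<le> (\<Sum>\<phi>\<in>S. card (\<phi> ` (?W - K)))" by (rule card_UN_le[OF S(1)])
  also have "\<dots> \<le> (\<Sum>\<phi>\<in>S. card ?W - card K)" unfolding cWK[symmetric] by (rule sum_mono) (rule card_image_le, use fin in simp)
  finally show "card (\<Union>J) \<le> card K + card S * (card ?W - card K)" by simp
  obtain \<phi>0 where \<phi>0: "\<phi>0 \<in> S" using S by blast
  let ?G = "\<lambda>(\<phi>, e). \<phi> ` e"
  have bw: "\<phi> w = b w" if "\<phi> \<in> S" "w \<in> K" for \<phi> w using b[OF that(1)] that(2) by blast
  have key: "e \<subseteq> K" if h: "\<phi> \<in> S" "\<psi> \<in> S" "e \<in> E" "e' \<in> E" "\<phi> ` e = \<psi> ` e'" "\<phi> \<noteq> \<psi>" for \<phi> \<psi> e e'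
  proof
    fix w assume w: "w \<in> e"
    show "w \<in> K"
    proof (rule ccontr)
      assume wK: "w \<notin> K"
      obtain w' where w': "w' \<in> e'" "\<phi> w = \<psi> w'" using h(5) w by blast
      show False
      proof (cases "w' \<in> K")
        case True
        then have "\<phi> w = \<phi> w'" using w'(2) bw[OF h(1) True] bw[OF h(2) True] by simp
        then have "w = w'" by (rule inj_onD[OF inj[OF h(1)]]) (use w h(3) True K(1) in auto)
        then show False using True wK by simp
      next
        case False
        then have "w \<in> ?W - K" "w' \<in> ?W - K" using w w'(1) wK h(3,4) by auto
        then have "\<phi> w \<in> \<phi> ` (?W - K)" "\<psi> w' \<in> \<psi> ` (?W - K)" by blast+
        then show False using disj[OF h(1,2,6)] w'(2) by auto
      qed
    qed
  qed
  have keyK: "e' \<subseteq> K" if "\<phi> \<in> S" "\<psi> \<in> S" "e \<in> E" "e' \<in> E" "\<phi> ` e = \<psi> ` e'" "e \<subseteq> K" for \<phi> \<psi> e e'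
  proof (cases "\<phi> = \<psi>")
    case True
    then have "e = e'"
      using inj_on_image_eq_iff[OF inj[OF that(1)] Union_upper[OF that(3)] Union_upper[OF that(4)]] that(5) by simp
    then show ?thesis using that by simp
  next
    case False then show ?thesis using key[of \<psi> \<phi> e' e] that by simp
  qed
  have inj1: "inj_on ?G (S \<times> (E - ?EK))"
  proof (rule inj_onI)
    fix x y assume xy: "x \<in> S \<times> (E - ?EK)" "y \<in> S \<times> (E - ?EK)" "?G x = ?G y"
    obtain \<phi> e where x: "x = (\<phi>, e)" by (cases x)
    obtain \<psi> e' where y: "y = (\<psi>, e')" by (cases y)
    have *: "\<phi> \<in> S" "\<psi> \<in> S" "e \<in> E" "e' \<in> E" "\<phi> ` e = \<psi> ` e'" "\<not> e \<subseteq> K"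
      using xy unfolding x y by auto
    have eq: "\<phi> = \<psi>" using key[OF *(1-5)] *(6) by blast
    have "e = e'" using inj_on_image_eq_iff[OF inj[OF *(1)] Union_upper[OF *(3)] Union_upper[OF *(4)]] *(5) eq by simp
    then show "x = y" using eq x y by simp
  qed
  have "card (?G ` (S \<times> (E - ?EK)) \<union> (`) \<phi>0 ` ?EK) = card (?G ` (S \<times> (E - ?EK))) + card ((`) \<phi>0 ` ?EK)"
  proof (rule card_Un_disjoint)
    show "?G ` (S \<times> (E - ?EK)) \<inter> (`) \<phi>0 ` ?EK = {}"
    proof (rule ccontr)
      assume "\<not> ?thesis"
      then obtain \<phi> e e' where *: "\<phi> \<in> S" "e \<in> E" "\<not> e \<subseteq> K" "e' \<in> E" "e' \<subseteq> K" "\<phi> ` e = \<phi>0 ` e'" by auto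
      then show False using keyK[of \<phi>0 \<phi> e' e] \<phi>0 by simp
    qed
  qed (use S fin in auto)
  also have "card (?G ` (S \<times> (E - ?EK))) = card S * card (E - ?EK)"
    using card_image[OF inj1] by (simp add: card_cartesian_product)
  also have "card ((`) \<phi>0 ` ?EK) = card ?EK"
  proof (rule card_image, rule inj_onI)
    fix e e' assume e: "e \<in> ?EK" "e' \<in> ?EK" "\<phi>0 ` e = \<phi>0 ` e'"
    then have "e \<subseteq> ?W" "e' \<subseteq> ?W" by auto
    then show "e = e'" using inj_on_image_eq_iff[OF inj[OF \<phi>0]] e(3) by simp
  qed
  also have "card (E - ?EK) = card E - card ?EK" using fin by (intro card_Diff_subset) auto
  finally have cU: "card (?G ` (S \<times> (E - ?EK)) \<union> (`) \<phi>0 ` ?EK) = card S * (card E - card ?EK) + card ?EK" .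
  have sub: "?G ` (S \<times> (E - ?EK)) \<union> (`) \<phi>0 ` ?EK \<subseteq> J" using \<phi>0 by (auto simp: J_def)
  have cJ: "card S * (card E - card ?EK) + card ?EK \<le> card J" using card_mono[OF finJ sub] unfolding cU .
  have "2 * card ?EK \<le> card (\<Union>?EK - A)" using A(3)[unfolded hall_def, rule_format, of ?EK] by simp
  also have "\<dots> \<le> card (K - A)" using finK by (intro card_mono) auto
  also have "\<dots> = card K - k" using card_Diff_subset[OF finite_subset[OF A(1) finK] A(1)] A(2) by simp
  finally have \<gamma>: "2 * card ?EK \<le> card K - k" .
  have kK: "k \<le> card K" using card_mono[OF finK A(1)] A(2) by simp
  have cEK: "card ?EK \<le> card E" using fin by (intro card_mono) auto
  have cKW: "card K \<le> card ?W" by (rule card_mono[OF fin(2) K(1)])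
  have cW: "card ?W = 2 * card E + k" using conf by (simp add: config_def)
  have Sp: "card S \<ge> 1" using S by (simp add: Suc_leI card_gt_0_iff)
  define s where "s = card S - 1"
  have s: "card S = Suc s" using Sp by (simp add: s_def)
  have "card ?W - card K \<le> 2 * (card E - card ?EK)" using \<gamma> kK cW cEK by linarith
  then have "s * (card ?W - card K) \<le> s * (2 * (card E - card ?EK))" by (rule mult_le_mono2)
  moreover have "card K + (card ?W - card K) = 2 * (card E - card ?EK) + 2 * card ?EK + k" using cKW cW cEK by linarith
  ultimately have "card K + card S * (card ?W - card K) \<le> 2 * (card S * (card E - card ?EK)) + 2 * card ?EK + k"
  proof -
    have "Suc s * x = x + s * x" "2 * (Suc s * x) = 2 * x + s * (2 * x)" for x by simp_all
    then show ?thesis unfolding s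
      using \<open>s * (card ?W - card K) \<le> s * (2 * (card E - card ?EK))\<close>
        \<open>card K + (card ?W - card K) = 2 * (card E - card ?EK) + 2 * card ?EK + k\<close> by (simp only:)
  qed
  then show "card K + card S * (card ?W - card K) \<le> 2 * card J + k" using cJ by linarith
qed

text \<open>From a large fibre take a largest kernel \<open>K\<close> whose fibre is still large.
  Fixing one more vertex leaves few copies, so a greedy choice gives a sunflower with as many petals
  as \<open>p\<close> vertices admit. Less than one petal of room is left, filled by part of a copy
  disjoint from the sunflower. In \<open>D\<close>, \<open>k\<close> is lost by the sunflower and
  \<open>h + 1\<close> by the filling.\<close>

lemma fibres_bounded:
  assumes ab: "abundant p D E k" and conf: "config E k" and fl: "flex E h"
    and vp: "card (\<Union>E) \<le> p" and kh: "k \<le> h" and D: "k + h + 1 \<le> D"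
  shows "bounded_fibres p D E k"
  unfolding bounded_fibres_def
proof (intro allI impI)
  fix \<epsilon> :: real assume "\<epsilon> > 0"
  then have e2: "\<epsilon> / 2 > 0" by simp
  obtain \<delta> n0 where \<delta>: "\<delta> > 0" and n0: "\<And>n H. n \<ge> n0 \<Longrightarrow> big (\<epsilon> / 2) n H \<Longrightarrow> \<not> good p D H \<Longrightarrow>
     \<delta> * real n ^ k \<le> real (card (copies E H n))" using ab e2 unfolding abundant_def by blast
  note fin = config_finite[OF conf]
  let ?W = "\<Union>E"
  define v where "v = card ?W"
  \<comment> \<open>The threshold falls by the factor \<open>p * v * v + 1\<close> with each vertex
    fixed, as the greedy choice of at most \<open>p\<close> petals requires, and ends at 1 for the
    full vertex set, where a fibre is a single copy.\<close>
  define Lim where "Lim j = (p * v * v + 1) ^ (v - j)" for j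
  define n1 where "n1 = max n0 (max 1 (nat \<lceil>2 * real p / \<epsilon>\<rceil>))"
  show "\<exists>L n0. \<forall>n\<ge>n0. \<forall>H. big \<epsilon> n H \<longrightarrow> \<not> good p D H \<longrightarrow>
     (\<forall>A a. A \<subseteq> ?W \<longrightarrow> card A = k \<longrightarrow> hall E A \<longrightarrow> card {\<phi> \<in> copies E H n. \<forall>w\<in>A. \<phi> w = a w} \<le> L)"
  proof (rule exI[of _ "Lim k"], rule exI[of _ n1], intro allI impI)
    fix n H A a
    assume n: "n1 \<le> n" and H: "big \<epsilon> n H" and ng: "\<not> good p D H"
      and A: "A \<subseteq> ?W" "card A = k" "hall E A"
    show "card {\<phi> \<in> copies E H n. \<forall>w\<in>A. \<phi> w = a w} \<le> Lim k"
    proof (rule ccontr)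
      assume "\<not> ?thesis"
      then have gt: "card {\<phi> \<in> copies E H n. \<forall>w\<in>A. \<phi> w = a w} > Lim (card A)" using A(2) by simp
      define fib where "fib K b = {\<phi> \<in> copies E H n. \<forall>w\<in>K. \<phi> w = b w}" for K b
      have finfib: "finite (fib K b)" for K b using finite_copies[OF fin(2)] by (simp add: fib_def)
      define KK where "KK = {K. A \<subseteq> K \<and> K \<subseteq> ?W \<and> (\<exists>b. card (fib K b) > Lim (card K))}"
      have "A \<in> KK" using A gt by (auto simp: KK_def fib_def)
      have finKK: "finite KK" by (rule finite_subset[of _ "Pow ?W"]) (use fin in \<open>auto simp: KK_def\<close>)
      have "Max (card ` KK) \<in> card ` KK" using finKK \<open>A \<in> KK\<close> by (intro Max_in) auto
      then obtain K where KKK: "K \<in> KK" and Kmax: "card K = Max (card ` KK)" by auto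
      have max: "card K' \<le> card K" if "K' \<in> KK" for K' unfolding Kmax using finKK that by (intro Max_ge) auto
      obtain b where b: "card (fib K b) > Lim (card K)" using KKK by (auto simp: KK_def)
      have AK: "A \<subseteq> K" "K \<subseteq> ?W" using KKK by (auto simp: KK_def)
      have finK: "finite K" using AK fin finite_subset by blast
      have KW: "K \<noteq> ?W"
      proof
        assume e: "K = ?W"
        have "\<phi> = \<psi>" if "\<phi> \<in> fib K b" "\<psi> \<in> fib K b" for \<phi> \<psi>
          using that unfolding fib_def copies_def e by (intro PiE_ext[of \<phi> ?W "\<lambda>_. {..<n}" \<psi>]) auto
        then have "card (fib K b) \<le> 1" using card_le_Suc0_iff_eq[OF finfib, of K b] by auto
        moreover have "Lim (card K) = 1" by (simp add: Lim_def v_def e)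
        ultimately show False using b by simp
      qed
      let ?P = "?W - K"
      have P: "finite ?P" "?P \<noteq> {}" using fin AK KW by auto
      have cK: "card K < v" unfolding v_def using fin AK KW by (intro psubset_card_mono) auto
      have LimS: "Lim (card K) = (p * v * v + 1) * Lim (Suc (card K))"
      proof -
        have "v - card K = Suc (v - Suc (card K))" using cK by simp
        then show ?thesis by (simp add: Lim_def)
      qed
      have Lpos: "Lim j > 0" for j by (simp add: Lim_def)
      have fibL: "card {\<phi> \<in> fib K b. \<phi> w = y} \<le> Lim (Suc (card K))" if w: "w \<in> ?P" for w y
      proof (rule ccontr)
        assume c: "\<not> ?thesis"
        have "{\<phi> \<in> fib K b. \<phi> w = y} = fib (insert w K) (b(w := y))" using w by (auto simp: fib_def)
        then have "insert w K \<in> KK" using c AK w finK by (auto simp: KK_def not_le)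
        then have "card (insert w K) \<le> card K" by (rule max)
        then show False using w finK by simp
      qed
      have cPv: "card ?P \<le> v" unfolding v_def using fin by (intro card_mono) auto
      define w where "w = v - card K"
      have w: "w \<ge> 1" "w \<le> v" using cK by (auto simp: w_def)
      have vK: "v \<le> p" using vp by (simp add: v_def)
      define Q where "Q = (p - card K) div w"
      have "w \<le> p - card K" using vK cK by (simp add: w_def)
      then have "0 < Q" unfolding Q_def using w(1) by (simp add: div_greater_zero_iff)
      then have Q1: "Q \<ge> 1" by simp
      have Qp: "Q \<le> p" unfolding Q_def using w by (meson diff_le_self div_le_dividend le_trans)
      have "(Q - 1) * card ?P * card ?P * Lim (Suc (card K)) \<le> (p * v * v) * Lim (Suc (card K))"
        using Qp cPv by (intro mult_le_mono) auto
      also have "\<dots> < Lim (card K)" unfolding LimS using Lpos by simp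
      also have "\<dots> < card (fib K b)" by (rule b)
      finally have "\<exists>S\<subseteq>fib K b. card S = Suc (Q - 1) \<and> (\<forall>\<phi>\<in>S. \<forall>\<psi>\<in>S. \<phi> \<noteq> \<psi> \<longrightarrow> \<phi> ` ?P \<inter> \<psi> ` ?P = {})"
        using fibL by (intro greedy_disjoint[OF finfib P])
      then obtain S where S0: "S \<subseteq> fib K b \<and> card S = Suc (Q - 1) \<and> (\<forall>\<phi>\<in>S. \<forall>\<psi>\<in>S. \<phi> \<noteq> \<psi> \<longrightarrow> \<phi> ` ?P \<inter> \<psi> ` ?P = {})"
        by (elim exE)
      have S: "S \<subseteq> fib K b" "card S = Q" using S0 Q1 by auto
      have S3: "\<phi> ` ?P \<inter> \<psi> ` ?P = {}" if "\<phi> \<in> S" "\<psi> \<in> S" "\<phi> \<noteq> \<psi>" for \<phi> \<psi> using S0 that by blast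
      have finS: "finite S" using S(1) finfib finite_subset by blast
      have Sne: "S \<noteq> {}" using S(2) Q1 by auto
      define J1 where "J1 = (\<Union>\<phi>\<in>S. (`) \<phi> ` E)"
      have Sb: "\<phi> \<in> copies E H n \<and> (\<forall>w\<in>K. \<phi> w = b w)" if "\<phi> \<in> S" for \<phi> using that S(1) by (auto simp: fib_def)
      note sc = sunflower_count[OF conf AK(2) KW Sb S3 finS Sne AK(1) A(2,3), folded J1_def v_def w_def, unfolded S(2)]
      define r where "r = p - (card K + Q * w)"
      have Kp: "card K \<le> p" using cK vK by simp
      have Qw: "Q * w \<le> p - card K" unfolding Q_def by simp
      have tot: "card K + Q * w + r = p" using Qw Kp by (simp add: r_def)
      have rw: "r < w"
      proof -
        have "p - card K = Q * w + (p - card K) mod w" unfolding Q_def by simp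
        moreover have "(p - card K) mod w < w" using w by simp
        ultimately show ?thesis unfolding r_def by linarith
      qed
      \<comment> \<open>At most \<open>p * n\<close> edges meet the sunflower, which for
        \<open>n \<ge> n1\<close> is at most half of \<open>\<epsilon> * n ^ 2\<close>. So
        \<open>H2\<close> is still big, and abundance within it yields a copy disjoint from the
        sunflower.\<close>
      define H2 where "H2 = {e \<in> H. e \<inter> \<Union>J1 = {}}"
      have finJ1: "finite (\<Union>J1)"
      proof -
        have "finite e" if "e \<in> J1" for e
        proof -
          have "e \<in> H" using that sc(1) by blast
          then have "e \<subseteq> {..<n}" using H by (auto simp: big_def)
          then show ?thesis using finite_subset by blast
        qed
        then show ?thesis using sc(2) by blast
      qed
      have cJ1: "card (\<Union>J1) \<le> p" using sc(3) tot by linarith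
      have finH: "finite H" using H by (rule big_finite)
      have "card (H - H2) \<le> p * n"
      proof -
        have "H - H2 \<subseteq> (\<Union>y\<in>\<Union>J1. {e \<in> H. y \<in> e})" by (auto simp: H2_def)
        then have "card (H - H2) \<le> card (\<Union>y\<in>\<Union>J1. {e \<in> H. y \<in> e})"
          using finH by (intro card_mono) (rule finite_subset[of _ H], auto)
        also have "\<dots> \<le> (\<Sum>y\<in>\<Union>J1. card {e \<in> H. y \<in> e})" by (rule card_UN_le[OF finJ1])
        also have "\<dots> \<le> (\<Sum>y\<in>\<Union>J1. n)" using H by (intro sum_mono) (auto simp: big_def)
        also have "\<dots> \<le> p * n" using cJ1 by simp
        finally show ?thesis .
      qed
      moreover have "card (H - H2) = card H - card H2" using finH by (intro card_Diff_subset) (auto simp: H2_def)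
      ultimately have "real (card H) - real (p * n) \<le> real (card H2)" by linarith
      moreover have "\<epsilon> * real n ^ 2 \<le> real (card H)" using H by (simp add: big_def)
      moreover have "real (p * n) \<le> \<epsilon> / 2 * real n ^ 2"
      proof -
        have "2 * real p / \<epsilon> \<le> real n" using n unfolding n1_def by linarith
        then have "real p \<le> \<epsilon> / 2 * real n" using \<open>\<epsilon> > 0\<close> by (simp add: field_simps)
        then have "real p * real n \<le> (\<epsilon> / 2 * real n) * real n" by (intro mult_right_mono) auto
        then show ?thesis by (simp add: power2_eq_square mult_ac)
      qed
      ultimately have "\<epsilon> / 2 * real n ^ 2 \<le> real (card H2)" by linarith
      moreover have "card {e \<in> H2. y \<in> e} \<le> n" for y
      proof -
        have "card {e \<in> H2. y \<in> e} \<le> card {e \<in> H. y \<in> e}" using finH by (intro card_mono) (auto simp: H2_def)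
        then show ?thesis using H unfolding big_def using le_trans by blast
      qed
      moreover have "H2 \<subseteq> H" by (auto simp: H2_def)
      ultimately have H2: "big (\<epsilon> / 2) n H2" using H unfolding big_def by blast
      have ng2: "\<not> good p D H2" using ng \<open>H2 \<subseteq> H\<close> unfolding good_def by blast
      have "0 < \<delta> * real n ^ k" using \<delta> n by (simp add: n1_def)
      also have "\<dots> \<le> real (card (copies E H2 n))" using n0[OF _ H2 ng2] n by (simp add: n1_def)
      finally have "copies E H2 n \<noteq> {}" by auto
      then obtain \<phi> where \<phi>: "\<phi> \<in> copies E H2 n" by blast
      have "r \<le> 2 * card E + h" using rw w(2) conf kh by (simp add: config_def v_def)
      then obtain E' where E': "E' \<subseteq> E" "card (\<Union>E') \<le> r" "r \<le> 2 * card E' + h + 1" using flex_pick[OF fl] by blast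
      note ci = copy_image[OF \<phi> E'(1) fin(2)]
      define J2 where "J2 = (`) \<phi> ` E'"
      have J2H: "J2 \<subseteq> H2" unfolding J2_def by (rule ci(1))
      have finJ2: "finite J2" by (rule finite_subset[OF subset_trans[OF J2H \<open>H2 \<subseteq> H\<close>] finH])
      have "J1 \<inter> J2 = {}"
      proof (rule ccontr)
        assume "\<not> ?thesis"
        then obtain e where e: "e \<in> J1" "e \<in> J2" by blast
        then have "e \<inter> \<Union>J1 = {}" "e \<in> H" using J2H by (auto simp: H2_def)
        moreover have "e \<noteq> {}" using \<open>e \<in> H\<close> H by (auto simp: big_def)
        ultimately show False using e(1) by blast
      qed
      then have cJ: "card (J1 \<union> J2) = card J1 + card E'"
        using card_Un_disjoint[OF sc(2) finJ2] ci(2) by (simp add: J2_def)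
      have "card (\<Union>(J1 \<union> J2)) \<le> card (\<Union>J1) + card (\<Union>J2)" using card_Un_le[of "\<Union>J1" "\<Union>J2"] by simp
      also have "\<dots> \<le> p" using sc(3) tot ci(3,4) E'(2) by (simp add: J2_def)
      finally have "card (\<Union>(J1 \<union> J2)) \<le> p" .
      moreover have "p \<le> 2 * card (J1 \<union> J2) + D" using sc(4) tot E'(3) D cJ by linarith
      moreover have "J1 \<union> J2 \<subseteq> H" using sc(1) J2H \<open>H2 \<subseteq> H\<close> by blast
      ultimately have "good p D H" unfolding good_def using sc(2) finJ2 by (intro exI[of _ "J1 \<union> J2"]) simp
      then show False using ng by simp
    qed
  qed
qed

section \<open>Gluing configurations\<close>

datatype pos = Z nat | Sh pos | Cp pos pos

text \<open>\<open>Sh w\<close> is a shared vertex and \<open>Cp i w\<close> the \<open>i\<close>-th copy of \<open>w\<close>. \<open>glue E Y X\<close> is the union of the copies \<open>rho Y i ` E\<close>, \<open>i \<in> X \<subseteq> Y\<close>: the \<open>i\<close>-th copy keeps all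
  vertices of \<open>Y\<close> but \<open>i\<close> and renames everything else.\<close>

definition rho :: "pos set \<Rightarrow> pos \<Rightarrow> pos \<Rightarrow> pos" where
  "rho Y i w = (if w \<in> Y - {i} then Sh w else Cp i w)"

definition glue :: "pos set set \<Rightarrow> pos set \<Rightarrow> pos set \<Rightarrow> pos set set" where
  "glue E Y X = (\<Union>i\<in>X. (`) (rho Y i) ` E)"

text \<open>A strengthened Hall condition: it leaves room for \<open>U\<close>, for any
  \<open>card X - 2\<close> marks and, by the final 1, for one arbitrary further vertex. No more can
  be asked: for a marked configuration and \<open>E' = E\<close> both sides are equal.\<close>

definition star :: "'a set set \<Rightarrow> 'a set \<Rightarrow> 'a set \<Rightarrow> bool" where
  "star E U X \<longleftrightarrow> (\<forall>E'\<subseteq>E. E' \<noteq> {} \<longrightarrow>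
     2 * card E' + card (U \<inter> \<Union>E') + min (card (X \<inter> \<Union>E')) (card X - 2) + 1 \<le> card (\<Union>E'))"

text \<open>\<open>U\<close> is to be held fixed while \<open>X\<close> spans the simplex. The sum
  \<open>k + 1\<close> gives each facet \<open>U \<union> (X - {i})\<close> exactly \<open>k\<close>
  vertices.\<close>

definition marked :: "'a set set \<Rightarrow> nat \<Rightarrow> 'a set \<Rightarrow> 'a set \<Rightarrow> bool" where
  "marked E k U X \<longleftrightarrow> config E k \<and> star E U X \<and> U \<subseteq> \<Union>E \<and> X \<subseteq> \<Union>E \<and> U \<inter> X = {} \<and>
     card U + card X = k + 1 \<and> card X \<ge> 3"

lemma rho_inj: "inj_on (rho Y i) A" by (auto simp: inj_on_def rho_def split: if_splits)

lemma rho_eq: "i \<noteq> j \<Longrightarrow> rho Y i w = rho Y j w' \<longleftrightarrow> w = w' \<and> w \<in> Y - {i,j}"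
  by (auto simp: rho_def)

lemma ex_other: "card X \<ge> 2 \<Longrightarrow> \<exists>j\<in>X. j \<noteq> w"
proof (rule ccontr)
  assume c: "card X \<ge> 2" and "\<not> ?thesis"
  then have "X \<subseteq> {w}" by blast
  then have "card X \<le> 1" using card_mono[of "{w}" X] by simp
  then show False using c by simp
qed

text \<open>The vertices of a subfamily meet the given set in at most as many points as
  \<open>star\<close> holds in reserve, with the last 1 reserved for \<open>w\<close>.\<close>

lemma star_hall:
  assumes m: "marked E k U X" and B: "B \<subseteq> X" "card B = card X - 2" and w: "w \<in> \<Union>E" "w \<notin> U" "w \<notin> B"
  shows "hall E (insert w (U \<union> B))" "card (insert w (U \<union> B)) = k" "insert w (U \<union> B) \<subseteq> \<Union>E"
proof -
  have conf: "config E k" using m by (simp add: marked_def)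
  note fin = config_finite[OF conf]
  have finU: "finite U" "finite X" "finite B" 
    using m B finite_subset[OF _ fin(2), of U] finite_subset[OF _ fin(2), of X] finite_subset[of B X] by (auto simp: marked_def)
  have UX: "U \<inter> X = {}" and st: "star E U X" using m by (simp_all add: marked_def)
  show "insert w (U \<union> B) \<subseteq> \<Union>E" using m B w by (auto simp: marked_def)
  have cUB: "card (U \<union> B) = card U + card B" using finU UX B by (intro card_Un_disjoint) auto
  have "card (insert w (U \<union> B)) = Suc (card (U \<union> B))" using w finU by (intro card_insert_disjoint) auto
  then show "card (insert w (U \<union> B)) = k" using cUB m B by (simp add: marked_def)
  show "hall E (insert w (U \<union> B))"
    unfolding hall_def
  proof (intro allI impI)
    fix E' assume E': "E' \<subseteq> E"
    show "2 * card E' \<le> card (\<Union>E' - insert w (U \<union> B))"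
    proof (cases "E' = {}")
      case True then show ?thesis by simp
    next
      case False
      let ?V = "\<Union>E'"
      have finV: "finite ?V" by (rule finite_subset[OF Union_mono[OF E'] fin(2)])
      have s: "2 * card E' + card (U \<inter> ?V) + min (card (X \<inter> ?V)) (card X - 2) + 1 \<le> card ?V"
        using st[unfolded star_def, rule_format, OF E' False] .
      have "?V \<inter> insert w (U \<union> B) \<subseteq> insert w ((U \<inter> ?V) \<union> (B \<inter> ?V))" by auto
      then have "card (?V \<inter> insert w (U \<union> B)) \<le> card (insert w ((U \<inter> ?V) \<union> (B \<inter> ?V)))"
        using finV by (intro card_mono) auto
      also have "\<dots> \<le> Suc (card ((U \<inter> ?V) \<union> (B \<inter> ?V)))" using finV by (simp add: card_insert_if)
      also have "\<dots> \<le> Suc (card (U \<inter> ?V) + card (B \<inter> ?V))" using card_Un_le by simp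
      also have "card (B \<inter> ?V) \<le> min (card (X \<inter> ?V)) (card X - 2)"
      proof -
        have "card (B \<inter> ?V) \<le> card (X \<inter> ?V)" using B finV by (intro card_mono) auto
        moreover have "card (B \<inter> ?V) \<le> card B" using finU by (intro card_mono) auto
        ultimately show ?thesis using B by simp
      qed
      finally have "card (?V \<inter> insert w (U \<union> B)) + 2 * card E' \<le> card ?V" using s by simp
      moreover have "card (?V - insert w (U \<union> B)) = card ?V - card (?V \<inter> insert w (U \<union> B))"
        using finV by (intro card_Diff_subset_Int) auto
      ultimately show ?thesis by linarith
    qed
  qed
qed

lemma glue_Union:
  "\<Union>(glue E Y X) = (\<Union>i\<in>X. rho Y i ` \<Union>E)"
  by (auto simp: glue_def)

text \<open>Shared names are counted once and private names separately for each copy. An element of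
  \<open>Y\<close> is shared as soon as it is used by a copy other than the one indexed by
  it.\<close>

lemma glue_card_Union:
  assumes fin: "finite Y" and XY: "X \<subseteq> Y" "card X \<ge> 2" and P: "\<And>i. i \<in> X \<Longrightarrow> finite (P i)"
    and S: "S = {w \<in> Y. \<exists>i\<in>X. i \<noteq> w \<and> w \<in> P i}"
  shows "card (\<Union>i\<in>X. rho Y i ` P i) = card S + (\<Sum>i\<in>X. card (P i - (Y - {i})))"
proof -
  have finX: "finite X" using fin XY finite_subset by blast
  have eq: "(\<Union>i\<in>X. rho Y i ` P i) = Sh ` S \<union> (\<Union>i\<in>X. Cp i ` (P i - (Y - {i})))"
  proof (intro equalityI subsetI)
    fix x assume "x \<in> (\<Union>i\<in>X. rho Y i ` P i)"
    then obtain i w where iw: "i \<in> X" "w \<in> P i" "x = rho Y i w" by blast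
    show "x \<in> Sh ` S \<union> (\<Union>i\<in>X. Cp i ` (P i - (Y - {i})))"
    proof (cases "w \<in> Y - {i}")
      case True
      then have "w \<in> S" unfolding S using iw by (intro CollectI conjI bexI[of _ i]) auto
      then show ?thesis using True iw(3) by (simp add: rho_def)
    next
      case False
      then have "x = Cp i w" "w \<in> P i - (Y - {i})" using iw by (auto simp: rho_def)
      then show ?thesis using iw(1) by blast
    qed
  next
    fix x assume "x \<in> Sh ` S \<union> (\<Union>i\<in>X. Cp i ` (P i - (Y - {i})))"
    then show "x \<in> (\<Union>i\<in>X. rho Y i ` P i)"
    proof
      assume "x \<in> Sh ` S"
      then obtain w i where w: "x = Sh w" "w \<in> Y" "i \<in> X" "i \<noteq> w" "w \<in> P i" unfolding S by blast
      then have "x = rho Y i w" by (auto simp: rho_def)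
      then show ?thesis using w by blast
    next
      assume "x \<in> (\<Union>i\<in>X. Cp i ` (P i - (Y - {i})))"
      then obtain i w where w: "x = Cp i w" "i \<in> X" "w \<in> P i" "w \<notin> Y - {i}" by blast
      then have "x = rho Y i w" by (simp add: rho_def)
      then show ?thesis using w by blast
    qed
  qed
  have finS: "finite S" using fin by (simp add: S)
  have "card (Sh ` S \<union> (\<Union>i\<in>X. Cp i ` (P i - (Y - {i})))) = card (Sh ` S) + card (\<Union>i\<in>X. Cp i ` (P i - (Y - {i})))"
    using finS finX P by (intro card_Un_disjoint) auto
  also have "card (Sh ` S) = card S" by (rule card_image) (simp add: inj_on_def)
  also have "card (\<Union>i\<in>X. Cp i ` (P i - (Y - {i}))) = (\<Sum>i\<in>X. card (Cp i ` (P i - (Y - {i}))))"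
    using finX P by (intro card_UN_disjoint) auto
  also have "\<dots> = (\<Sum>i\<in>X. card (P i - (Y - {i})))"
    by (intro sum.cong refl card_image) (simp add: inj_on_def)
  finally show ?thesis unfolding eq .
qed

text \<open>An edge inside a facet would contradict \<open>hall\<close> for that facet, since it has
  no vertex outside. Hence different copies share no edge and the numbers of edges add up.\<close>

lemma not_edge_in:
  assumes m: "marked E k U X" and i: "i \<in> X" and e: "e \<in> E"
  shows "\<not> e \<subseteq> (U \<union> X) - {i}"
proof
  assume sub: "e \<subseteq> (U \<union> X) - {i}"
  have conf: "config E k" using m by (simp add: marked_def)
  have fin: "finite X" by (rule finite_subset[OF _ config_finite(2)[OF conf]]) (use m in \<open>simp add: marked_def\<close>)
  have UX: "U \<inter> X = {}" "X \<subseteq> \<Union>E" "card X \<ge> 3" using m by (auto simp: marked_def)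
  obtain j where j: "j \<in> X" "j \<noteq> i" using ex_other[of X i] UX(3) by auto
  have c: "card (X - {i,j}) = card X - 2" using fin i j by (simp add: card_Diff_subset)
  have h: "hall E (insert j (U \<union> (X - {i,j})))"
    by (rule star_hall(1)[OF m _ c]) (use j UX in auto)
  have "insert j (U \<union> (X - {i,j})) = (U \<union> X) - {i}" using i j UX by auto
  then have "2 * card {e} \<le> card (\<Union>{e} - ((U \<union> X) - {i}))" using h[unfolded hall_def, rule_format, of "{e}"] e by simp
  then show False using sub by (simp add: Diff_eq_empty_iff[THEN iffD2])
qed

lemma glue_disjoint:
  assumes m: "marked E k U X" and ij: "i \<in> X" "j \<in> X" "i \<noteq> j"
  shows "(`) (rho (U \<union> X) i) ` E \<inter> (`) (rho (U \<union> X) j) ` E = {}"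
proof (rule ccontr)
  assume "\<not> ?thesis"
  then obtain e e' where e: "e \<in> E" "e' \<in> E" "rho (U \<union> X) i ` e = rho (U \<union> X) j ` e'" by blast
  have "e \<subseteq> (U \<union> X) - {i}"
  proof
    fix w assume "w \<in> e"
    then have "rho (U \<union> X) i w \<in> rho (U \<union> X) j ` e'" using e(3) by blast
    then obtain w' where w': "rho (U \<union> X) i w = rho (U \<union> X) j w'" by (elim imageE)
    then have "w = w' \<and> w \<in> (U \<union> X) - {i,j}" unfolding rho_eq[OF ij(3)] .
    then show "w \<in> (U \<union> X) - {i}" by auto
  qed
  then show False using not_edge_in[OF m ij(1) e(1)] by blast
qed

lemma rho_image_inj: "inj_on ((`) (rho Y i)) E"
proof (rule inj_onI)
  fix e e' assume "rho Y i ` e = rho Y i ` e'"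
  then show "e = e'" using inj_on_image_eq_iff[OF rho_inj[of Y i UNIV], of e e'] by blast
qed

lemma glue_card:
  assumes m: "marked E k U X" and F: "\<And>i. i \<in> X \<Longrightarrow> F i \<subseteq> E"
  shows "card (\<Union>i\<in>X. (`) (rho (U \<union> X) i) ` F i) = (\<Sum>i\<in>X. card (F i))"
proof -
  have conf: "config E k" using m by (simp add: marked_def)
  note fin = config_finite[OF conf]
  have finX: "finite X" by (rule finite_subset[OF _ fin(2)]) (use m in \<open>simp add: marked_def\<close>)
  have finF: "finite (F i)" if "i \<in> X" for i by (rule finite_subset[OF F[OF that] fin(1)])
  have "card (\<Union>i\<in>X. (`) (rho (U \<union> X) i) ` F i) = (\<Sum>i\<in>X. card ((`) (rho (U \<union> X) i) ` F i))"
  proof (rule card_UN_disjoint[OF finX])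
    show "\<forall>i\<in>X. finite ((`) (rho (U \<union> X) i) ` F i)" using finF by blast
    show "\<forall>i\<in>X. \<forall>j\<in>X. i \<noteq> j \<longrightarrow> (`) (rho (U \<union> X) i) ` F i \<inter> (`) (rho (U \<union> X) j) ` F j = {}"
      using glue_disjoint[OF m] F by blast
  qed
  also have "\<dots> = (\<Sum>i\<in>X. card (F i))"
    by (intro sum.cong refl card_image rho_image_inj)
  finally show ?thesis .
qed

text \<open>The \<open>k + 1\<close> vertices of \<open>U \<union> X\<close> are shared, and each
  copy adds its \<open>2 * card E\<close> vertices outside its facet, twice the number of its edges.
  So the excess becomes \<open>k + 1\<close>.\<close>

lemma glue_config:
  assumes m: "marked E k U X"
  shows "config (glue E (U \<union> X) X) (k + 1)" "card (glue E (U \<union> X) X) = card X * card E"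
proof -
  have conf: "config E k" using m by (simp add: marked_def)
  note fin = config_finite[OF conf]
  let ?Y = "U \<union> X"
  have X: "X \<subseteq> \<Union>E" "U \<subseteq> \<Union>E" "card X \<ge> 3" "U \<inter> X = {}" "card U + card X = k + 1" using m by (auto simp: marked_def)
  have finX: "finite X" "finite U" by (rule finite_subset[OF _ fin(2)], use X in simp)+
  have cY: "card ?Y = k + 1" using X finX by (simp add: card_Un_disjoint)
  show cg: "card (glue E ?Y X) = card X * card E"
    unfolding glue_def using glue_card[OF m, of "\<lambda>i. E"] by simp
  have ex: "\<exists>i\<in>X. i \<noteq> w" for w using ex_other[of X w] X(3) by simp
  have "card (\<Union>(glue E ?Y X)) = card {w \<in> ?Y. \<exists>i\<in>X. i \<noteq> w \<and> w \<in> \<Union>E} + (\<Sum>i\<in>X. card (\<Union>E - (?Y - {i})))"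
    unfolding glue_Union using finX X fin by (intro glue_card_Union) auto
  also have "{w \<in> ?Y. \<exists>i\<in>X. i \<noteq> w \<and> w \<in> \<Union>E} = ?Y" using X ex by blast
  also have "(\<Sum>i\<in>X. card (\<Union>E - (?Y - {i}))) = (\<Sum>i\<in>X. 2 * card E)"
  proof (rule sum.cong[OF refl])
    fix i assume i: "i \<in> X"
    have "card (?Y - {i}) = k" using cY i finX by simp
    moreover have "card (\<Union>E - (?Y - {i})) = card (\<Union>E) - card (?Y - {i})"
      using X finX by (intro card_Diff_subset) auto
    ultimately show "card (\<Union>E - (?Y - {i})) = 2 * card E" using conf by (simp add: config_def)
  qed
  finally have "card (\<Union>(glue E ?Y X)) = 2 * card (glue E ?Y X) + (k + 1)" using cY cg by simp
  moreover have "finite (glue E ?Y X)" using finX fin by (simp add: glue_def)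
  moreover have "card e = 4" if e: "e \<in> glue E ?Y X" for e
  proof -
    obtain i e' where "i \<in> X" "e' \<in> E" "e = rho ?Y i ` e'" using e by (auto simp: glue_def)
    then show ?thesis using card_image[OF rho_inj[of ?Y i e']] fin(4) by simp
  qed
  ultimately show "config (glue E ?Y X) (k + 1)" unfolding config_def by blast
qed

section \<open>Thinning out copies\<close>

lemma maximal_independent:
  assumes fin: "finite C" and sym: "\<And>x y. R x y \<Longrightarrow> R y x"
  shows "\<exists>S\<subseteq>C. (\<forall>x\<in>S. \<forall>y\<in>S. x \<noteq> y \<longrightarrow> \<not> R x y) \<and> (\<forall>x\<in>C. \<exists>y\<in>S. x = y \<or> R x y)"
  using fin
proof (induction C rule: finite_induct)
  case empty then show ?case by auto
next
  case (insert c C)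
  then obtain S where S0: "S \<subseteq> C \<and> (\<forall>x\<in>S. \<forall>y\<in>S. x \<noteq> y \<longrightarrow> \<not> R x y) \<and> (\<forall>x\<in>C. \<exists>y\<in>S. x = y \<or> R x y)" by (elim exE)
  have a: "S \<subseteq> C" and b: "\<And>x y. x \<in> S \<Longrightarrow> y \<in> S \<Longrightarrow> x \<noteq> y \<Longrightarrow> \<not> R x y"
    and d: "\<And>x. x \<in> C \<Longrightarrow> \<exists>y\<in>S. x = y \<or> R x y" using S0 by simp_all
  show ?case
  proof (cases "\<exists>y\<in>S. R c y")
    case True
    then show ?thesis using a b d by (intro exI[of _ S] conjI) auto
  next
    case False
    have "\<not> R x y" if "x \<in> insert c S" "y \<in> insert c S" "x \<noteq> y" for x y
      using that b False sym[of x y] by auto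
    moreover have "\<exists>y\<in>insert c S. x = y \<or> R x y" if "x \<in> insert c C" for x using that d[of x] by auto
    ultimately show ?thesis using a by (intro exI[of _ "insert c S"] conjI) auto
  qed
qed

text \<open>Call two copies in conflict if they agree on some \<open>k\<close>-set satisfying
  \<open>hall\<close>. Each copy has at most \<open>2 ^ card (\<Union>E) * L\<close> copies in
  conflict with it, and a maximal conflict-free family conflicts with everything else.\<close>

lemma thin_copies:
  assumes m: "marked E k U X" and fin: "finite C"
    and L: "\<And>A a. A \<subseteq> \<Union>E \<Longrightarrow> card A = k \<Longrightarrow> hall E A \<Longrightarrow> card {\<phi> \<in> C. \<forall>w\<in>A. \<phi> w = a w} \<le> L"
  shows "\<exists>S\<subseteq>C. (\<forall>\<phi>\<in>S. \<forall>\<psi>\<in>S. \<forall>A. A \<subseteq> \<Union>E \<longrightarrow> card A = k \<longrightarrow> hall E A \<longrightarrow> (\<forall>y\<in>A. \<phi> y = \<psi> y) \<longrightarrow> \<phi> = \<psi>) \<and>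
     card C \<le> card S * (2 ^ card (\<Union>E) * L)"
proof -
  have conf: "config E k" using m by (simp add: marked_def)
  note finE = config_finite[OF conf]
  define AA where "AA = {A. A \<subseteq> \<Union>E \<and> card A = k \<and> hall E A}"
  have AA_sub: "AA \<subseteq> Pow (\<Union>E)" by (auto simp: AA_def)
  have finAA: "finite AA" by (rule finite_subset[OF AA_sub]) (use finE in simp)
  have cAA: "card AA \<le> 2 ^ card (\<Union>E)" using card_mono[OF _ AA_sub] finE by (simp add: card_Pow)
  define R where "R \<phi> \<psi> \<longleftrightarrow> (\<exists>A\<in>AA. \<forall>y\<in>A. \<phi> y = \<psi> y)" for \<phi> \<psi> :: "'a \<Rightarrow> 'b"
  have sym: "R \<psi> \<phi>" if "R \<phi> \<psi>" for \<phi> \<psi> using that unfolding R_def by metis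
  have "\<exists>S\<subseteq>C. (\<forall>x\<in>S. \<forall>y\<in>S. x \<noteq> y \<longrightarrow> \<not> R x y) \<and> (\<forall>x\<in>C. \<exists>y\<in>S. x = y \<or> R x y)"
    by (rule maximal_independent[OF fin]) (rule sym)
  then obtain S where S0: "S \<subseteq> C \<and> (\<forall>x\<in>S. \<forall>y\<in>S. x \<noteq> y \<longrightarrow> \<not> R x y) \<and> (\<forall>x\<in>C. \<exists>y\<in>S. x = y \<or> R x y)"
    by (elim exE)
  have S1: "S \<subseteq> C" and S2: "\<And>x y. x \<in> S \<Longrightarrow> y \<in> S \<Longrightarrow> x \<noteq> y \<Longrightarrow> \<not> R x y"
    and S3: "\<And>x. x \<in> C \<Longrightarrow> \<exists>y\<in>S. x = y \<or> R x y" using S0 by simp_all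
  have finS: "finite S" by (rule finite_subset[OF S1 fin])
  \<comment> \<open>At least one admissible \<open>k\<close>-set is needed, so that a member of
    \<open>S\<close> is counted among the copies which it covers itself.\<close>
  obtain A0 where A0: "A0 \<in> AA"
  proof -
    have X: "card X \<ge> 3" "X \<subseteq> \<Union>E" "U \<inter> X = {}" using m by (simp_all add: marked_def)
    have finX: "finite X" by (rule finite_subset[OF X(2) finE(2)])
    have "X \<noteq> {}" using X(1) by auto
    then obtain i where i: "i \<in> X" by blast
    obtain j where j: "j \<in> X" "j \<noteq> i" using ex_other[of X i] X(1) by auto
    have c: "card (X - {i,j}) = card X - 2" using finX i j by (simp add: card_Diff_subset)
    have jj: "j \<in> \<Union>E" "j \<notin> U" "j \<notin> X - {i,j}" using j X by auto
    have "insert j (U \<union> (X - {i,j})) \<in> AA"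
      using star_hall[OF m Diff_subset c jj] by (simp add: AA_def)
    then show thesis by (rule that)
  qed
  have "C \<subseteq> (\<Union>(\<psi>,A)\<in>S \<times> AA. {\<phi> \<in> C. \<forall>w\<in>A. \<phi> w = \<psi> w})"
  proof
    fix \<phi> assume \<phi>: "\<phi> \<in> C"
    then obtain \<psi> where \<psi>: "\<psi> \<in> S" "\<phi> = \<psi> \<or> R \<phi> \<psi>" using S3 by blast
    obtain A where A: "A \<in> AA" "\<forall>w\<in>A. \<phi> w = \<psi> w"
    proof (cases "\<phi> = \<psi>")
      case True then show thesis using that[OF A0] by simp
    next
      case False
      then have "R \<phi> \<psi>" using \<psi>(2) by simp
      then obtain A where "A \<in> AA" "\<forall>w\<in>A. \<phi> w = \<psi> w" unfolding R_def by (elim bexE)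
      then show thesis by (rule that)
    qed
    show "\<phi> \<in> (\<Union>(\<psi>,A)\<in>S \<times> AA. {\<phi> \<in> C. \<forall>w\<in>A. \<phi> w = \<psi> w})"
      using \<phi> \<psi>(1) A by (intro UN_I[of "(\<psi>, A)"]) auto
  qed
  then have "card C \<le> card (\<Union>(\<psi>,A)\<in>S \<times> AA. {\<phi> \<in> C. \<forall>w\<in>A. \<phi> w = \<psi> w})"
    by (intro card_mono finite_subset[OF _ fin]) auto
  also have "\<dots> \<le> (\<Sum>x\<in>S \<times> AA. card (case x of (\<psi>,A) \<Rightarrow> {\<phi> \<in> C. \<forall>w\<in>A. \<phi> w = \<psi> w}))"
    by (rule card_UN_le) (use finS finAA in simp)
  also have "\<dots> \<le> (\<Sum>x\<in>S \<times> AA. L)"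
    by (rule sum_mono) (use L in \<open>auto simp: AA_def\<close>)
  also have "\<dots> = card S * card AA * L" by (simp add: card_cartesian_product)
  also have "\<dots> \<le> card S * (2 ^ card (\<Union>E) * L)" using cAA by simp
  finally have card: "card C \<le> card S * (2 ^ card (\<Union>E) * L)" .
  have d: "\<phi> = \<psi>" if "\<phi> \<in> S" "\<psi> \<in> S" "A \<subseteq> \<Union>E" "card A = k" "hall E A" "\<forall>y\<in>A. \<phi> y = \<psi> y" for \<phi> \<psi> A
  proof (rule ccontr)
    assume "\<phi> \<noteq> \<psi>"
    then have "\<not> R \<phi> \<psi>" by (rule S2[OF that(1,2)])
    moreover have "R \<phi> \<psi>" unfolding R_def using that by (intro bexI[of _ A]) (auto simp: AA_def)
    ultimately show False by simp
  qed
  show ?thesis by (intro exI[of _ S] conjI ballI allI impI S1 card; rule d; assumption)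
qed

section \<open>Simplices of copies and their coincidences\<close>

definition over :: "('a \<Rightarrow> nat) set \<Rightarrow> 'a set \<Rightarrow> ('a \<Rightarrow> nat) \<Rightarrow> ('a \<Rightarrow> nat) set" where
  "over S U u = {\<phi> \<in> S. \<forall>w\<in>U. \<phi> w = u w}"

definition simplices :: "('a \<Rightarrow> nat) set \<Rightarrow> 'a set \<Rightarrow> 'a set \<Rightarrow> nat \<Rightarrow> ('a \<Rightarrow> nat) \<Rightarrow> ('a \<Rightarrow> nat) set" where
  "simplices S U X n u = {x \<in> PiE X (\<lambda>_. {..<n}). \<forall>i\<in>X. \<exists>\<phi>\<in>over S U u. \<forall>j\<in>X - {i}. \<phi> j = x j}"

definition face :: "('a \<Rightarrow> nat) set \<Rightarrow> 'a set \<Rightarrow> 'a set \<Rightarrow> ('a \<Rightarrow> nat) \<Rightarrow> ('a \<Rightarrow> nat) \<Rightarrow> 'a \<Rightarrow> 'a \<Rightarrow> nat" where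
  "face S U X u x i = (SOME \<phi>. \<phi> \<in> over S U u \<and> (\<forall>j\<in>X - {i}. \<phi> j = x j))"

lemma faceI:
  assumes "x \<in> simplices S U X n u" "i \<in> X"
  shows "face S U X u x i \<in> S" "\<And>w. w \<in> U \<Longrightarrow> face S U X u x i w = u w"
    "\<And>j. j \<in> X \<Longrightarrow> j \<noteq> i \<Longrightarrow> face S U X u x i j = x j"
proof -
  have "\<exists>\<phi>. \<phi> \<in> over S U u \<and> (\<forall>j\<in>X - {i}. \<phi> j = x j)" using assms unfolding simplices_def by blast
  then have *: "face S U X u x i \<in> over S U u \<and> (\<forall>j\<in>X - {i}. face S U X u x i j = x j)"
    unfolding face_def by (rule someI_ex)
  show "face S U X u x i \<in> S" using * by (simp add: over_def)
  show "face S U X u x i w = u w" if "w \<in> U" for w using * that by (simp add: over_def)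
  show "face S U X u x i j = x j" if "j \<in> X" "j \<noteq> i" for j using * that by simp
qed

text \<open>Slice \<open>S\<close> by the values \<open>u\<close> on \<open>U\<close>. A slice has
  at most \<open>n ^ (card X - 1)\<close> members, so a positive proportion of the slices reaches
  half of the guaranteed average, and simplex removal applies to each of these.\<close>

lemma many_simplices:
  fixes U X :: "'a set" and c :: real
  assumes fin: "finite U" "finite X" and X: "card X \<ge> 3" and k: "card U + card X = k + 1" and c: "c > 0"
  shows "\<exists>\<delta>>0. \<forall>n>0. \<forall>S. finite S \<longrightarrow> (\<forall>\<phi>\<in>S. \<forall>w\<in>U \<union> X. \<phi> w < n) \<longrightarrow>
     (\<forall>\<phi>\<in>S. \<forall>\<psi>\<in>S. \<forall>i\<in>X. (\<forall>w\<in>U \<union> (X - {i}). \<phi> w = \<psi> w) \<longrightarrow> \<phi> = \<psi>) \<longrightarrow> c * real n ^ k \<le> real (card S) \<longrightarrow>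
     \<delta> * real n ^ (k + 1) \<le> real (card (Sigma (PiE U (\<lambda>_. {..<n})) (simplices S U X n)))"
proof -
  have Xne: "X \<noteq> {}" using X by auto
  have c2: "c / 2 > 0" using c by simp
  obtain \<delta> where \<delta>0: "\<delta> > 0 \<and> (\<forall>n>0. \<forall>T. T \<subseteq> PiE X (\<lambda>_. {..<n}) \<longrightarrow>
     (\<forall>i\<in>X. inj_on (\<lambda>x. restrict x (X - {i})) T) \<longrightarrow> c / 2 * real n ^ (card X - 1) \<le> real (card T) \<longrightarrow>
     \<delta> * real n ^ card X \<le> real (card {x \<in> PiE X (\<lambda>_. {..<n}). \<forall>i\<in>X. \<exists>t\<in>T. \<forall>j\<in>X - {i}. t j = x j}))"
    using simplex_removal[OF fin(2) Xne c2] by (elim exE)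
  have \<delta>: "\<delta> > 0" using \<delta>0 by simp
  have rem: "\<delta> * real n ^ card X \<le> real (card {x \<in> PiE X (\<lambda>_. {..<n}). \<forall>i\<in>X. \<exists>t\<in>T. \<forall>j\<in>X - {i}. t j = x j})"
    if "n > 0" "T \<subseteq> PiE X (\<lambda>_. {..<n})" "\<forall>i\<in>X. inj_on (\<lambda>x. restrict x (X - {i})) T"
      "c / 2 * real n ^ (card X - 1) \<le> real (card T)" for n T
    by (rule \<delta>0[THEN conjunct2, THEN spec, THEN mp, OF that(1), THEN spec, THEN mp, OF that(2), THEN mp, OF that(3), THEN mp, OF that(4)])
  show ?thesis
  proof (rule exI[of _ "c / 2 * \<delta>"], intro conjI allI impI)
    show "c / 2 * \<delta> > 0" using c \<delta> by simp
    fix n :: nat and S :: "('a \<Rightarrow> nat) set"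
    assume n: "n > 0" and finS: "finite S" and lt: "\<forall>\<phi>\<in>S. \<forall>w\<in>U \<union> X. \<phi> w < n"
      and det: "\<forall>\<phi>\<in>S. \<forall>\<psi>\<in>S. \<forall>i\<in>X. (\<forall>w\<in>U \<union> (X - {i}). \<phi> w = \<psi> w) \<longrightarrow> \<phi> = \<psi>"
      and card: "c * real n ^ k \<le> real (card S)"
    obtain i0 where i0: "i0 \<in> X" using Xne by blast
    let ?PU = "PiE U (\<lambda>_. {..<n})"
    have finPU: "finite ?PU" using fin by (intro finite_PiE) auto
    have cPU: "card ?PU = n ^ card U" using fin by (simp add: card_PiE)
    have det': "\<phi> = \<psi>" if "\<phi> \<in> over S U u" "\<psi> \<in> over S U u" "i \<in> X" "\<And>j. j \<in> X - {i} \<Longrightarrow> \<phi> j = \<psi> j" for \<phi> \<psi> u i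
    proof -
      have a: "\<phi> \<in> S" "\<psi> \<in> S" "\<And>w. w \<in> U \<Longrightarrow> \<phi> w = \<psi> w" using that(1,2) by (simp_all add: over_def)
      have "\<forall>w\<in>U \<union> (X - {i}). \<phi> w = \<psi> w" using a(3) that(4) by blast
      then show ?thesis using det a(1,2) that(3) by blast
    qed
    have finov: "finite (over S U u)" for u using finS by (simp add: over_def)
    define T where "T u = (\<lambda>\<phi>. restrict \<phi> X) ` over S U u" for u
    have injR: "inj_on (\<lambda>\<phi>. restrict \<phi> (X - {i})) (over S U u)" if i: "i \<in> X" for u i
    proof (rule inj_onI)
      fix \<phi> \<psi> assume *: "\<phi> \<in> over S U u" "\<psi> \<in> over S U u" "restrict \<phi> (X - {i}) = restrict \<psi> (X - {i})"
      have "\<phi> j = \<psi> j" if "j \<in> X - {i}" for j using fun_cong[OF *(3), of j] that by simp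
      then show "\<phi> = \<psi>" using det'[OF *(1,2) i] by blast
    qed
    have injX: "inj_on (\<lambda>\<phi>. restrict \<phi> X) (over S U u)" for u
    proof (rule inj_onI)
      fix \<phi> \<psi> assume *: "\<phi> \<in> over S U u" "\<psi> \<in> over S U u" "restrict \<phi> X = restrict \<psi> X"
      have "\<phi> j = \<psi> j" if "j \<in> X - {i0}" for j using fun_cong[OF *(3), of j] that by simp
      then show "\<phi> = \<psi>" using det'[OF *(1,2) i0] by blast
    qed
    have cT: "card (T u) = card (over S U u)" for u unfolding T_def by (rule card_image[OF injX])
    have cle: "card (over S U u) \<le> n ^ (card X - 1)" for u
    proof -
      have "card (over S U u) \<le> card (PiE (X - {i0}) (\<lambda>_. {..<n}))"
      proof (rule card_inj_on_le[OF injR[OF i0]])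
        show "(\<lambda>\<phi>. restrict \<phi> (X - {i0})) ` over S U u \<subseteq> PiE (X - {i0}) (\<lambda>_. {..<n})"
          by (rule image_subsetI) (use lt in \<open>simp add: over_def restrict_PiE_iff\<close>)
        show "finite (PiE (X - {i0}) (\<lambda>_. {..<n}))" using fin by (intro finite_PiE) auto
      qed
      then show ?thesis using fin i0 by (simp add: card_PiE)
    qed
    define m where "m = card X - 1"
    have km: "k = card U + m" using k X by (simp add: m_def)
    define Gd where "Gd = {u \<in> ?PU. c / 2 * real n ^ m \<le> real (card (over S U u))}"
    have finGd: "finite Gd" using finPU by (simp add: Gd_def)
    have "S \<subseteq> (\<Union>u\<in>?PU. over S U u)"
    proof
      fix \<phi> assume "\<phi> \<in> S"
      then have "restrict \<phi> U \<in> ?PU" "\<phi> \<in> over S U (restrict \<phi> U)"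
        using lt by (simp_all add: over_def restrict_PiE_iff)
      then show "\<phi> \<in> (\<Union>u\<in>?PU. over S U u)" by blast
    qed
    then have "card S \<le> card (\<Union>u\<in>?PU. over S U u)" using finPU finov by (intro card_mono) auto
    also have "\<dots> \<le> (\<Sum>u\<in>?PU. card (over S U u))" by (rule card_UN_le[OF finPU])
    finally have "real (card S) \<le> (\<Sum>u\<in>?PU. real (card (over S U u)))" by (metis of_nat_le_iff of_nat_sum)
    also have "\<dots> \<le> (\<Sum>u\<in>?PU. (if u \<in> Gd then real n ^ m else 0) + c / 2 * real n ^ m)"
    proof (rule sum_mono)
      fix u assume u: "u \<in> ?PU"
      show "real (card (over S U u)) \<le> (if u \<in> Gd then real n ^ m else 0) + c / 2 * real n ^ m"
      proof (cases "u \<in> Gd")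
        case True
        have "real (card (over S U u)) \<le> real n ^ m" using cle[of u] unfolding m_def by (metis of_nat_le_iff of_nat_power)
        moreover have "0 \<le> c / 2 * real n ^ m" using c by simp
        ultimately show ?thesis unfolding if_P[OF True] by linarith
      next
        case False then show ?thesis using u by (simp add: Gd_def)
      qed
    qed
    also have "\<dots> = real (card Gd) * real n ^ m + real n ^ card U * (c / 2 * real n ^ m)"
    proof -
      have "?PU \<inter> {u. u \<in> Gd} = Gd" by (auto simp: Gd_def)
      then show ?thesis using finPU by (simp add: sum.distrib sum.If_cases cPU)
    qed
    finally have "c * real n ^ k \<le> real (card Gd) * real n ^ m + real n ^ card U * (c / 2 * real n ^ m)" using card by simp
    moreover have "real n ^ k = real n ^ card U * real n ^ m" by (simp add: km power_add)
    ultimately have "(c / 2 * real n ^ card U) * real n ^ m \<le> real (card Gd) * real n ^ m" by (simp add: algebra_simps)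
    then have cGd: "c / 2 * real n ^ card U \<le> real (card Gd)" using n by simp
    have each: "\<delta> * real n ^ card X \<le> real (card (simplices S U X n u))" if u: "u \<in> Gd" for u
    proof -
      have "\<delta> * real n ^ card X \<le> real (card {x \<in> PiE X (\<lambda>_. {..<n}). \<forall>i\<in>X. \<exists>t\<in>T u. \<forall>j\<in>X - {i}. t j = x j})"
      proof (rule rem[OF n])
        show "T u \<subseteq> PiE X (\<lambda>_. {..<n})"
          unfolding T_def by (rule image_subsetI) (use lt in \<open>simp add: over_def restrict_PiE_iff\<close>)
        show "c / 2 * real n ^ (card X - 1) \<le> real (card (T u))" using u by (simp add: Gd_def cT m_def)
        show "\<forall>i\<in>X. inj_on (\<lambda>x. restrict x (X - {i})) (T u)"
        proof
          fix i assume i: "i \<in> X"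
          have "inj_on ((\<lambda>x. restrict x (X - {i})) \<circ> (\<lambda>\<phi>. restrict \<phi> X)) (over S U u)"
          proof -
            have eq: "((\<lambda>x. restrict x (X - {i})) \<circ> (\<lambda>\<phi>. restrict \<phi> X)) = (\<lambda>\<phi>. restrict \<phi> (X - {i}))"
              by (auto simp: fun_eq_iff restrict_def)
            show ?thesis unfolding eq by (rule injR[OF i])
          qed
          then show "inj_on (\<lambda>x. restrict x (X - {i})) (T u)" unfolding T_def by (rule inj_on_imageI)
        qed
      qed
      also have "{x \<in> PiE X (\<lambda>_. {..<n}). \<forall>i\<in>X. \<exists>t\<in>T u. \<forall>j\<in>X - {i}. t j = x j} = simplices S U X n u"
        by (simp add: simplices_def T_def)
      finally show ?thesis .
    qed
    have finsim: "finite (simplices S U X n u)" for u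
      unfolding simplices_def using fin by (intro finite_subset[OF _ finite_PiE[of X "\<lambda>_. {..<n}"]]) auto
    have "c / 2 * \<delta> * real n ^ (k + 1) = (c / 2 * real n ^ card U) * (\<delta> * real n ^ card X)"
      using k by (simp add: power_add[symmetric] mult_ac)
    also have "\<dots> \<le> real (card Gd) * (\<delta> * real n ^ card X)" using cGd \<delta> by (intro mult_right_mono) auto
    also have "\<dots> = (\<Sum>u\<in>Gd. \<delta> * real n ^ card X)" by simp
    also have "\<dots> \<le> (\<Sum>u\<in>Gd. real (card (simplices S U X n u)))" using each by (rule sum_mono)
    also have "\<dots> \<le> (\<Sum>u\<in>?PU. real (card (simplices S U X n u)))"
      using finPU by (intro sum_mono2) (auto simp: Gd_def)
    also have "\<dots> = real (card (Sigma ?PU (simplices S U X n)))" using finPU finsim by (simp add: card_SigmaI)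
    finally show "c / 2 * \<delta> * real n ^ (k + 1) \<le> real (card (Sigma ?PU (simplices S U X n)))" .
  qed
qed

text \<open>Fix \<open>u\<close> and all coordinates of \<open>x\<close> but the one at
  \<open>i\<close>. They determine face \<open>i\<close>, hence the common value, which face
  \<open>j\<close> takes at \<open>w'\<close>; with \<open>U\<close> and \<open>X - {i,j}\<close>
  this determines face \<open>j\<close> and so \<open>x i\<close>. One degree of freedom is lost.
  Here the arbitrary further vertex of \<open>star\<close> is essential.\<close>

lemma few_coincidences:
  fixes U X :: "'a set"
  assumes fin: "finite U" "finite X" and k: "card U + card X = k + 1" and ij: "i \<in> X" "j \<in> X" "i \<noteq> j"
    and det1: "\<And>\<phi> \<psi>. \<phi> \<in> S \<Longrightarrow> \<psi> \<in> S \<Longrightarrow> (\<And>y. y \<in> U \<union> (X - {i}) \<Longrightarrow> \<phi> y = \<psi> y) \<Longrightarrow> \<phi> = \<psi>"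
    and det2: "\<And>\<phi> \<psi>. \<phi> \<in> S \<Longrightarrow> \<psi> \<in> S \<Longrightarrow> (\<And>y. y \<in> insert w' (U \<union> (X - {i,j})) \<Longrightarrow> \<phi> y = \<psi> y) \<Longrightarrow> \<phi> = \<psi>"
  shows "card {(u,x). u \<in> PiE U (\<lambda>_. {..<n}) \<and> x \<in> simplices S U X n u \<and> face S U X u x i w = face S U X u x j w'} \<le> n ^ k"
    (is "card ?B \<le> _")
proof -
  let ?f = "\<lambda>(u,x). (u, restrict x (X - {i}))"
  have inj: "inj_on ?f ?B"
  proof (rule inj_onI)
    fix p q assume p: "p \<in> ?B" and q: "q \<in> ?B" and eq: "?f p = ?f q"
    obtain u x where px: "p = (u, x)" by (cases p)
    obtain u' y where qy: "q = (u', y)" by (cases q)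
    have uu: "u' = u" and r: "restrict x (X - {i}) = restrict y (X - {i})" using eq by (simp_all add: px qy)
    have x: "x \<in> simplices S U X n u" and fx: "face S U X u x i w = face S U X u x j w'" using p by (simp_all add: px)
    have y: "y \<in> simplices S U X n u" and fy: "face S U X u y i w = face S U X u y j w'" using q by (simp_all add: qy uu)
    have xy: "x l = y l" if "l \<in> X" "l \<noteq> i" for l using fun_cong[OF r, of l] that by simp
    have fi: "face S U X u x i = face S U X u y i"
    proof (rule det1)
      show "face S U X u x i \<in> S" by (rule faceI(1)[OF x ij(1)])
      show "face S U X u y i \<in> S" by (rule faceI(1)[OF y ij(1)])
      fix l assume "l \<in> U \<union> (X - {i})"
      then consider "l \<in> U" | "l \<in> X" "l \<noteq> i" by blast
      then show "face S U X u x i l = face S U X u y i l"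
      proof cases
        case 1 then show ?thesis using faceI(2)[OF x ij(1)] faceI(2)[OF y ij(1)] by simp
      next
        case 2 then show ?thesis using faceI(3)[OF x ij(1)] faceI(3)[OF y ij(1)] xy by simp
      qed
    qed
    have fj: "face S U X u x j = face S U X u y j"
    proof (rule det2)
      show "face S U X u x j \<in> S" by (rule faceI(1)[OF x ij(2)])
      show "face S U X u y j \<in> S" by (rule faceI(1)[OF y ij(2)])
      fix l assume "l \<in> insert w' (U \<union> (X - {i,j}))"
      then consider "l = w'" | "l \<in> U" | "l \<in> X" "l \<noteq> i" "l \<noteq> j" by blast
      then show "face S U X u x j l = face S U X u y j l"
      proof cases
        case 1 then show ?thesis using fx fy fi by simp
      next
        case 2 then show ?thesis using faceI(2)[OF x ij(2)] faceI(2)[OF y ij(2)] by simp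
      next
        case 3 then show ?thesis using faceI(3)[OF x ij(2)] faceI(3)[OF y ij(2)] xy by simp
      qed
    qed
    have "x i = y i" using faceI(3)[OF x ij(2) ij(1,3)] faceI(3)[OF y ij(2) ij(1,3)] fj by simp
    then have "x l = y l" if "l \<in> X" for l using xy that by (cases "l = i") auto
    moreover have "x \<in> PiE X (\<lambda>_. {..<n})" "y \<in> PiE X (\<lambda>_. {..<n})" using x y by (simp_all add: simplices_def)
    ultimately have "x = y" by (intro PiE_ext[of x X "\<lambda>_. {..<n}" y])
    then show "p = q" by (simp add: px qy uu)
  qed
  have "card ?B \<le> card (PiE U (\<lambda>_. {..<n}) \<times> PiE (X - {i}) (\<lambda>_. {..<n}))"
  proof (rule card_inj_on_le[OF inj])
    show "?f ` ?B \<subseteq> PiE U (\<lambda>_. {..<n}) \<times> PiE (X - {i}) (\<lambda>_. {..<n})"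
    proof (rule image_subsetI)
      fix p assume p: "p \<in> ?B"
      obtain u x where px: "p = (u, x)" by (cases p)
      have u: "u \<in> PiE U (\<lambda>_. {..<n})" and x: "x \<in> PiE X (\<lambda>_. {..<n})" using p by (simp_all add: px simplices_def)
      have "x l < n" if "l \<in> X" for l using PiE_mem[OF x that] by simp
      then show "?f p \<in> PiE U (\<lambda>_. {..<n}) \<times> PiE (X - {i}) (\<lambda>_. {..<n})"
        using u by (simp add: px restrict_PiE_iff)
    qed
    show "finite (PiE U (\<lambda>_. {..<n}) \<times> PiE (X - {i}) (\<lambda>_. {..<n}))"
      using fin by (intro finite_cartesian_product finite_PiE) auto
  qed
  also have "\<dots> = n ^ card U * n ^ (card X - 1)" using fin ij by (simp add: card_cartesian_product card_PiE)
  also have "\<dots> = n ^ k"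
  proof -
    have "card X \<ge> 1" using ij fin by (auto simp: Suc_le_eq card_gt_0_iff)
    then have "card U + (card X - 1) = k" using k by simp
    then show ?thesis by (simp add: power_add[symmetric])
  qed
  finally show ?thesis .
qed

text \<open>The faces of a simplex agree on shared vertices and so define a map on the glued vertex
  set. The condition in \<open>G\<close> rules out equal values of different faces except at
  vertices of \<open>U\<close> and of \<open>X - {i,j}\<close>, where they have to agree; this gives
  injectivity. The pair \<open>(u, x)\<close> can be read off from the shared vertices.\<close>

lemma glue_copies:
  fixes U X :: "pos set"
  assumes m: "marked E k U X" and S: "S \<subseteq> copies E H n"
  defines "G \<equiv> {(u,x). u \<in> PiE U (\<lambda>_. {..<n}) \<and> x \<in> simplices S U X n u \<and>
      (\<forall>i\<in>X. \<forall>j\<in>X. i \<noteq> j \<longrightarrow> (\<forall>w\<in>\<Union>E. \<forall>w'\<in>\<Union>E. w' \<notin> U \<union> (X - {i,j}) \<longrightarrow> face S U X u x i w \<noteq> face S U X u x j w'))}"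
  shows "card G \<le> card (copies (glue E (U \<union> X) X) H n)"
proof -
  let ?Y = "U \<union> X"
  let ?W = "\<Union>E"
  let ?W' = "\<Union>(glue E ?Y X)"
  have conf: "config E k" using m by (simp add: marked_def)
  note fin = config_finite[OF conf]
  have X: "X \<subseteq> ?W" "U \<subseteq> ?W" "card X \<ge> 3" "U \<inter> X = {}" using m by (auto simp: marked_def)
  define ext where "ext = (\<lambda>(u,x). restrict (\<lambda>q. case q of Z a \<Rightarrow> 0 | Sh w \<Rightarrow> if w \<in> U then u w else x w
     | Cp i w \<Rightarrow> face S U X u x i w) ?W')"
  have W': "?W' = (\<Union>i\<in>X. rho ?Y i ` ?W)" by (rule glue_Union)
  have val: "ext (u,x) (rho ?Y i w) = face S U X u x i w"
    if "x \<in> simplices S U X n u" "i \<in> X" "w \<in> ?W" for u x i w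
  proof -
    have mem: "rho ?Y i w \<in> ?W'" unfolding W' using that by blast
    show ?thesis
    proof (cases "w \<in> ?Y - {i}")
      case True
      then have "w \<in> U \<or> (w \<in> X \<and> w \<noteq> i \<and> w \<notin> U)" using X by blast
      then show ?thesis using mem True faceI(2,3)[OF that(1,2)] by (auto simp: ext_def rho_def)
    next
      case False then show ?thesis using mem by (auto simp: ext_def rho_def)
    qed
  qed
  have copy: "ext (u,x) \<in> copies (glue E ?Y X) H n" if \<gamma>: "(u,x) \<in> G" for u x
  proof -
    have x: "x \<in> simplices S U X n u" and nb: "\<And>i j w w'. i \<in> X \<Longrightarrow> j \<in> X \<Longrightarrow> i \<noteq> j \<Longrightarrow> w \<in> ?W \<Longrightarrow> w' \<in> ?W \<Longrightarrow>
        w' \<notin> U \<union> (X - {i,j}) \<Longrightarrow> face S U X u x i w \<noteq> face S U X u x j w'" using \<gamma> unfolding G_def by auto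
    have fc: "face S U X u x i \<in> copies E H n" if "i \<in> X" for i using faceI(1)[OF x that] S by blast
    have v: "ext (u,x) (rho ?Y i w) = face S U X u x i w" if "i \<in> X" "w \<in> ?W" for i w using val[OF x that] .
    have "ext (u,x) q < n" if q: "q \<in> ?W'" for q
    proof -
      obtain i w where iw: "i \<in> X" "w \<in> ?W" "q = rho ?Y i w" using q unfolding W' by blast
      have "face S U X u x i w \<in> {..<n}" using fc[OF iw(1)] iw(2) by (auto simp: copies_def)
      then show ?thesis using v[OF iw(1,2)] iw(3) by simp
    qed
    moreover have "ext (u,x) \<in> extensional ?W'" by (simp add: ext_def)
    ultimately have 1: "ext (u,x) \<in> PiE ?W' (\<lambda>_. {..<n})" by (auto simp: PiE_def)
    have 2: "inj_on (ext (u,x)) ?W'"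
    proof (rule inj_onI)
      fix q q' assume q: "q \<in> ?W'" "q' \<in> ?W'" and eq: "ext (u,x) q = ext (u,x) q'"
      obtain i w where iw: "i \<in> X" "w \<in> ?W" "q = rho ?Y i w" using q(1) unfolding W' by blast
      obtain j w' where jw: "j \<in> X" "w' \<in> ?W" "q' = rho ?Y j w'" using q(2) unfolding W' by blast
      have feq: "face S U X u x i w = face S U X u x j w'" using eq v[OF iw(1,2)] v[OF jw(1,2)] iw(3) jw(3) by simp
      have inji: "inj_on (face S U X u x i) ?W" using fc[OF iw(1)] by (simp add: copies_def)
      show "q = q'"
      proof (cases "i = j")
        case True
        then have "w = w'" using inj_onD[OF inji _ iw(2) jw(2)] feq by simp
        then show ?thesis using iw jw True by simp
      next
        case False
        have w'in: "w' \<in> U \<union> (X - {i,j})" using nb[OF iw(1) jw(1) False iw(2) jw(2)] feq by blast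
        have "face S U X u x j w' = face S U X u x i w'"
          using w'in faceI(2,3)[OF x iw(1)] faceI(2,3)[OF x jw(1)] by auto
        then have "w = w'" using inj_onD[OF inji _ iw(2) jw(2)] feq by simp
        moreover have "w' \<in> ?Y - {i,j}" using w'in X iw(1) jw(1) by blast
        ultimately show ?thesis unfolding iw(3) jw(3) using rho_eq[OF False, of ?Y w w'] by simp
      qed
    qed
    have "ext (u,x) ` e \<in> H" if e: "e \<in> glue E ?Y X" for e
    proof -
      obtain i e' where ie: "i \<in> X" "e' \<in> E" "e = rho ?Y i ` e'" using e by (auto simp: glue_def)
      have "ext (u,x) ` e = face S U X u x i ` e'"
        unfolding ie(3) image_image by (rule image_cong[OF refl]) (use v[OF ie(1)] ie(2) in blast)
      then show ?thesis using fc[OF ie(1)] ie(2) by (simp add: copies_def)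
    qed
    then show ?thesis using 1 2 unfolding copies_def by blast
  qed
  have inj: "inj_on ext G"
  proof (rule inj_onI)
    fix p q assume p: "p \<in> G" and q: "q \<in> G" and eq: "ext p = ext q"
    obtain u x where px: "p = (u, x)" by (cases p)
    obtain u' y where qy: "q = (u', y)" by (cases q)
    have u: "u \<in> PiE U (\<lambda>_. {..<n})" "u' \<in> PiE U (\<lambda>_. {..<n})" and x: "x \<in> simplices S U X n u" "y \<in> simplices S U X n u'"
      using p q unfolding G_def px qy by auto
    have mem: "Sh w \<in> ?W'" if "w \<in> ?Y" for w
    proof -
      obtain i where i: "i \<in> X" "i \<noteq> w" using ex_other[of X w] X(3) by auto
      have "rho ?Y i w = Sh w" using that i by (auto simp: rho_def)
      moreover have "w \<in> ?W" using that X by blast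
      ultimately show ?thesis unfolding W' using i(1) by (metis UN_iff imageI)
    qed
    have "u w = u' w" if "w \<in> U" for w
      using fun_cong[OF eq, of "Sh w"] mem[of w] that by (simp add: ext_def px qy)
    then have uu: "u = u'" using u by (intro PiE_ext[of u U "\<lambda>_. {..<n}" u'])
    have "x w = y w" if "w \<in> X" for w
    proof -
      have "w \<notin> U" using that X by blast
      then show ?thesis using fun_cong[OF eq, of "Sh w"] mem[of w] that by (simp add: ext_def px qy)
    qed
    moreover have "x \<in> PiE X (\<lambda>_. {..<n})" "y \<in> PiE X (\<lambda>_. {..<n})" using x by (simp_all add: simplices_def)
    ultimately have "x = y" by (intro PiE_ext[of x X "\<lambda>_. {..<n}" y])
    then show "p = q" using uu px qy by simp
  qed
  have finW': "finite ?W'" by (rule config_finite(2)[OF glue_config(1)[OF m]])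
  show ?thesis
  proof (rule card_inj_on_le[OF inj])
    show "ext ` G \<subseteq> copies (glue E ?Y X) H n" using copy by auto
    show "finite (copies (glue E ?Y X) H n)" by (rule finite_copies[OF finW'])
  qed
qed

text \<open>There are at least of the order of \<open>n ^ (k + 1)\<close> simplices, while each of
  the at most \<open>q\<close> kinds of coincidence spoils at most \<open>n ^ k\<close> of them, so
  for large \<open>n\<close> at least half the guaranteed number survives.\<close>

lemma abundant_glue:
  assumes m: "marked E k U X" and ab: "abundant p D E k" and bf: "bounded_fibres p D E k"
  shows "abundant p D (glue E (U \<union> X) X) (k + 1)"
  unfolding abundant_def
proof (intro allI impI)
  fix \<epsilon> :: real assume e: "\<epsilon> > 0"
  have conf: "config E k" using m by (simp add: marked_def)
  note finE = config_finite[OF conf]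
  let ?W = "\<Union>E"
  have X: "X \<subseteq> ?W" "U \<subseteq> ?W" "card X \<ge> 3" "U \<inter> X = {}" "card U + card X = k + 1" using m by (simp_all add: marked_def)
  have fin: "finite U" "finite X" by (rule finite_subset[OF X(2) finE(2)], rule finite_subset[OF X(1) finE(2)])
  from ab[unfolded abundant_def, THEN spec, THEN mp, OF e] obtain \<delta>1 n1 where d1: "\<delta>1 > 0"
    "\<forall>n\<ge>n1. \<forall>H. big \<epsilon> n H \<longrightarrow> \<not> good p D H \<longrightarrow> \<delta>1 * real n ^ k \<le> real (card (copies E H n))" by (elim exE conjE)
  from bf[unfolded bounded_fibres_def, THEN spec, THEN mp, OF e] obtain L n2 where L:
    "\<forall>n\<ge>n2. \<forall>H. big \<epsilon> n H \<longrightarrow> \<not> good p D H \<longrightarrow>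
     (\<forall>A a. A \<subseteq> ?W \<longrightarrow> card A = k \<longrightarrow> hall E A \<longrightarrow> card {\<phi> \<in> copies E H n. \<forall>w\<in>A. \<phi> w = a w} \<le> L)" by (elim exE)
  define B where "B = 2 ^ card ?W * L + 1"
  define c where "c = \<delta>1 / real B"
  have B: "real B > 0" unfolding B_def by (simp only: of_nat_0_less_iff)
  have c: "c > 0" unfolding c_def using d1(1) B by (rule divide_pos_pos)
  from many_simplices[OF fin X(3,5) c] obtain \<delta>2 where d2: "\<delta>2 > 0" "\<forall>n>0. \<forall>S. finite S \<longrightarrow> (\<forall>\<phi>\<in>S. \<forall>w\<in>U \<union> X. \<phi> w < n) \<longrightarrow>
     (\<forall>\<phi>\<in>S. \<forall>\<psi>\<in>S. \<forall>i\<in>X. (\<forall>w\<in>U \<union> (X - {i}). \<phi> w = \<psi> w) \<longrightarrow> \<phi> = \<psi>) \<longrightarrow> c * real n ^ k \<le> real (card S) \<longrightarrow>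
     \<delta>2 * real n ^ (k + 1) \<le> real (card (Sigma (PiE U (\<lambda>_. {..<n})) (simplices S U X n)))" by (elim exE conjE)
  define q where "q = card (X \<times> X \<times> ?W \<times> ?W)"
  define n0 where "n0 = max (max n1 n2) (max 1 (nat \<lceil>2 * real q / \<delta>2\<rceil>))"
  have main: "\<delta>2 / 2 * real n ^ (k + 1) \<le> real (card (copies (glue E (U \<union> X) X) H n))"
    if n: "n0 \<le> n" and H: "big \<epsilon> n H" and ng: "\<not> good p D H" for n H
  proof -
    have n': "n \<ge> n1" "n \<ge> n2" "n > 0" using n by (auto simp: n0_def)
    define C where "C = copies E H n"
    have finC: "finite C" unfolding C_def by (rule finite_copies[OF finE(2)])
    have cC: "\<delta>1 * real n ^ k \<le> real (card C)" unfolding C_def using d1(2) n'(1) H ng by blast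
    have fib: "card {\<phi> \<in> C. \<forall>w\<in>A. \<phi> w = a w} \<le> L" if "A \<subseteq> ?W" "card A = k" "hall E A" for A a
      unfolding C_def using L[THEN spec, THEN mp, OF n'(2), THEN spec, THEN mp, OF H, THEN mp, OF ng] that by blast
    have "\<exists>S\<subseteq>C. (\<forall>\<phi>\<in>S. \<forall>\<psi>\<in>S. \<forall>A. A \<subseteq> ?W \<longrightarrow> card A = k \<longrightarrow> hall E A \<longrightarrow> (\<forall>y\<in>A. \<phi> y = \<psi> y) \<longrightarrow> \<phi> = \<psi>) \<and>
     card C \<le> card S * (2 ^ card ?W * L)" by (rule thin_copies[OF m finC fib])
    then obtain S where
      S0: "S \<subseteq> C \<and> (\<forall>\<phi>\<in>S. \<forall>\<psi>\<in>S. \<forall>A. A \<subseteq> ?W \<longrightarrow> card A = k \<longrightarrow> hall E A \<longrightarrow> (\<forall>y\<in>A. \<phi> y = \<psi> y) \<longrightarrow> \<phi> = \<psi>) \<and>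
     card C \<le> card S * (2 ^ card ?W * L)" by (elim exE)
    have S1: "S \<subseteq> C" and S3: "card C \<le> card S * (2 ^ card ?W * L)" using S0 by simp_all
    have S2: "\<phi> = \<psi>" if "\<phi> \<in> S" "\<psi> \<in> S" "A \<subseteq> ?W" "card A = k" "hall E A" "\<forall>y\<in>A. \<phi> y = \<psi> y" for \<phi> \<psi> A
      using S0[THEN conjunct2, THEN conjunct1, THEN bspec, OF that(1), THEN bspec, OF that(2), THEN spec, THEN mp, OF that(3),
        THEN mp, OF that(4), THEN mp, OF that(5), THEN mp, OF that(6)] .
    have finS: "finite S" by (rule finite_subset[OF S1 finC])
    have "card C \<le> card S * B" using S3 by (simp add: B_def algebra_simps)
    then have "real (card C) \<le> real (card S) * real B" by (metis of_nat_le_iff of_nat_mult)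
    then have "\<delta>1 * real n ^ k \<le> real (card S) * real B" using cC by linarith
    then have cS: "c * real n ^ k \<le> real (card S)" using B by (simp add: c_def field_simps)
    have cXij: "card (X - {i,j}) = card X - 2" if "i \<in> X" "j \<in> X" "i \<noteq> j" for i j
      using fin that by (simp add: card_Diff_subset)
    have det2: "\<phi> = \<psi>" if "i \<in> X" "j \<in> X" "i \<noteq> j" "w' \<in> ?W" "w' \<notin> U \<union> (X - {i,j})" "\<phi> \<in> S" "\<psi> \<in> S"
      "\<And>y. y \<in> insert w' (U \<union> (X - {i,j})) \<Longrightarrow> \<phi> y = \<psi> y" for i j w' \<phi> \<psi>
    proof -
      have w: "w' \<in> ?W" "w' \<notin> U" "w' \<notin> X - {i,j}" using that by blast+
      note h = star_hall[OF m Diff_subset cXij[OF that(1-3)] w]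
      show ?thesis by (rule S2[OF that(6,7) h(3,2,1)]) (use that(8) in blast)
    qed
    \<comment> \<open>The facet opposite \<open>i\<close> is the case of \<open>det2\<close> in
      which the further vertex is another mark \<open>j\<close>.\<close>
    have det1: "\<phi> = \<psi>" if "i \<in> X" "\<phi> \<in> S" "\<psi> \<in> S" "\<And>y. y \<in> U \<union> (X - {i}) \<Longrightarrow> \<phi> y = \<psi> y" for i \<phi> \<psi>
    proof -
      obtain j where j: "j \<in> X" "j \<noteq> i" using ex_other[of X i] X(3) by auto
      show ?thesis
        by (rule det2[of i j j]) (use that j X in auto)
    qed
    have lt: "\<forall>\<phi>\<in>S. \<forall>w\<in>U \<union> X. \<phi> w < n"
    proof (intro ballI)
      fix \<phi> w assume "\<phi> \<in> S" "w \<in> U \<union> X"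
      then have "\<phi> \<in> PiE ?W (\<lambda>_. {..<n})" "w \<in> ?W" using S1 X by (auto simp: C_def copies_def)
      then show "\<phi> w < n" using PiE_mem by fastforce
    qed
    have detall: "\<forall>\<phi>\<in>S. \<forall>\<psi>\<in>S. \<forall>i\<in>X. (\<forall>w\<in>U \<union> (X - {i}). \<phi> w = \<psi> w) \<longrightarrow> \<phi> = \<psi>"
      by (intro ballI impI) (rule det1, auto)
    let ?Sig = "Sigma (PiE U (\<lambda>_. {..<n})) (simplices S U X n)"
    have big: "\<delta>2 * real n ^ (k + 1) \<le> real (card ?Sig)"
      using d2(2)[THEN spec, THEN mp, OF n'(3), THEN spec, THEN mp, OF finS, THEN mp, OF lt, THEN mp, OF detall, THEN mp, OF cS] .
    define Bad where "Bad i j w w' = {(u,x). u \<in> PiE U (\<lambda>_. {..<n}) \<and> x \<in> simplices S U X n u \<and> face S U X u x i w = face S U X u x j w'}" for i j w w'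
    define Qd where "Qd = {(i,j,w,w'). i \<in> X \<and> j \<in> X \<and> i \<noteq> j \<and> w \<in> ?W \<and> w' \<in> ?W \<and> w' \<notin> U \<union> (X - {i,j})}"
    have Qsub: "Qd \<subseteq> X \<times> X \<times> ?W \<times> ?W" by (auto simp: Qd_def)
    have finQ: "finite Qd" by (rule finite_subset[OF Qsub]) (use fin finE in simp)
    have cQ: "card Qd \<le> q" unfolding q_def by (rule card_mono[OF _ Qsub]) (use fin finE in simp)
    have bad: "card (Bad i j w w') \<le> n ^ k" if "(i,j,w,w') \<in> Qd" for i j w w'
    proof -
      have Q: "i \<in> X" "j \<in> X" "i \<noteq> j" "w' \<in> ?W" "w' \<notin> U \<union> (X - {i,j})" using that by (simp_all add: Qd_def)
      show ?thesis unfolding Bad_def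
        by (rule few_coincidences[OF fin X(5) Q(1-3)]) (use det1[OF Q(1)] det2[OF Q] in blast)+
    qed
    define G where "G = {(u,x). u \<in> PiE U (\<lambda>_. {..<n}) \<and> x \<in> simplices S U X n u \<and>
      (\<forall>i\<in>X. \<forall>j\<in>X. i \<noteq> j \<longrightarrow> (\<forall>w\<in>\<Union>E. \<forall>w'\<in>\<Union>E. w' \<notin> U \<union> (X - {i,j}) \<longrightarrow> face S U X u x i w \<noteq> face S U X u x j w'))}"
    have finSig: "finite ?Sig"
      using fin by (intro finite_SigmaI finite_PiE) (auto simp: simplices_def intro: finite_subset[OF _ finite_PiE[of X "\<lambda>_. {..<n}"]])
    have GS: "G \<subseteq> ?Sig" by (auto simp: G_def)
    have finG: "finite G" by (rule finite_subset[OF GS finSig])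
    have badS: "Bad i j w w' \<subseteq> ?Sig" for i j w w' by (auto simp: Bad_def)
    have "?Sig \<subseteq> G \<union> (\<Union>(i,j,w,w')\<in>Qd. Bad i j w w')"
    proof
      fix z assume z: "z \<in> ?Sig"
      obtain u x where zx: "z = (u, x)" by (cases z)
      have ux: "u \<in> PiE U (\<lambda>_. {..<n})" "x \<in> simplices S U X n u" using z by (simp_all add: zx)
      show "z \<in> G \<union> (\<Union>(i,j,w,w')\<in>Qd. Bad i j w w')"
      proof (cases "z \<in> G")
        case True then show ?thesis by simp
      next
        case False
        then obtain i j w w' where ij: "i \<in> X" "j \<in> X" "i \<noteq> j" "w \<in> ?W" "w' \<in> ?W" "w' \<notin> U \<union> (X - {i,j})"
          "face S U X u x i w = face S U X u x j w'" using ux unfolding G_def zx mem_Collect_eq prod.case by metis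
        then have "(i,j,w,w') \<in> Qd" "z \<in> Bad i j w w'" using ux by (auto simp: Qd_def Bad_def zx)
        then show ?thesis by blast
      qed
    qed
    then have "card ?Sig \<le> card (G \<union> (\<Union>(i,j,w,w')\<in>Qd. Bad i j w w'))"
      by (rule card_mono[rotated]) (rule finite_subset[OF _ finSig], use GS badS in blast)
    also have "\<dots> \<le> card G + card (\<Union>(i,j,w,w')\<in>Qd. Bad i j w w')" by (rule card_Un_le)
    also have "card (\<Union>(i,j,w,w')\<in>Qd. Bad i j w w') \<le> (\<Sum>t\<in>Qd. card (case t of (i,j,w,w') \<Rightarrow> Bad i j w w'))"
      by (rule card_UN_le[OF finQ])
    also have "\<dots> \<le> (\<Sum>t\<in>Qd. n ^ k)"
      by (rule sum_mono) (use bad in auto)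
    also have "\<dots> \<le> q * n ^ k" using cQ by simp
    finally have "card ?Sig \<le> card G + q * n ^ k" by simp
    then have "real (card ?Sig) \<le> real (card G) + real q * real n ^ k" by (metis of_nat_le_iff of_nat_add of_nat_mult of_nat_power)
    moreover have "real q * real n ^ k \<le> \<delta>2 / 2 * real n ^ (k + 1)"
    proof -
      have "2 * real q / \<delta>2 \<le> real n" using n unfolding n0_def by linarith
      then have "real q \<le> \<delta>2 / 2 * real n" using d2(1) by (simp add: field_simps)
      then have "real q * real n ^ k \<le> (\<delta>2 / 2 * real n) * real n ^ k" by (intro mult_right_mono) auto
      then show ?thesis by (simp add: mult_ac)
    qed
    ultimately have "\<delta>2 / 2 * real n ^ (k + 1) \<le> real (card G)" using big by linarith
    also have "card G \<le> card (copies (glue E (U \<union> X) X) H n)"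
      unfolding G_def by (rule glue_copies[OF m]) (use S1 in \<open>simp add: C_def\<close>)
    finally show ?thesis by simp
  qed
  show "\<exists>\<delta>>0. \<exists>n0. \<forall>n\<ge>n0. \<forall>H. big \<epsilon> n H \<longrightarrow> \<not> good p D H \<longrightarrow> \<delta> * real n ^ (k + 1) \<le> real (card (copies (glue E (U \<union> X) X) H n))"
    by (rule exI[of _ "\<delta>2 / 2"], rule conjI, use d2(1) in simp, rule exI[of _ n0]) (use main in blast)
qed

text \<open>Flexibility up to the marks that are used. An estimate without this term would add the
  \<open>k + 1\<close> shared vertices to the loss at each gluing and make it quadratic; relative to
  the marks it grows by 3 per level.\<close>

definition flexr :: "'a set set \<Rightarrow> 'a set \<Rightarrow> nat \<Rightarrow> bool" where
  "flexr E X h \<longleftrightarrow> (\<forall>j\<le>card E. \<exists>E'\<subseteq>E. card E' = j \<and> card (\<Union>E') \<le> 2 * j + card (X \<inter> \<Union>E') + h)"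

text \<open>Two shared marks are given up and the private apexes of three copies gained. A complete
  copy has only excess \<open>k\<close>, so \<open>star\<close> allows it at most
  \<open>k - 1\<close> new marks. Its facet and its apex would give too many if fewer than two
  shared marks were dropped, and three apexes are then needed to reach \<open>k + 2\<close>
  marks.\<close>

definition new_marks :: "pos set \<Rightarrow> pos \<Rightarrow> pos \<Rightarrow> pos \<Rightarrow> pos \<Rightarrow> pos \<Rightarrow> pos set" where
  "new_marks X y1 y2 y3 y4 y5 = Sh ` (X - {y1,y2}) \<union> {Cp y3 y3, Cp y4 y4, Cp y5 y5}"

lemma rho_new_marks:
  shows "rho X y3 ` (X - {y1,y2}) \<subseteq> new_marks X y1 y2 y3 y4 y5"
proof
  fix x assume "x \<in> rho X y3 ` (X - {y1,y2})"
  then obtain w where w: "w \<in> X - {y1,y2}" "x = rho X y3 w" by (elim imageE)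
  show "x \<in> new_marks X y1 y2 y3 y4 y5"
    using w by (cases "w = y3") (simp_all add: rho_def new_marks_def)
qed

lemma card_new_marks:
  assumes fin: "finite X" and y: "distinct [y1,y2,y3,y4,y5]" "{y1,y2,y3,y4,y5} \<subseteq> X"
  shows "card (new_marks X y1 y2 y3 y4 y5) = card X + 1"
proof -
  have "card (new_marks X y1 y2 y3 y4 y5) = card (Sh ` (X - {y1,y2})) + card {Cp y3 y3, Cp y4 y4, Cp y5 y5}"
    unfolding new_marks_def using fin by (intro card_Un_disjoint) auto
  also have "card (Sh ` (X - {y1,y2})) = card (X - {y1,y2})" by (rule card_image) (simp add: inj_on_def)
  also have "\<dots> = card X - 2" using y fin by (simp add: card_Diff_subset)
  also have "card {Cp y3 y3, Cp y4 y4, Cp y5 y5} = 3" using y by simp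
  finally show ?thesis using card_mono[OF fin y(2)] y(1) by simp
qed

text \<open>Take \<open>q\<close> whole copies, among them the one at \<open>y3\<close>, and
  \<open>r\<close> edges of one more. The copy at \<open>y3\<close> holds all but two as many new
  marks as there are shared vertices, and the partial copy may add its apex \<open>i\<close>: this
  is the increase by 3. For \<open>q = 0\<close> only two marks are lost.\<close>

lemma glue_flexr:
  assumes m: "marked E k {} X" and y: "distinct [y1,y2,y3,y4,y5]" "{y1,y2,y3,y4,y5} \<subseteq> X"
    and fl: "flexr E X h"
  shows "flexr (glue E X X) (new_marks X y1 y2 y3 y4 y5) (h + 3)"
  unfolding flexr_def
proof (intro allI impI)
  fix j assume j: "j \<le> card (glue E X X)"
  let ?X' = "new_marks X y1 y2 y3 y4 y5"
  let ?W = "\<Union>E"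
  have conf: "config E k" using m by (simp add: marked_def)
  note finE = config_finite[OF conf]
  have X: "X \<subseteq> ?W" "card X \<ge> 3" "card X = k + 1" using m by (simp_all add: marked_def)
  have finX: "finite X" by (rule finite_subset[OF X(1) finE(2)])
  have cg: "card (glue E X X) = card X * card E" using glue_config(2)[OF m] by simp
  define e where "e = card E"
  have "E \<noteq> {}" using X by auto
  then have e: "e > 0" using finE by (simp add: e_def card_gt_0_iff)
  define q where "q = j div e"
  define r where "r = j mod e"
  have jqr: "j = q * e + r" "r < e" using e by (simp_all add: q_def r_def)
  obtain E0 where E0: "E0 \<subseteq> E" "card E0 = r" "card (\<Union>E0) \<le> 2 * r + card (X \<inter> \<Union>E0) + h"
    using fl[unfolded flexr_def, THEN spec, THEN mp, of r] jqr(2) by (auto simp: e_def)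
  have finE0: "finite E0" by (rule finite_subset[OF E0(1) finE(1)])
  have finP0: "finite (\<Union>E0)" by (rule finite_subset[OF Union_mono[OF E0(1)] finE(2)])
  have y3: "y3 \<in> X" using y by simp
  have two: "card A - 2 \<le> card (A - {y1,y2})" if "finite A" for A
    using diff_card_le_card_Diff[of "{y1,y2}" A] y(1) by simp
  show "\<exists>E'\<subseteq>glue E X X. card E' = j \<and> card (\<Union>E') \<le> 2 * j + card (?X' \<inter> \<Union>E') + (h + 3)"
  proof (cases "q = 0")
    case True
    let ?E' = "(`) (rho X y3) ` E0"
    have "?E' \<subseteq> glue E X X" using E0(1) y3 by (auto simp: glue_def)
    moreover have "card ?E' = j" using card_image[OF rho_image_inj] E0(2) jqr True by simp
    moreover have UE: "\<Union>?E' = rho X y3 ` \<Union>E0" by auto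
    have "card (\<Union>?E') = card (\<Union>E0)" unfolding UE by (rule card_image[OF rho_inj])
    moreover have "card (X \<inter> \<Union>E0) - 2 \<le> card (?X' \<inter> \<Union>?E')"
    proof -
      have "card (X \<inter> \<Union>E0) - 2 \<le> card (X \<inter> \<Union>E0 - {y1,y2})" using finX by (intro two) simp
      also have "\<dots> = card (rho X y3 ` (X \<inter> \<Union>E0 - {y1,y2}))" by (rule card_image[OF rho_inj, symmetric])
      also have "\<dots> \<le> card (?X' \<inter> \<Union>?E')"
      proof (rule card_mono)
        show "finite (?X' \<inter> \<Union>?E')" unfolding UE using finP0 by simp
        show "rho X y3 ` (X \<inter> \<Union>E0 - {y1,y2}) \<subseteq> ?X' \<inter> \<Union>?E'"
          unfolding UE using rho_new_marks[of X y3 y1 y2 y4 y5] by blast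
      qed
      finally show ?thesis .
    qed
    ultimately show ?thesis using E0(3) jqr True by (intro exI[of _ ?E']) simp
  next
    case False
    have qX: "q \<le> card X" using j unfolding cg q_def e_def[symmetric]
      by (metis div_le_mono e nonzero_mult_div_cancel_right less_numeral_extra(3))
    have "q - 1 \<le> card (X - {y3})" using qX finX y3 by simp
    then obtain Q0 where Q0: "Q0 \<subseteq> X - {y3}" "card Q0 = q - 1" "finite Q0" by (rule obtain_subset_with_card_n)
    \<comment> \<open>The copy at \<open>y3\<close> is always included because its own apex is a new
      mark that replaces the shared vertex \<open>y3\<close> it lacks.\<close>
    define Q where "Q = insert y3 Q0"
    have finQ0: "finite Q0" by (rule finite_subset[OF Q0(1)]) (use finX in simp)
    have "y3 \<notin> Q0" using Q0(1) by blast
    then have Q: "Q \<subseteq> X" "y3 \<in> Q" "card Q = q" using Q0 y3 finQ0 False by (auto simp: Q_def)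
    have finQ: "finite Q" by (rule finite_subset[OF Q(1) finX])
    obtain i where i: "i \<in> X" "r > 0 \<Longrightarrow> i \<notin> Q"
    proof (cases "r > 0")
      case True
      have "q \<noteq> card X"
      proof
        assume "q = card X"
        then show False using j jqr True unfolding cg e_def[symmetric] by simp
      qed
      then have "Q \<noteq> X" using Q(3) by auto
      then show thesis using that Q(1) by blast
    next
      case False then show thesis using that[OF y3] by simp
    qed
    define F where "F a = (if a \<in> Q then E else if a = i then E0 else {})" for a
    have F: "F a \<subseteq> E" for a using E0(1) by (simp add: F_def)
    define E' where "E' = (\<Union>a\<in>X. (`) (rho X a) ` F a)"
    have split: "sum f X = sum f (X - Q) + sum f Q" for f :: "pos \<Rightarrow> nat" by (rule sum.subset_diff[OF Q(1) finX])
    have delta: "(\<Sum>a\<in>X - Q. if a = i then c else 0) = (if i \<in> X - Q then c else 0)" for c :: nat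
      using finX by (simp add: sum.delta)
    have s1: "(\<Sum>a\<in>X. card (F a)) = j"
    proof -
      have "(\<Sum>a\<in>Q. card (F a)) = (\<Sum>a\<in>Q. e)" by (rule sum.cong) (simp_all add: F_def e_def)
      moreover have "(\<Sum>a\<in>X - Q. card (F a)) = (\<Sum>a\<in>X - Q. if a = i then r else 0)"
        by (rule sum.cong) (auto simp: F_def E0(2))
      moreover have "\<dots> = r" unfolding delta using i by auto
      ultimately show ?thesis unfolding split[of "\<lambda>a. card (F a)"] using Q(3) jqr(1) by simp
    qed
    have cardE': "card E' = j" unfolding E'_def using glue_card[OF m, of F] F s1 by simp
    have sub: "E' \<subseteq> glue E X X" unfolding E'_def glue_def using F by blast
    have UE: "\<Union>E' = (\<Union>a\<in>X. rho X a ` \<Union>(F a))" by (auto simp: E'_def)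
    have full: "card (?W - (X - {a})) = 2 * e" if "a \<in> X" for a
    proof -
      have "card (?W - (X - {a})) = card ?W - card (X - {a})" using X finX by (intro card_Diff_subset) auto
      then show ?thesis using conf X that finX by (simp add: config_def e_def)
    qed
    have part: "card (\<Union>E0 - (X - {i})) \<le> 2 * r + h + 1"
    proof -
      have "card (\<Union>E0 - (X - {i})) \<le> card (insert i (\<Union>E0 - X))" using finP0 by (intro card_mono) auto
      also have "\<dots> \<le> Suc (card (\<Union>E0 - X))" using finP0 by (simp add: card_insert_if)
      also have "card (\<Union>E0 - X) = card (\<Union>E0) - card (\<Union>E0 \<inter> X)" using finP0 by (intro card_Diff_subset_Int) simp
      finally show ?thesis using E0(3) by (simp add: Int_commute)
    qed
    have s2: "(\<Sum>a\<in>X. card (\<Union>(F a) - (X - {a}))) \<le> q * (2 * e) + (2 * r + h + 1)"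
    proof -
      have "(\<Sum>a\<in>Q. card (\<Union>(F a) - (X - {a}))) = (\<Sum>a\<in>Q. 2 * e)"
        by (rule sum.cong) (use full Q(1) in \<open>auto simp: F_def\<close>)
      moreover have "(\<Sum>a\<in>X - Q. card (\<Union>(F a) - (X - {a}))) \<le> (\<Sum>a\<in>X - Q. if a = i then 2 * r + h + 1 else 0)"
        by (rule sum_mono) (use part in \<open>auto simp: F_def\<close>)
      moreover have "\<dots> \<le> 2 * r + h + 1" unfolding delta by simp
      ultimately show ?thesis unfolding split[of "\<lambda>a. card (\<Union>(F a) - (X - {a}))"] using Q(3) by simp
    qed
    have finF: "finite (\<Union>(F a))" for a by (rule finite_subset[OF Union_mono[OF F] finE(2)])
    have "card (\<Union>E') = card {w \<in> X. \<exists>a\<in>X. a \<noteq> w \<and> w \<in> \<Union>(F a)} + (\<Sum>a\<in>X. card (\<Union>(F a) - (X - {a})))"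
      unfolding UE by (rule glue_card_Union[OF finX subset_refl _ finF refl]) (use X in simp)
    also have "\<dots> \<le> card X + (q * (2 * e) + (2 * r + h + 1))"
      by (rule add_mono[OF _ s2]) (use finX in \<open>auto intro!: card_mono\<close>)
    finally have up: "card (\<Union>E') \<le> 2 * j + (k + 1) + h + 1" using X(3) jqr(1) by simp
    have "card X - 2 \<le> card (X - {y1,y2})" using finX by (rule two)
    also have "\<dots> = card (rho X y3 ` (X - {y1,y2}))" by (rule card_image[OF rho_inj, symmetric])
    also have "\<dots> \<le> card (?X' \<inter> \<Union>E')"
    proof (rule card_mono)
      show "finite (?X' \<inter> \<Union>E')" unfolding UE using finX finF by simp
      have "rho X y3 w \<in> \<Union>E'" if "w \<in> X" for w
      proof -
        have "w \<in> \<Union>(F y3)" using that X(1) Q(2) by (auto simp: F_def)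
        then show ?thesis unfolding UE using y3 by blast
      qed
      then show "rho X y3 ` (X - {y1,y2}) \<subseteq> ?X' \<inter> \<Union>E'" using rho_new_marks[of X y3 y1 y2 y4 y5] by blast
    qed
    finally have "card (\<Union>E') \<le> 2 * j + card (?X' \<inter> \<Union>E') + (h + 3)" using up X(3) by linarith
    then show ?thesis using sub cardE' by blast
  qed
qed

text \<open>Three cases. If every copy used sees fewer than \<open>k - 1\<close> shared vertices,
  the surpluses pay for the apexes and for the final 1. If some copy sees at least
  \<open>k - 1\<close> and a second copy is used, shared vertices and surpluses reach
  \<open>k + 1\<close>, the most that can be required. If that copy is the only one, it contains at
  most \<open>k - 1\<close> new marks.\<close>

lemma glue_marked:
  assumes m: "marked E k {} X" and y: "distinct [y1,y2,y3,y4,y5]" "{y1,y2,y3,y4,y5} \<subseteq> X"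
  shows "marked (glue E X X) (k + 1) {} (new_marks X y1 y2 y3 y4 y5)"
proof -
  let ?X' = "new_marks X y1 y2 y3 y4 y5"
  let ?W = "\<Union>E"
  have conf: "config E k" and st: "star E {} X" using m by (simp_all add: marked_def)
  note finE = config_finite[OF conf]
  have X: "X \<subseteq> ?W" "card X \<ge> 3" "card X = k + 1" using m by (simp_all add: marked_def)
  have finX: "finite X" by (rule finite_subset[OF X(1) finE(2)])
  have k4: "k \<ge> 4" using card_mono[OF finX y(2)] y(1) X(3) by simp
  have cX': "card ?X' = k + 2" using card_new_marks[OF finX y] X(3) by simp
  have sub: "?X' \<subseteq> \<Union>(glue E X X)"
  proof -
    have U: "\<Union>(glue E X X) = (\<Union>i\<in>X. rho X i ` ?W)" by (rule glue_Union)
    have "Sh w \<in> \<Union>(glue E X X)" if w: "w \<in> X" for w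
    proof -
      obtain i where i: "i \<in> X" "i \<noteq> w" using ex_other[of X w] X(2) by auto
      have "rho X i w = Sh w" using w i by (auto simp: rho_def)
      moreover have "w \<in> ?W" using w X by blast
      ultimately have "Sh w \<in> rho X i ` ?W" by (metis imageI)
      then show ?thesis unfolding U using i(1) by blast
    qed
    moreover have "Cp i i \<in> \<Union>(glue E X X)" if i: "i \<in> X" for i
    proof -
      have "rho X i i = Cp i i" by (simp add: rho_def)
      moreover have "i \<in> ?W" using i X by blast
      ultimately have "Cp i i \<in> rho X i ` ?W" by (metis imageI)
      then show ?thesis unfolding U using i by blast
    qed
    ultimately show ?thesis using y(2) by (auto simp: new_marks_def)
  qed
  have "star (glue E X X) {} ?X'"
    unfolding star_def
  proof (intro allI impI)
    fix E' assume E': "E' \<subseteq> glue E X X" and ne: "E' \<noteq> {}"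
    define F where "F i = {e \<in> E. rho X i ` e \<in> E'}" for i
    have FE: "F i \<subseteq> E" for i by (auto simp: F_def)
    have E'F: "E' = (\<Union>i\<in>X. (`) (rho X i) ` F i)"
    proof (intro equalityI subsetI)
      fix x assume x: "x \<in> E'"
      then obtain i e where "i \<in> X" "e \<in> E" "x = rho X i ` e" using E' unfolding glue_def by blast
      then show "x \<in> (\<Union>i\<in>X. (`) (rho X i) ` F i)" using x by (auto simp: F_def)
    qed (auto simp: F_def)
    have cE': "card E' = (\<Sum>i\<in>X. card (F i))" using glue_card[OF m, of F] FE unfolding E'F by simp
    define P where "P i = \<Union>(F i)" for i
    have finP: "finite (P i)" for i unfolding P_def by (rule finite_subset[OF Union_mono[OF FE] finE(2)])
    have UE': "\<Union>E' = (\<Union>i\<in>X. rho X i ` P i)" unfolding E'F P_def by auto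
    define S where "S = {w \<in> X. \<exists>i\<in>X. i \<noteq> w \<and> w \<in> P i}"
    have finS: "finite S" using finX by (simp add: S_def)
    have cU: "card (\<Union>E') = card S + (\<Sum>i\<in>X. card (P i - (X - {i})))"
      unfolding UE' by (rule glue_card_Union[OF finX subset_refl _ finP S_def]) (use X in simp)
    define a where "a i = card (P i \<inter> (X - {i}))" for i
    define z where "z i = (if i \<in> P i then 1 else 0::nat)" for i
    \<comment> \<open>The surplus of copy \<open>i\<close>: by \<open>star\<close> for
      \<open>E\<close> it has at least \<open>2 * card (F i) + min (a i + z i) (k - 1) + 1\<close>
      vertices, of which \<open>a i\<close> are shared. Here \<open>z i\<close> records whether its
      apex is present.\<close>
    define t where "t i = (if F i = {} then 0 else if a i = k then 0 else if a i = k - 1 then 1 else 1 + z i)" for i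
    have ak: "a i \<le> k" if "i \<in> X" for i
    proof -
      have "a i \<le> card (X - {i})" unfolding a_def using finX by (intro card_mono) auto
      then show ?thesis using that finX X(3) by simp
    qed
    have aS: "a i \<le> card S" if "i \<in> X" for i
    proof -
      have "x \<in> S" if "x \<in> P i \<inter> (X - {i})" for x
        unfolding S_def using that \<open>i \<in> X\<close> by (intro CollectI conjI bexI[of _ i]) auto
      then show ?thesis unfolding a_def by (intro card_mono[OF finS] subsetI)
    qed
    have t: "2 * card (F i) + t i \<le> card (P i - (X - {i}))" if i: "i \<in> X" for i
    proof (cases "F i = {}")
      case True then show ?thesis by (simp add: t_def)
    next
      case False
      have s: "2 * card (F i) + min (card (X \<inter> P i)) (k - 1) + 1 \<le> card (P i)"
        using st[unfolded star_def, THEN spec, THEN mp, OF FE, THEN mp, OF False] X(3) by (simp add: P_def)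
      have "card (X \<inter> P i) = a i + z i"
      proof (cases "i \<in> P i")
        case True
        then have "X \<inter> P i = insert i (P i \<inter> (X - {i}))" using i by auto
        then show ?thesis using True finX by (simp add: a_def z_def)
      next
        case False
        then have "X \<inter> P i = P i \<inter> (X - {i})" by auto
        then show ?thesis using False by (simp add: a_def z_def)
      qed
      moreover have "card (P i - (X - {i})) = card (P i) - a i"
        unfolding a_def using finP by (intro card_Diff_subset_Int) simp
      moreover have "z i \<le> 1" by (simp add: z_def)
      ultimately show ?thesis using s False ak[OF i] k4 by (auto simp: t_def min_def split: if_splits)
    qed
    have low: "card S + 2 * card E' + (\<Sum>i\<in>X. t i) \<le> card (\<Union>E')"
    proof -
      have "(\<Sum>i\<in>X. 2 * card (F i) + t i) \<le> (\<Sum>i\<in>X. card (P i - (X - {i})))" using t by (rule sum_mono)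
      then show ?thesis unfolding cU cE' by (simp add: sum.distrib sum_distrib_left)
    qed
    have zF: "z i = 0" if "F i = {}" for i using that by (simp add: z_def P_def)
    obtain i0 where i0: "i0 \<in> X" "F i0 \<noteq> {}" using ne unfolding E'F by blast
    have goal: "min (card (?X' \<inter> \<Union>E')) k + 1 \<le> card S + (\<Sum>i\<in>X. t i)"
    proof (cases "\<forall>i\<in>X. F i \<noteq> {} \<longrightarrow> a i < k - 1")
      case True
      have "?X' \<inter> \<Union>E' \<subseteq> Sh ` S \<union> (\<lambda>i. Cp i i) ` {i \<in> {y3,y4,y5}. i \<in> P i}"
      proof
        fix x assume x: "x \<in> ?X' \<inter> \<Union>E'"
        then obtain i w where iw: "i \<in> X" "w \<in> P i" "x = rho X i w" unfolding UE' by blast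
        show "x \<in> Sh ` S \<union> (\<lambda>i. Cp i i) ` {i \<in> {y3,y4,y5}. i \<in> P i}"
        proof (cases "w \<in> X - {i}")
          case True
          then have "w \<in> S" unfolding S_def using iw by (intro CollectI conjI bexI[of _ i]) auto
          then show ?thesis using True iw(3) by (simp add: rho_def)
        next
          case False
          then have "x = Cp i w" using iw(3) by (auto simp: rho_def)
          then show ?thesis using x iw(2) by (auto simp: new_marks_def)
        qed
      qed
      then have "card (?X' \<inter> \<Union>E') \<le> card (Sh ` S \<union> (\<lambda>i. Cp i i) ` {i \<in> {y3,y4,y5}. i \<in> P i})"
        using finS by (intro card_mono) auto
      also have "\<dots> \<le> card (Sh ` S) + card ((\<lambda>i. Cp i i) ` {i \<in> {y3,y4,y5}. i \<in> P i})" by (rule card_Un_le)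
      also have "\<dots> \<le> card S + card {i \<in> {y3,y4,y5}. i \<in> P i}"
        using finS by (intro add_mono card_image_le) auto
      also have "card {i \<in> {y3,y4,y5}. i \<in> P i} = (\<Sum>i\<in>{y3,y4,y5}. z i)"
        by (simp add: z_def sum.If_cases Int_def conj_commute)
      also have "\<dots> \<le> (\<Sum>i\<in>X. z i)" using finX y(2) by (intro sum_mono2) auto
      finally have N: "card (?X' \<inter> \<Union>E') \<le> card S + (\<Sum>i\<in>X. z i)" by simp
      have "t i = (if F i = {} then 0 else 1) + z i" if "i \<in> X" for i
        using True that zF[of i] k4 by (auto simp: t_def)
      then have "(\<Sum>i\<in>X. t i) = (\<Sum>i\<in>X. if F i = {} then 0 else 1) + (\<Sum>i\<in>X. z i)" by (simp add: sum.distrib)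
      moreover have "(\<Sum>i\<in>X. if F i = {} then 0 else 1::nat) \<ge> 1"
        using member_le_sum[of i0 X "\<lambda>i. if F i = {} then 0 else 1::nat"] i0 finX by simp
      ultimately show ?thesis using N by linarith
    next
      case False
      then obtain i where i: "i \<in> X" "F i \<noteq> {}" "\<not> a i < k - 1" by blast
      then have i3: "a i \<ge> k - 1" by simp
      show ?thesis
      proof (cases "\<exists>j\<in>X. j \<noteq> i \<and> F j \<noteq> {}")
        case True
        then obtain j where j: "j \<in> X" "j \<noteq> i" "F j \<noteq> {}" by blast
        have "(\<Sum>l\<in>{i,j}. t l) \<le> (\<Sum>l\<in>X. t l)" using i j finX by (intro sum_mono2) auto
        then have tt: "t i + t j \<le> (\<Sum>l\<in>X. t l)" using j by simp
        have "k + 1 \<le> card S + (t i + t j)"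
        proof (cases "a i = k \<and> a j = k")
          case True
          have full: "X - {l} \<subseteq> S" if "l \<in> X" "a l = k" for l
          proof -
            have "card (X - {l}) = k" using that X(3) finX by simp
            then have "P l \<inter> (X - {l}) = X - {l}" using that finX by (intro card_subset_eq) (auto simp: a_def)
            then have "x \<in> P l" if "x \<in> X - {l}" for x using that by blast
            then show ?thesis unfolding S_def using that(1) by (intro subsetI CollectI conjI bexI[of _ l]) auto
          qed
          have "X \<subseteq> S" using full[OF i(1)] full[OF j(1)] True j(2) by blast
          then have "card X \<le> card S" using finS by (intro card_mono)
          then show ?thesis using X(3) by simp
        next
          case False
          have ti: "a i = k - 1 \<Longrightarrow> t i = 1" using i k4 by (simp add: t_def)
          have tj: "a j \<noteq> k \<Longrightarrow> t j \<ge> 1" using j by (simp add: t_def)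
          show ?thesis using ti tj False i3 ak[OF i(1)] aS[OF i(1)] aS[OF j(1)] k4 by (cases "a i = k"; cases "a j = k") auto
        qed
        then show ?thesis using tt by linarith
      next
        case False
        then have only: "F j = {}" if "j \<in> X" "j \<noteq> i" for j using that by blast
        have "t i \<le> (\<Sum>l\<in>X. t l)" using member_le_sum[of i X t] i finX by simp
        moreover have "k \<le> card S + t i" using i i3 ak[OF i(1)] aS[OF i(1)] k4 by (auto simp: t_def)
        moreover have "card (?X' \<inter> \<Union>E') \<le> k - 1"
        proof -
          have UE2: "\<Union>E' \<subseteq> rho X i ` P i" unfolding UE' using only by (auto simp: P_def)
          have "?X' \<inter> \<Union>E' \<subseteq> Sh ` (X - {y1,y2} - {i}) \<union> (if i \<in> {y3,y4,y5} then {Cp i i} else {})"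
            using UE2 by (auto simp: new_marks_def rho_def)
          then have "card (?X' \<inter> \<Union>E') \<le> card (Sh ` (X - {y1,y2} - {i}) \<union> (if i \<in> {y3,y4,y5} then {Cp i i} else {}))"
            using finX by (intro card_mono) auto
          also have "\<dots> \<le> card (Sh ` (X - {y1,y2} - {i})) + card (if i \<in> {y3,y4,y5} then {Cp i i} else {})" by (rule card_Un_le)
          also have "card (Sh ` (X - {y1,y2} - {i})) \<le> card (X - {y1,y2} - {i})" using finX by (intro card_image_le) simp
          also have "card (X - {y1,y2} - {i}) + card (if i \<in> {y3,y4,y5} then {Cp i i} else {}) \<le> k - 1"
          proof -
            have c: "card (X - {y1,y2}) = k - 1" using y finX X(3) by (simp add: card_Diff_subset)
            show ?thesis
            proof (cases "i \<in> {y3,y4,y5}")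
              case True
              then have "i \<in> X - {y1,y2}" using y by auto
              then have "card (X - {y1,y2} - {i}) = k - 2" using c finX by simp
              then show ?thesis using True k4 by simp
            next
              case False
              then show ?thesis using c card_mono[of "X - {y1,y2}" "X - {y1,y2} - {i}"] finX by auto
            qed
          qed
          finally show ?thesis by simp
        qed
        ultimately show ?thesis using k4 by linarith
      qed
    qed
    show "2 * card E' + card ({} \<inter> \<Union>E') + min (card (?X' \<inter> \<Union>E')) (card ?X' - 2) + 1 \<le> card (\<Union>E')"
      using low goal cX' by simp
  qed
  moreover have "config (glue E X X) (k + 1)" using glue_config(1)[OF m] by simp
  ultimately show ?thesis unfolding marked_def using sub cX' k4 by simp
qed

section \<open>The recursion\<close>

text \<open>A list version of \<open>glue\<close>, so that the condition \<open>star\<close> can be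
  evaluated on the first levels.\<close>

definition glue_list :: "pos list list \<Rightarrow> pos list \<Rightarrow> pos list \<Rightarrow> pos list list" where
  "glue_list es Y X = concat (map (\<lambda>i. map (map (\<lambda>w. if w \<in> set Y \<and> w \<noteq> i then Sh w else Cp i w)) es) X)"

text \<open>Each edge is either left out or taken, so all subfamilies are visited, with their
  vertices \<open>V\<close> and number of edges \<open>c\<close> carried along; \<open>c = 0\<close>
  exempts the empty family. For the nine edges of \<open>F4\<close> there are 512 of them.\<close>

fun star_check :: "'a list \<Rightarrow> 'a list \<Rightarrow> 'a list list \<Rightarrow> 'a list \<Rightarrow> nat \<Rightarrow> bool" where
  "star_check U X [] V c \<longleftrightarrow> c = 0 \<or>
     2 * c + length (filter (\<lambda>w. w \<in> set U) V) + min (length (filter (\<lambda>w. w \<in> set X) V)) (length X - 2) + 1 \<le> length V"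
| "star_check U X (e # es) V c \<longleftrightarrow> star_check U X es V c \<and> star_check U X es (List.union e V) (c + 1)"

lemma glue_list: "glue (set ` set es) (set Y) (set X) = set ` set (glue_list es Y X)"
proof -
  have "rho (set Y) i ` set e = set (map (\<lambda>w. if w \<in> set Y \<and> w \<noteq> i then Sh w else Cp i w) e)" for i e
    unfolding set_map by (rule image_cong) (auto simp: rho_def)
  then show ?thesis
    unfolding glue_def glue_list_def set_concat set_map image_UN image_image by simp
qed

lemma star_check:
  assumes "star_check U X es V c" "distinct V" "distinct X" "E' \<subseteq> set ` set es" "E' \<noteq> {} \<or> c > 0"
  shows "2 * (card E' + c) + card (set U \<inter> (\<Union>E' \<union> set V)) + min (card (set X \<inter> (\<Union>E' \<union> set V))) (length X - 2) + 1
    \<le> card (\<Union>E' \<union> set V)"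
  using assms
proof (induction es arbitrary: V c E')
  case Nil
  have f: "card (set A \<inter> set V) \<le> length (filter (\<lambda>w. w \<in> set A) V)" for A :: "'a list"
  proof -
    have "set A \<inter> set V = set (filter (\<lambda>w. w \<in> set A) V)" by auto
    then show ?thesis using card_length[of "filter (\<lambda>w. w \<in> set A) V"] by simp
  qed
  have "E' = {}" using Nil by simp
  then show ?case using Nil f[of U] f[of X] distinct_card[OF Nil(2)] by auto
next
  case (Cons e es)
  show ?case
  proof (cases "set e \<in> E'")
    case False
    then have "E' \<subseteq> set ` set es" using Cons.prems(4) by auto
    then show ?thesis using Cons.IH[of V c E'] Cons.prems by simp
  next
    case True
    define E0 where "E0 = E' - {set e}"
    have "finite E'" by (rule finite_subset[OF Cons.prems(4)]) simp
    then have c: "card E' = card E0 + 1" using True card_Suc_Diff1[of E' "set e"] by (simp add: E0_def)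
    have "E0 \<subseteq> set ` set es" using Cons.prems(4) by (auto simp: E0_def)
    then have "2 * (card E0 + (c + 1)) + card (set U \<inter> (\<Union>E0 \<union> set (List.union e V))) +
      min (card (set X \<inter> (\<Union>E0 \<union> set (List.union e V)))) (length X - 2) + 1 \<le> card (\<Union>E0 \<union> set (List.union e V))"
      using Cons.prems by (intro Cons.IH) (auto intro: distinct_union)
    moreover have "\<Union>E0 \<union> set (List.union e V) = \<Union>E' \<union> set V" using True by (auto simp: E0_def)
    ultimately show ?thesis by (simp add: c)
  qed
qed

lemma star_by_check: "star_check U X es [] 0 \<Longrightarrow> distinct X \<Longrightarrow> star (set ` set es) (set U) (set X)"
  unfolding star_def
proof (intro allI impI)
  fix E' assume c: "star_check U X es [] 0" "distinct X" and E': "E' \<subseteq> set ` set es" "E' \<noteq> {}"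
  show "2 * card E' + card (set U \<inter> \<Union>E') + min (card (set X \<inter> \<Union>E')) (card (set X) - 2) + 1 \<le> card (\<Union>E')"
    using star_check[OF c(1) _ c(2) E'(1)] E'(2) distinct_card[OF c(2)] by simp
qed

lemma marked_glue_list:
  assumes m: "marked (set ` set es) k (set U) (set X)"
    and c: "star_check U' X' (glue_list es (U @ X) X) [] 0"
    and l: "distinct (U' @ X')" "length (U' @ X') = k + 2" "length X' \<ge> 3"
      "list_all (\<lambda>w. list_ex (\<lambda>e. w \<in> set e) (glue_list es (U @ X) X)) (U' @ X')"
  shows "marked (set ` set (glue_list es (U @ X) X)) (k + 1) (set U') (set X')"
proof -
  have \<gamma>: "glue (set ` set es) (set U \<union> set X) (set X) = set ` set (glue_list es (U @ X) X)"
    using glue_list[of es "U @ X" X] by simp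
  have "config (set ` set (glue_list es (U @ X) X)) (k + 1)" using glue_config(1)[OF m] unfolding \<gamma> .
  moreover have "star (set ` set (glue_list es (U @ X) X)) (set U') (set X')"
    by (rule star_by_check[OF c]) (use l in simp)
  moreover have "set (U' @ X') \<subseteq> \<Union>(set ` set (glue_list es (U @ X) X))"
    using l(4) by (auto simp: list_all_iff list_ex_iff)
  moreover have "card (set U') = length U'" "card (set X') = length X'" using l(1) by (simp_all add: distinct_card)
  ultimately show ?thesis using l unfolding marked_def by simp
qed

text \<open>The marked vertices \<open>U3\<close>, \<open>X3\<close>, \<open>X4\<close> were found by exhaustive search; from \<open>X4\<close> on, \<open>new_marks\<close>
  supplies them.\<close>

definition "X2 = [Z 0, Z 1, Z 2]"
definition "U3 = [Cp (Z 1) (Z 1)]"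
definition "X3 = [Sh (Z 1), Cp (Z 2) (Z 2), Cp (Z 2) (Z 3)]"
definition "X4 = [Cp (Cp (Z 2) (Z 2)) (Cp (Z 0) (Z 0)), Cp (Cp (Z 2) (Z 2)) (Cp (Z 1) (Z 3)),
  Cp (Cp (Z 2) (Z 3)) (Cp (Z 0) (Z 0)), Cp (Cp (Z 2) (Z 3)) (Cp (Z 1) (Z 3)), Cp (Sh (Z 1)) (Cp (Z 0) (Z 0))]"
definition "F2 = [[Z 0, Z 1, Z 2, Z 3]]"
definition "F3 = glue_list F2 ([] @ X2) X2"
definition "F4 = glue_list F3 (U3 @ X3) X3"

lemma marked2: "marked (set ` set F2) 2 (set []) (set X2)"
proof -
  have "star (set ` set F2) (set []) (set X2)" by (rule star_by_check) code_simp+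
  then show ?thesis by (simp add: marked_def config_def F2_def X2_def)
qed

text \<open>With \<open>U\<close> empty there would have to be four marks, and then
  \<open>star\<close> allows only one mark in each edge; but the three edges of \<open>F3\<close>
  cover all vertices. So one vertex goes into \<open>U3\<close>, and the next gluing triples the
  edges instead of quadrupling them.\<close>

lemma marked3: "marked (set ` set F3) 3 (set U3) (set X3)"
proof -
  have "marked (set ` set F3) (2 + 1) (set U3) (set X3)"
    unfolding F3_def by (rule marked_glue_list[OF marked2]) code_simp+
  then show ?thesis by simp
qed

lemma star_check4: "star_check [] X4 F4 [] 0" by code_simp

lemma marked4: "marked (set ` set F4) 4 {} (set X4)"
proof -
  have "marked (set ` set F4) (3 + 1) (set []) (set X4)"
    unfolding F4_def by (rule marked_glue_list[OF marked3]) (rule star_check4[unfolded F4_def], code_simp+)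
  then show ?thesis by simp
qed

lemma card_levels: "card (set ` set F2) = 1" "card (set ` set F3) = 3" "card (set ` set F4) = 9"
proof -
  show 2: "card (set ` set F2) = 1" by (simp add: F2_def)
  show 3: "card (set ` set F3) = 3"
    using glue_config(2)[OF marked2] glue_list[of F2 "[] @ X2" X2] unfolding F3_def 2 by (simp add: X2_def)
  show "card (set ` set F4) = 9"
    using glue_config(2)[OF marked3] glue_list[of F3 "U3 @ X3" X3] unfolding F4_def 3 by (simp add: X3_def)
qed

section \<open>Climbing the levels\<close>

lemma flexr_trivial:
  assumes "config E k" "card (\<Union>E) \<le> h"
  shows "flexr E X h"
  unfolding flexr_def
proof (intro allI impI)
  fix j assume "j \<le> card E"
  then obtain E' where E': "E' \<subseteq> E" "card E' = j" "finite E'" by (rule obtain_subset_with_card_n)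
  have "card (\<Union>E') \<le> card (\<Union>E)" by (rule card_mono[OF config_finite(2)[OF assms(1)] Union_mono[OF E'(1)]])
  then show "\<exists>E'\<subseteq>E. card E' = j \<and> card (\<Union>E') \<le> 2 * j + card (X \<inter> \<Union>E') + h"
    using E' assms(2) by (intro exI[of _ E']) simp
qed

lemma flexr_flex:
  assumes "flexr E X h" "finite X"
  shows "flex E (card X + h)"
  unfolding flex_def
proof (intro allI impI)
  fix j assume "j \<le> card E"
  then obtain E' where E': "E' \<subseteq> E" "card E' = j" "card (\<Union>E') \<le> 2 * j + card (X \<inter> \<Union>E') + h"
    using assms(1) unfolding flexr_def by blast
  have "card (X \<inter> \<Union>E') \<le> card X" using assms(2) by (intro card_mono) auto
  then show "\<exists>E'\<subseteq>E. card E' = j \<and> card (\<Union>E') \<le> 2 * j + (card X + h)"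
    using E' by (intro exI[of _ E']) simp
qed

text \<open>Every edge of the host is the image of a copy, so \<epsilon> itself serves as the
  constant.\<close>

lemma abundant_edge:
  assumes e: "card e = 4"
  shows "abundant p D {e} 2"
  unfolding abundant_def
proof (intro allI impI)
  fix \<epsilon> :: real assume pos: "\<epsilon> > 0"
  have fine: "finite e" using e card.infinite by fastforce
  have main: "\<epsilon> * real n ^ 2 \<le> real (card (copies {e} H n))" if H: "big \<epsilon> n H" for n H
  proof -
    have f: "\<exists>\<phi>\<in>copies {e} H n. \<phi> ` e = a" if a: "a \<in> H" for a
    proof -
      have a4: "card a = 4" "a \<subseteq> {..<n}" using H a by (auto simp: big_def)
      then have "finite a" using finite_subset by blast
      then obtain f where f: "bij_betw f e a" using finite_same_card_bij[OF fine] a4 e by metis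
      have im: "restrict f e ` e = a" using f by (simp add: bij_betw_def)
      have "restrict f e \<in> copies {e} H n"
        unfolding copies_def using f im a a4(2) by (auto simp: bij_betw_def inj_on_def)
      then show ?thesis using im by blast
    qed
    have "H \<subseteq> (\<lambda>\<phi>. \<phi> ` e) ` copies {e} H n" using f by blast
    then have "card H \<le> card (copies {e} H n)"
      using finite_copies[of "{e}" H n] fine by (intro surj_card_le) auto
    then show ?thesis using H by (simp add: big_def)
  qed
  show "\<exists>\<delta>>0. \<exists>n0. \<forall>n\<ge>n0. \<forall>H. big \<epsilon> n H \<longrightarrow> \<not> good p D H \<longrightarrow> \<delta> * real n ^ 2 \<le> real (card (copies {e} H n))"
    by (rule exI[of _ \<epsilon>]) (use main pos in blast)
qed

text \<open>The loss \<open>3 * k + 10\<close> starts at 22, the number of vertices of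
  \<open>F4\<close>, and grows by 3 per gluing. The edges multiply by \<open>k + 1\<close> like the
  factorial, and the constant 3 accounts for the start, where 24 is compared with nine
  edges.\<close>

definition level :: "nat \<Rightarrow> nat \<Rightarrow> nat \<Rightarrow> pos set set \<Rightarrow> pos set \<Rightarrow> bool" where
  "level p D k E X \<longleftrightarrow> marked E k {} X \<and> flexr E X (3 * k + 10) \<and> abundant p D E k \<and> fact k \<le> 3 * card E"

lemma level_4:
  assumes p: "22 \<le> p" and D: "32 \<le> D"
  shows "level p D 4 (set ` set F4) (set X4)"
proof -
  have c: "config (set ` set F2) 2" "config (set ` set F3) 3" "config (set ` set F4) 4"
    using marked2 marked3 marked4 by (simp_all add: marked_def)
  have v: "card (\<Union>(set ` set F2)) = 4" "card (\<Union>(set ` set F3)) = 9" "card (\<Union>(set ` set F4)) = 22"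
    using c card_levels unfolding config_def by auto
  have fl: "flex E h" if "config E k" "card (\<Union>E) \<le> h" for E :: "pos set set" and k h
    using flexr_flex[OF flexr_trivial[OF that, of "{}"]] by simp
  have "set ` set F2 = {set [Z 0, Z 1, Z 2, Z 3]}" by (simp add: F2_def)
  then have a2: "abundant p D (set ` set F2) 2" using abundant_edge[of "set [Z 0, Z 1, Z 2, Z 3]" p D] by simp
  have "bounded_fibres p D (set ` set F2) 2"
    by (rule fibres_bounded[OF a2 c(1) fl[OF c(1), of 4]]) (use v p D in auto)
  then have "abundant p D (glue (set ` set F2) (set [] \<union> set X2) (set X2)) (2 + 1)" by (rule abundant_glue[OF marked2 a2])
  then have a3: "abundant p D (set ` set F3) 3" using glue_list[of F2 "[] @ X2" X2] by (simp add: F3_def)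
  have "bounded_fibres p D (set ` set F3) 3"
    by (rule fibres_bounded[OF a3 c(2) fl[OF c(2), of 9]]) (use v p D in auto)
  then have "abundant p D (glue (set ` set F3) (set U3 \<union> set X3) (set X3)) (3 + 1)" by (rule abundant_glue[OF marked3 a3])
  then have a4: "abundant p D (set ` set F4) 4" using glue_list[of F3 "U3 @ X3" X3] by (simp add: F4_def)
  have "flexr (set ` set F4) (set X4) (3 * 4 + 10)" by (rule flexr_trivial[OF c(3)]) (simp add: v)
  moreover have "fact 4 \<le> 3 * card (set ` set F4)" unfolding card_levels by (simp add: fact_numeral)
  ultimately show ?thesis using a4 marked4 unfolding level_def by blast
qed

lemma level_flex:
  assumes "level p D k E X"
  shows "flex E (4 * k + 11)" "config E k" "finite X" "card X = k + 1"
proof -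
  show c: "config E k" "card X = k + 1" using assms by (simp_all add: level_def marked_def)
  have "X \<subseteq> \<Union>E" using assms by (simp add: level_def marked_def)
  then show f: "finite X" by (rule finite_subset[OF _ config_finite(2)[OF c(1)]])
  have "flexr E X (3 * k + 10)" using assms by (simp add: level_def)
  from flexr_flex[OF this f] show "flex E (4 * k + 11)" using c(2) by (simp add: algebra_simps)
qed

text \<open>The bound on \<open>p\<close> says that the configuration still fits into
  \<open>p\<close> vertices, and \<open>5 * k + 12\<close> is \<open>k + (4 * k + 11) + 1\<close>;
  both are what \<open>fibres_bounded\<close> asks for.\<close>

lemma level_Suc:
  assumes l: "level p D k E X" and k: "4 \<le> k" and p: "2 * card E + k \<le> p" and D: "5 * k + 12 \<le> D"
  shows "\<exists>E' X'. level p D (k + 1) E' X'"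
proof -
  note lf = level_flex[OF l]
  have m: "marked E k {} X" and fr: "flexr E X (3 * k + 10)" and ab: "abundant p D E k" and fk: "fact k \<le> 3 * card E"
    using l by (simp_all add: level_def)
  have bf: "bounded_fibres p D E k"
    by (rule fibres_bounded[OF ab lf(2,1)]) (use lf(2) p D in \<open>simp_all add: config_def\<close>)
  have "5 \<le> card X" using lf(4) k by simp
  then obtain T where T: "T \<subseteq> X" "card T = 5" "finite T" by (rule obtain_subset_with_card_n)
  obtain ys where ys: "set ys = T" "distinct ys" using finite_distinct_list[OF T(3)] by blast
  have "length ys = 5" using ys T(2) distinct_card[of ys] by simp
  then have "ys = [ys ! 0, ys ! 1, ys ! 2, ys ! 3, ys ! 4]"
    by (intro nth_equalityI) (auto simp: less_Suc_eq numeral_eq_Suc)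
  then obtain y1 y2 y3 y4 y5 where "ys = [y1,y2,y3,y4,y5]" by (rule that)
  then have y: "distinct [y1,y2,y3,y4,y5]" "{y1,y2,y3,y4,y5} \<subseteq> X" using ys T(1) by auto
  let ?E = "glue E X X" and ?X = "new_marks X y1 y2 y3 y4 y5"
  have "marked ?E (k + 1) {} ?X" by (rule glue_marked[OF m y])
  moreover have "flexr ?E ?X (3 * (k + 1) + 10)" using glue_flexr[OF m y fr] by (simp add: algebra_simps)
  moreover have "abundant p D ?E (k + 1)" using abundant_glue[OF m ab bf] by simp
  moreover have "fact (k + 1) \<le> 3 * card ?E"
  proof -
    have "card ?E = (k + 1) * card E" using glue_config(2)[OF m] lf(4) by simp
    moreover have "(k + 1) * fact k \<le> (k + 1) * (3 * card E)" by (rule mult_left_mono[OF fk]) simp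
    ultimately show ?thesis by (simp add: algebra_simps)
  qed
  ultimately show ?thesis unfolding level_def by blast
qed

text \<open>As soon as \<open>2 * card E + (4 * k + 11)\<close> reaches \<open>p\<close>, a cut-down
  copy is the required set. Until then the configuration has fewer than \<open>p\<close> vertices
  and the recursion goes on. It cannot pass level \<open>K\<close>, where
  \<open>fact K \<le> 3 * card E\<close> gives \<open>p \<le> 2 * card E\<close>.\<close>

theorem dense_good:
  fixes \<epsilon> :: real
  assumes p: "22 \<le> p" and K: "4 \<le> K" "3 * p \<le> 2 * fact K" and D: "5 * K + 12 \<le> D" and \<epsilon>: "\<epsilon> > 0"
  shows "\<exists>n0. \<forall>n\<ge>n0. \<forall>H. big \<epsilon> n H \<longrightarrow> good p D H"
proof (rule ccontr)
  assume no: "\<not> ?thesis"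
  have small: "2 * card E + (4 * k + 11) < p" if l: "level p D k E X" and k: "k \<le> K" for k E X
  proof (rule ccontr)
    assume "\<not> ?thesis"
    then have "p \<le> 2 * card E + (4 * k + 11)" by simp
    moreover have "abundant p D E k" using l by (simp add: level_def)
    ultimately have "\<exists>n0. \<forall>n\<ge>n0. \<forall>H. big \<epsilon> n H \<longrightarrow> good p D H"
      using D k \<epsilon> by (intro abundant_good[OF _ level_flex(2,1)[OF l]]) auto
    then show False using no by simp
  qed
  have "k \<le> K \<Longrightarrow> \<exists>E X. level p D k E X" if "4 \<le> k" for k
    using that
  proof (induction k rule: dec_induct)
    case base
    then show ?case using level_4[of p D] p K D by force
  next
    case (step k)
    then obtain E X where l: "level p D k E X" by auto
    show ?case using level_Suc[OF l] small[OF l] step D by simp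
  qed
  from this[OF K(1)] obtain E X where l: "level p D K E X" by auto
  then have "fact K \<le> 3 * card E" by (simp add: level_def)
  then show False using small[OF l] K(2) by simp
qed

section \<open>Colourings\<close>

text \<open>One term of the exponential series is at most the whole sum.\<close>

lemma power_le_fact_exp: "real K ^ K \<le> fact K * exp (real K)"
proof -
  have s: "(\<lambda>n. real K ^ n /\<^sub>R fact n) sums exp (real K)" by (rule exp_converges)
  have "(\<Sum>n\<in>{K}. real K ^ n /\<^sub>R fact n) \<le> (\<Sum>n. real K ^ n /\<^sub>R fact n)"
    by (rule sum_le_suminf[OF sums_summable[OF s]]) auto
  then have "real K ^ K / fact K \<le> exp (real K)" using sums_unique[OF s] by (simp add: divide_inverse_commute)
  then show ?thesis by (simp add: divide_simps mult.commute)
qed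

lemma ln_ln_bounds:
  assumes "4 \<le> (p::nat)"
  shows "ln (real p) > 1" "ln (ln (real p)) > 0" "ln (real p) / ln (ln (real p)) \<ge> 1"
proof -
  have "exp 1 < (4::real)" using exp_le by simp
  then have "exp 1 < real p" using assms by linarith
  then show 1: "ln (real p) > 1" by (metis exp_gt_zero ln_exp ln_less_cancel_iff order_less_trans)
  then show 2: "ln (ln (real p)) > 0" by simp
  have "ln (ln (real p)) \<le> ln (real p) - 1" using 1 by (intro ln_le_minus_one) simp
  then show "ln (real p) / ln (ln (real p)) \<ge> 1" using 2 by (simp add: le_divide_eq)
qed

lemma ex_fact_bound:
  assumes p: "4 \<le> (p::nat)"
  shows "\<exists>K\<ge>4. 3 * p \<le> 2 * fact K \<and> real K \<le> 5 * (ln (real p) / ln (ln (real p)))"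
proof -
  define x where "x = ln (real p)"
  define L where "L = ln x"
  \<comment> \<open>The factor 4 contributes \<open>2 * ln 2\<close> to \<open>ln K\<close>; with
    \<open>ln L \<le> L / 2 - 1 + ln 2\<close> this leaves \<open>ln K - 1 \<ge> L / 2\<close>. So
    \<open>K * (ln K - 1)\<close> is at least \<open>2 * x\<close>, and
    \<open>p ^ 2 \<le> fact K\<close> follows by \<open>power_le_fact_exp\<close>.\<close>
  define K where "K = nat \<lceil>4 * (x / L)\<rceil>"
  have x: "x > 1" "L > 0" "x / L \<ge> 1" using ln_ln_bounds[OF p] by (simp_all add: x_def L_def)
  have K: "4 * (x / L) \<le> real K" "real K \<le> 4 * (x / L) + 1" using x(3) unfolding K_def by linarith+
  have K4: "real K \<ge> 4" using K(1) x(3) by linarith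
  have "ln (4 * (x / L)) \<le> ln (real K)" using K(1) x by (intro ln_mono) (auto intro: divide_pos_pos)
  moreover have "ln (4 * (x / L)) = 2 * ln 2 + L - ln L"
  proof -
    have "ln (4 * (x / L)) = ln 4 + ln (x / L)" using x by (intro ln_mult_pos) (auto intro: divide_pos_pos)
    also have "ln (x / L) = L - ln L" unfolding L_def[symmetric] using x by (simp add: ln_div L_def)
    also have "ln (4::real) = 2 * ln 2" using ln_mult_pos[of 2 "2::real"] by simp
    finally show ?thesis by simp
  qed
  moreover have "ln L \<le> L / 2 - 1 + ln 2"
  proof -
    have "ln L = ln (L / 2) + ln 2" using x by (simp add: ln_div)
    then show ?thesis using ln_le_minus_one[of "L / 2"] x by simp
  qed
  moreover have "ln 2 > (0::real)" by simp
  ultimately have lnK: "L / 2 \<le> ln (real K) - 1" by linarith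
  have "2 * x = 4 * (x / L) * (L / 2)" using x by simp
  also have "\<dots> \<le> real K * (ln (real K) - 1)" using K(1) lnK x K4 by (intro mult_mono) auto
  finally have a: "2 * x + real K \<le> real K * ln (real K)" by (simp add: algebra_simps)
  have "real p ^ 2 * exp (real K) = exp (2 * x + real K)"
    using p by (simp add: x_def exp_add exp_double power2_eq_square)
  also have "\<dots> \<le> exp (real K * ln (real K))" using a by simp
  also have "\<dots> = real K ^ K" using K4 by (simp add: exp_of_nat_mult)
  also have "\<dots> \<le> fact K * exp (real K)" by (rule power_le_fact_exp)
  finally have "real p ^ 2 \<le> fact K" by simp
  then have "real (p ^ 2) \<le> real (fact K)" by simp
  then have "p ^ 2 \<le> fact K" by (simp only: of_nat_le_iff)
  moreover have "4 * p \<le> p ^ 2" using p by (simp add: power2_eq_square)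
  ultimately have "3 * p \<le> 2 * fact K" by linarith
  moreover have "real K \<le> 5 * (x / L)" using K(2) x(3) by linarith
  moreover have "4 \<le> K" using K4 by linarith
  ultimately show ?thesis unfolding x_def L_def by blast
qed

section \<open>Repeated colours inside a p-set\<close>

lemma pad_set:
  assumes "W \<subseteq> {..<n}" "card W \<le> p" "p \<le> n"
  shows "\<exists>S\<in>nsets {..<n} p. W \<subseteq> (S::nat set)"
proof -
  have fW: "finite W" by (rule finite_subset[OF assms(1)]) simp
  have "p - card W \<le> card ({..<n} - W)" using assms fW by (simp add: card_Diff_subset)
  then obtain T where T: "T \<subseteq> {..<n} - W" "card T = p - card W" "finite T" by (rule obtain_subset_with_card_n)
  have "card (W \<union> T) = p" using T fW assms by (subst card_Un_disjoint) auto
  then have "W \<union> T \<in> nsets {..<n} p" using T assms fW by (auto simp: nsets_def)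
  then show ?thesis by blast
qed

lemma few_colours:
  assumes S: "S \<in> nsets A p" and J: "J \<subseteq> nsets S 2"
    and r: "\<And>e. e \<in> J \<Longrightarrow> \<exists>e'\<in>nsets S 2 - J. c e' = c e"
  shows "card (c ` nsets S 2) + card J \<le> p choose 2"
proof -
  have S': "finite S" "card S = p" using S by (auto simp: nsets_def)
  have fin: "finite (nsets S 2)" using S'(1) by (rule finite_imp_finite_nsets)
  have "c ` nsets S 2 \<subseteq> c ` (nsets S 2 - J)"
  proof
    fix y assume "y \<in> c ` nsets S 2"
    then obtain e where e: "e \<in> nsets S 2" "y = c e" by blast
    show "y \<in> c ` (nsets S 2 - J)"
    proof (cases "e \<in> J")
      case True
      then obtain e' where "e' \<in> nsets S 2 - J" "c e' = c e" using r by blast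
      then show ?thesis using e(2) by (metis imageI)
    next
      case False then show ?thesis using e by blast
    qed
  qed
  then have "card (c ` nsets S 2) \<le> card (c ` (nsets S 2 - J))" using fin by (intro card_mono) auto
  also have "\<dots> \<le> card (nsets S 2 - J)" using fin by (intro card_image_le) auto
  also have "\<dots> = card (nsets S 2) - card J" using J fin by (intro card_Diff_subset) (auto intro: finite_subset)
  finally have "card (c ` nsets S 2) \<le> card (nsets S 2) - card J" .
  moreover have "card J \<le> card (nsets S 2)" using J fin by (intro card_mono)
  ultimately show ?thesis using S'(2) card_nsets[of S 2] by simp
qed

text \<open>\<open>t\<close> is a number of colours lost on one \<open>p\<close>-set, and
  \<open>D\<close> bounds twice its shortfall from \<open>p / 2\<close>.\<close>

definition saving :: "nat \<Rightarrow> nat \<Rightarrow> nat \<Rightarrow> (nat set \<Rightarrow> nat) \<Rightarrow> bool" where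
  "saving p D n c \<longleftrightarrow> (\<exists>S\<in>nsets {..<n} p. \<exists>t. card (c ` nsets S 2) + t \<le> p choose 2 \<and> p \<le> 2 * t + D)"

text \<open>\<open>p div 2\<close> edges of one colour span at most \<open>p\<close> vertices and
  repeat that colour \<open>p div 2 - 1\<close> times; the value 3 covers the rounding and the one
  edge that is not a repetition.\<close>

lemma saving_by_class:
  assumes A: "A \<subseteq> nsets {..<n} 2" "\<And>e. e \<in> A \<Longrightarrow> c e = k" and p: "2 \<le> p" "p \<le> card A" "p \<le> n" and D: "3 \<le> D"
  shows "saving p D n c"
proof -
  have "p div 2 \<le> card A" using p by linarith
  then obtain B where B: "B \<subseteq> A" "card B = p div 2" "finite B" by (rule obtain_subset_with_card_n)
  have Bn: "e \<subseteq> {..<n}" "card e = 2" if "e \<in> B" for e using that A B by (auto simp: nsets_def)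
  have "card (\<Union>B) \<le> (\<Sum>e\<in>B. card e)" using card_UN_le[OF B(3), of "\<lambda>e. e"] by simp
  also have "\<dots> = 2 * (p div 2)" using Bn B by simp
  also have "\<dots> \<le> p" by simp
  finally have "\<exists>S\<in>nsets {..<n} p. \<Union>B \<subseteq> S" using Bn p by (intro pad_set) auto
  then obtain S where S: "S \<in> nsets {..<n} p" "\<Union>B \<subseteq> S" by blast
  have BS: "B \<subseteq> nsets S 2"
  proof
    fix e assume e: "e \<in> B"
    then show "e \<in> nsets S 2" using S(2) A(1) B(1) by (auto simp: nsets_def)
  qed
  have "B \<noteq> {}" using B p by auto
  then obtain e0 where e0: "e0 \<in> B" by blast
  have "card (c ` nsets S 2) + card (B - {e0}) \<le> p choose 2"
  proof (rule few_colours[OF S(1)])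
    show "B - {e0} \<subseteq> nsets S 2" using BS by blast
    show "\<exists>e'\<in>nsets S 2 - (B - {e0}). c e' = c e" if "e \<in> B - {e0}" for e
      using that e0 BS A(2) B(1) by (intro bexI[of _ e0]) (auto simp: subset_iff)
  qed
  moreover have "p \<le> 2 * card (B - {e0}) + D" using e0 B D by simp
  ultimately show ?thesis unfolding saving_def using S(1) by blast
qed

text \<open>The edges \<open>a k\<close> have distinct colours, hence are distinct, and each is made
  redundant by \<open>b k\<close>, which is not among them.\<close>

lemma saving_by_pairs:
  assumes M: "finite M" "\<And>k. k \<in> M \<Longrightarrow> a k \<in> nsets {..<n} 2 \<and> b k \<in> nsets {..<n} 2 \<and> a k \<noteq> b k \<and> c (a k) = k \<and> c (b k) = k"
    and W: "card (\<Union>k\<in>M. a k \<union> b k) \<le> p" and p: "p \<le> n" "p \<le> 2 * card M + D"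
  shows "saving p D n c"
proof -
  let ?W = "\<Union>k\<in>M. a k \<union> b k"
  have "?W \<subseteq> {..<n}" using M(2) by (fastforce simp: nsets_def)
  then obtain S where S: "S \<in> nsets {..<n} p" "?W \<subseteq> S" using pad_set[OF _ W p(1)] by blast
  have ab: "a k \<in> nsets S 2" "b k \<in> nsets S 2" if "k \<in> M" for k
    using M(2)[OF that] S(2) that by (auto simp: nsets_def)
  have inj: "inj_on a M" using M(2) by (metis inj_onI)
  have "card (c ` nsets S 2) + card (a ` M) \<le> p choose 2"
  proof (rule few_colours[OF S(1)])
    show "a ` M \<subseteq> nsets S 2" using ab by blast
    show "\<exists>e'\<in>nsets S 2 - a ` M. c e' = c e" if e: "e \<in> a ` M" for e
    proof -
      obtain k where k: "k \<in> M" "e = a k" using e by blast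
      have "b k \<notin> a ` M" using M(2) k(1) by (metis imageE)
      then show ?thesis using ab[OF k(1)] M(2)[OF k(1)] k(2) by (intro bexI[of _ "b k"]) auto
    qed
  qed
  then show ?thesis unfolding saving_def using S(1) p(2) card_image[OF inj] by auto
qed

theorem few_colours_saving:
  fixes \<epsilon> :: real
  assumes hyp: "\<And>\<eta>::real. \<eta> > 0 \<Longrightarrow> \<exists>n0. \<forall>n\<ge>n0. \<forall>H. big \<eta> n H \<longrightarrow> good p D H"
    and p: "2 \<le> p" and D: "3 \<le> D" and \<epsilon>: "\<epsilon> > 0"
  shows "\<exists>n0. \<forall>n\<ge>n0. \<forall>c. real (card (c ` nsets {..<n} 2)) + \<epsilon> * real n ^ 2 \<le> real (n choose 2) \<longrightarrow> saving p D n c"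
proof -
  \<comment> \<open>Half of \<open>\<epsilon> * n ^ 2\<close> goes to the cherries, a 4-set stands
    for at most 6 colours, and a repeated colour has fewer than \<open>p\<close> edges; together
    this is the factor \<open>12 * p\<close>.\<close>
  define \<eta> where "\<eta> = \<epsilon> / (12 * real p)"
  have \<eta>: "\<eta> > 0" using \<epsilon> p by (simp add: \<eta>_def)
  from hyp[OF \<eta>] obtain n1 where n1: "\<And>n H. n \<ge> n1 \<Longrightarrow> big \<eta> n H \<Longrightarrow> good p D H" by blast
  define n0 where "n0 = max n1 (max p (nat \<lceil>2 * real p * real p / \<epsilon>\<rceil> + 1))"
  have "saving p D n c" if n: "n \<ge> n0" and few: "real (card (c ` nsets {..<n} 2)) + \<epsilon> * real n ^ 2 \<le> real (n choose 2)" for n c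
  proof (rule ccontr)
    assume ns: "\<not> saving p D n c"
    have n': "n \<ge> n1" "p \<le> n" "n > 0" "2 * real p * real p / \<epsilon> < real n"
      using n p unfolding n0_def by (simp, simp, simp, linarith)
    let ?E = "nsets {..<n} 2"
    have finE: "finite ?E" by (rule finite_imp_finite_nsets) simp
    define Q where "Q = c ` ?E"
    define cl where "cl k = {e \<in> ?E. c e = k}" for k
    have fincl: "finite (cl k)" for k using finE by (simp add: cl_def)
    have clp: "card (cl k) < p" for k
    proof (rule ccontr)
      assume "\<not> card (cl k) < p"
      then have "saving p D n c" using p n' D by (intro saving_by_class[of "cl k" n c k]) (auto simp: cl_def)
      then show False using ns by simp
    qed
    define Q2 where "Q2 = {k \<in> Q. card (cl k) \<ge> 2}"
    have finQ: "finite Q" "finite Q2" using finE by (simp_all add: Q_def Q2_def)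
    have "card ?E = (\<Sum>k\<in>Q. card (cl k))"
    proof -
      have "?E = (\<Union>k\<in>Q. cl k)" by (auto simp: Q_def cl_def)
      moreover have "card (\<Union>k\<in>Q. cl k) = (\<Sum>k\<in>Q. card (cl k))"
        using finQ fincl by (intro card_UN_disjoint) (auto simp: cl_def)
      ultimately show ?thesis by simp
    qed
    also have "\<dots> \<le> (\<Sum>k\<in>Q. 1 + (if k \<in> Q2 then p else 0))"
    proof (rule sum_mono)
      fix k assume "k \<in> Q"
      then show "card (cl k) \<le> 1 + (if k \<in> Q2 then p else 0)" using clp[of k] by (auto simp: Q2_def)
    qed
    also have "\<dots> = card Q + card Q2 * p"
    proof -
      have "Q \<inter> {k. k \<in> Q2} = Q2" by (auto simp: Q2_def)
      then show ?thesis using finQ by (simp add: sum.distrib sum.If_cases del: One_nat_def plus_1_eq_Suc)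
    qed
    finally have "n choose 2 \<le> card Q + card Q2 * p" using card_nsets[of "{..<n}" 2] by simp
    then have "real (n choose 2) \<le> real (card Q) + real (card Q2) * real p" by (metis of_nat_add of_nat_le_iff of_nat_mult)
    then have cQ2: "\<epsilon> * real n ^ 2 \<le> real (card Q2) * real p" using few by (simp add: Q_def)
    have "\<exists>a b. a \<in> cl k \<and> b \<in> cl k \<and> a \<noteq> b" if "k \<in> Q2" for k
    proof -
      have "2 \<le> card (cl k)" using that by (simp add: Q2_def)
      then obtain T where "T \<subseteq> cl k" "card T = 2" "finite T" by (rule obtain_subset_with_card_n)
      then show ?thesis by (auto simp: card_2_iff)
    qed
    then obtain a b where ab0: "\<And>k. k \<in> Q2 \<Longrightarrow> a k \<in> cl k \<and> b k \<in> cl k \<and> a k \<noteq> b k" by metis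
    have ab: "a k \<in> ?E \<and> b k \<in> ?E \<and> a k \<noteq> b k \<and> c (a k) = k \<and> c (b k) = k" if "k \<in> Q2" for k
      using ab0[OF that] by (simp add: cl_def)
    have ab2: "finite (a k)" "finite (b k)" "card (a k) = 2" "card (b k) = 2" "a k \<subseteq> {..<n}" "b k \<subseteq> {..<n}" if "k \<in> Q2" for k
      using ab[OF that] by (auto simp: nsets_def)
    define M1 where "M1 = {k \<in> Q2. a k \<inter> b k \<noteq> {}}"
    define M2 where "M2 = {k \<in> Q2. a k \<inter> b k = {}}"
    have finM: "finite M1" "finite M2" using finQ by (simp_all add: M1_def M2_def)
    have "Q2 = M1 \<union> M2" by (auto simp: M1_def M2_def)
    then have cM: "card Q2 \<le> card M1 + card M2" by (simp add: card_Un_le)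

    \<comment> \<open>Monochromatic cherries centred at \<open>x\<close>. Any
      \<open>(p - 1) div 2\<close> of them span at most \<open>p\<close> vertices, centre included,
      and would give a saving; so there are fewer than \<open>p\<close> at each vertex.\<close>
    define thru where "thru x = {k \<in> M1. x \<in> a k \<inter> b k}" for x
    have atp: "card (thru x) < p" for x
    proof (rule ccontr)
      assume "\<not> card (thru x) < p"
      then have "(p - 1) div 2 \<le> card (thru x)" by simp
      then obtain M where M: "M \<subseteq> thru x" "card M = (p - 1) div 2" "finite M" by (rule obtain_subset_with_card_n)
      have MQ: "k \<in> Q2" "x \<in> a k" "x \<in> b k" if "k \<in> M" for k using that M(1) by (auto simp: thru_def M1_def)
      have "(\<Union>k\<in>M. a k \<union> b k) \<subseteq> insert x (\<Union>k\<in>M. (a k - {x}) \<union> (b k - {x}))" by blast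
      then have "card (\<Union>k\<in>M. a k \<union> b k) \<le> card (insert x (\<Union>k\<in>M. (a k - {x}) \<union> (b k - {x})))"
        using M(3) ab2 MQ by (intro card_mono) auto
      also have "\<dots> \<le> Suc (card (\<Union>k\<in>M. (a k - {x}) \<union> (b k - {x})))" by (rule card_insert_le_m1[of "Suc m" for m, unfolded diff_Suc_1]) simp_all
      also have "card (\<Union>k\<in>M. (a k - {x}) \<union> (b k - {x})) \<le> (\<Sum>k\<in>M. card ((a k - {x}) \<union> (b k - {x})))"
        by (rule card_UN_le[OF M(3)])
      also have "\<dots> \<le> (\<Sum>k\<in>M. 2)"
      proof (rule sum_mono)
        fix k assume k: "k \<in> M"
        have "card ((a k - {x}) \<union> (b k - {x})) \<le> card (a k - {x}) + card (b k - {x})" by (rule card_Un_le)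
        also have "\<dots> = 2" using ab2[OF MQ(1)[OF k]] MQ[OF k] by simp
        finally show "card ((a k - {x}) \<union> (b k - {x})) \<le> 2" .
      qed
      also have "Suc (\<Sum>k\<in>M. 2) \<le> p" using M(2) p by simp
      finally have W: "card (\<Union>k\<in>M. a k \<union> b k) \<le> p" by simp
      have "saving p D n c"
        by (rule saving_by_pairs[OF M(3) _ W n'(2)]) (use ab MQ in blast, use M(2) D p in simp)
      then show False using ns by simp
    qed
    have "card M1 \<le> n * p"
    proof -
      have "M1 \<subseteq> (\<Union>x\<in>{..<n}. thru x)"
      proof
        fix k assume k: "k \<in> M1"
        then obtain x where x: "x \<in> a k \<inter> b k" by (auto simp: M1_def)
        have "x < n" using x ab2(5)[of k] k by (auto simp: M1_def)
        then show "k \<in> (\<Union>x\<in>{..<n}. thru x)" using x k by (auto simp: thru_def)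
      qed
      then have "card M1 \<le> card (\<Union>x\<in>{..<n}. thru x)" using finM by (intro card_mono) (auto simp: thru_def)
      also have "\<dots> \<le> (\<Sum>x\<in>{..<n}. card (thru x))" by (rule card_UN_le) simp
      also have "\<dots> \<le> (\<Sum>x\<in>{..<n}. p)" by (rule sum_mono) (use atp in \<open>simp add: less_imp_le\<close>)
      finally show ?thesis by simp
    qed
    then have "real (card M1) \<le> real n * real p" by (metis of_nat_le_iff of_nat_mult)
    moreover have "real (card Q2) \<le> real (card M1) + real (card M2)" using cM by linarith
    ultimately have "real (card Q2) \<le> real n * real p + real (card M2)" by linarith
    then have "real (card Q2) * real p \<le> (real n * real p + real (card M2)) * real p" by (rule mult_right_mono) simp
    then have m2: "\<epsilon> * real n ^ 2 \<le> real n * (real p * real p) + real (card M2) * real p" using cQ2 by (simp add: algebra_simps)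
    have "real n * (real p * real p) \<le> \<epsilon> / 2 * real n ^ 2"
    proof -
      have "real p * real p \<le> \<epsilon> / 2 * real n" using n'(4) \<epsilon> by (simp add: field_simps)
      then have "real n * (real p * real p) \<le> real n * (\<epsilon> / 2 * real n)" by (rule mult_left_mono) simp
      then show ?thesis by (simp add: power2_eq_square algebra_simps)
    qed
    then have m2': "\<epsilon> / 2 * real n ^ 2 \<le> real (card M2) * real p" using m2 by (simp add: algebra_simps)

    define hk where "hk k = a k \<union> b k" for k
    define H where "H = hk ` M2"
    have M2Q: "k \<in> Q2" "a k \<inter> b k = {}" if "k \<in> M2" for k using that by (simp_all add: M2_def)
    have h4: "hk k \<subseteq> {..<n}" "card (hk k) = 4" if "k \<in> M2" for k
      using ab2[OF M2Q(1)[OF that]] M2Q(2)[OF that] by (auto simp: hk_def card_Un_disjoint)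
    \<comment> \<open>Several colours may produce the same 4-set, but each of them occurs on one of
      its six pairs.\<close>
    have "card M2 \<le> 6 * card H"
    proof -
      have "M2 \<subseteq> (\<Union>h\<in>H. c ` nsets h 2)"
      proof
        fix k assume k: "k \<in> M2"
        have "a k \<in> nsets (hk k) 2" using ab2[OF M2Q(1)[OF k]] by (auto simp: nsets_def hk_def)
        moreover have "c (a k) = k" using ab[OF M2Q(1)[OF k]] by simp
        ultimately have "k \<in> c ` nsets (hk k) 2" by (metis imageI)
        then show "k \<in> (\<Union>h\<in>H. c ` nsets h 2)" using k by (auto simp: H_def)
      qed
      moreover have finh: "finite h" "card h = 4" if h: "h \<in> H" for h
      proof -
        show "card h = 4" using h h4 by (auto simp: H_def)
        then show "finite h" using card.infinite by fastforce
      qed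
      ultimately have "card M2 \<le> card (\<Union>h\<in>H. c ` nsets h 2)"
        using finM(2) by (intro card_mono) (auto simp: H_def hk_def M2_def ab2 intro!: finite_imp_finite_nsets)
      also have "\<dots> \<le> (\<Sum>h\<in>H. card (c ` nsets h 2))" using finM by (intro card_UN_le) (simp add: H_def)
      also have "\<dots> \<le> (\<Sum>h\<in>H. 6)"
      proof (rule sum_mono)
        fix h assume h: "h \<in> H"
        have "card (c ` nsets h 2) \<le> card (nsets h 2)" using finh[OF h] by (intro card_image_le finite_imp_finite_nsets)
        also have "\<dots> = 4 choose 2" using card_nsets[of h 2] finh[OF h] by simp
        also have "\<dots> = 6" by (simp add: choose_two)
        finally show "card (c ` nsets h 2) \<le> 6" .
      qed
      finally show ?thesis by simp
    qed
    then have "real (card M2) * real p \<le> 6 * real (card H) * real p" by (intro mult_right_mono) simp_all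
    then have "\<epsilon> / 2 * real n ^ 2 \<le> 6 * real (card H) * real p" using m2' by linarith
    then have cH: "\<eta> * real n ^ 2 \<le> real (card H)" using p by (simp add: \<eta>_def field_simps)
    \<comment> \<open>A hyperedge through \<open>y\<close> contains a chosen edge at
      \<open>y\<close>, say to \<open>z\<close>, and is recovered from the colour of that edge. This
      is why only one pair of edges was kept for each colour.\<close>
    have deg: "card {e \<in> H. y \<in> e} \<le> n" for y
    proof -
      have "{e \<in> H. y \<in> e} \<subseteq> (\<lambda>z. hk (c {y,z})) ` {..<n}"
      proof
        fix h assume "h \<in> {e \<in> H. y \<in> e}"
        then obtain k where k: "k \<in> M2" "h = hk k" "y \<in> a k \<union> b k" by (auto simp: H_def hk_def)
        note q = M2Q(1)[OF k(1)]
        obtain d where d: "y \<in> d" "d \<subseteq> {..<n}" "card d = 2" "c d = k" using k(3) ab2[OF q] ab[OF q] by blast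
        obtain z where z: "d = {y,z}" using d(1,3) by (auto simp: card_2_iff)
        then have "z < n" using d(2) by auto
        then show "h \<in> (\<lambda>z. hk (c {y,z})) ` {..<n}" using d(4) k(2) z by auto
      qed
      then have "card {e \<in> H. y \<in> e} \<le> card ((\<lambda>z. hk (c {y,z})) ` {..<n})" by (intro card_mono) auto
      also have "\<dots> \<le> card {..<n}" by (rule card_image_le) simp
      finally show ?thesis by simp
    qed
    have "H \<subseteq> {e. e \<subseteq> {..<n} \<and> card e = 4}" using h4 by (auto simp: H_def)
    then have "big \<eta> n H" using deg cH unfolding big_def by blast
    from n1[OF n'(1) this] obtain J where J: "J \<subseteq> H" "finite J" "card (\<Union>J) \<le> p" "p \<le> 2 * card J + D"
      unfolding good_def by blast
    have "\<forall>h\<in>J. \<exists>k\<in>M2. hk k = h" using J(1) by (auto simp: H_def)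
    then obtain f where f: "\<And>h. h \<in> J \<Longrightarrow> f h \<in> M2 \<and> hk (f h) = h" by metis
    have inj: "inj_on f J" using f by (metis inj_onI)
    have UJ: "(\<Union>k\<in>f ` J. a k \<union> b k) = \<Union>J"
    proof -
      have "(\<Union>k\<in>f ` J. a k \<union> b k) = (\<Union>h\<in>J. hk (f h))" by (simp add: hk_def)
      also have "\<dots> = \<Union>J" using f by simp
      finally show ?thesis .
    qed
    have "saving p D n c"
    proof (rule saving_by_pairs[where M = "f ` J" and a = a and b = b])
      show "finite (f ` J)" using J(2) by simp
      show "a k \<in> ?E \<and> b k \<in> ?E \<and> a k \<noteq> b k \<and> c (a k) = k \<and> c (b k) = k" if "k \<in> f ` J" for k
        using that f M2Q(1) by (intro ab) blast
      show "card (\<Union>k\<in>f ` J. a k \<union> b k) \<le> p" unfolding UJ by (rule J(3))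
      show "p \<le> n" by (rule n'(2))
      show "p \<le> 2 * card (f ` J) + D" using J(4) card_image[OF inj] by simp
    qed
    then show False using ns by simp
  qed
  then show ?thesis by blast
qed

text \<open>An injective colouring is admissible, so the set whose least element defines
  \<open>g\<close> is not empty.\<close>

lemma g_attained:
  assumes "q \<le> p choose 2"
  shows "\<exists>c. pq_coloring n p q c \<and> card (c ` nsets {..<n} 2) = g n p q" "g n p q \<le> n choose 2"
proof -
  have "finite (nsets {..<n} 2)" by (rule finite_imp_finite_nsets) simp
  then obtain f :: "nat set \<Rightarrow> nat" where f: "inj_on f (nsets {..<n} 2)" using finite_imp_inj_to_nat_seg by metis
  have "pq_coloring n p q f"
    unfolding pq_coloring_def
  proof
    fix S assume S: "S \<in> nsets {..<n} p"
    then have "nsets S 2 \<subseteq> nsets {..<n} 2" by (auto simp: nsets_def)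
    then have "card (f ` nsets S 2) = card (nsets S 2)" by (intro card_image inj_on_subset[OF f])
    also have "\<dots> = p choose 2" using S by (simp add: nsets_def[of "{..<n}"])
    finally show "q \<le> card (f ` nsets S 2)" using assms by simp
  qed
  moreover have "card (f ` nsets {..<n} 2) = n choose 2" using card_image[OF f] card_nsets[of "{..<n}" 2] by simp
  ultimately have ex: "\<exists>c. pq_coloring n p q c \<and> card (c ` nsets {..<n} 2) = n choose 2" by blast
  show "\<exists>c. pq_coloring n p q c \<and> card (c ` nsets {..<n} 2) = g n p q"
    unfolding g_def by (rule LeastI, rule ex)
  show "g n p q \<le> n choose 2" unfolding g_def by (rule Least_le, rule ex)
qed

theorem theorem5p2:
  "\<exists>C::real. \<forall>p q :: nat.
     p \<ge> 4 \<longrightarrow>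
     real_of_int (q_quad p) + C * ln (real p) / ln (ln (real p)) \<le> real q \<longrightarrow>
     q \<le> p choose 2 \<longrightarrow>
     (\<lambda>n. real (n choose 2) - real (g n p q)) \<in> o(\<lambda>n. (real n)\<^sup>2)"
proof (rule exI[of _ 40], intro allI impI)
  fix p q :: nat
  assume p: "p \<ge> 4" and q: "real_of_int (q_quad p) + 40 * ln (real p) / ln (ln (real p)) \<le> real q" and qp: "q \<le> p choose 2"
  define R where "R = ln (real p) / ln (ln (real p))"
  have R: "R \<ge> 1" using ln_ln_bounds[OF p] by (simp add: R_def)
  have half: "real_of_int \<lfloor>real p / 2\<rfloor> \<le> real p / 2" by (rule of_int_floor_le)
  have q1: "real (p choose 2) - real p / 2 + 2 + 40 * R \<le> real q"
    using q half unfolding q_quad_def R_def by simp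
  \<comment> \<open>As \<open>R \<ge> 1\<close>, the two bounds on \<open>q\<close> can hold
    together only if \<open>p / 2 \<ge> 42\<close>.\<close>
  have p22: "22 \<le> p" using q1 R qp by linarith
  obtain K where K: "K \<ge> 4" "3 * p \<le> 2 * fact K" "real K \<le> 5 * R" using ex_fact_bound[OF p] unfolding R_def by blast
  define D where "D = 5 * K + 12"
  have DR: "real D \<le> 37 * R" using K(3) R by (simp add: D_def)
  \<comment> \<open>A saving has \<open>t \<ge> (p - D) / 2\<close>, and
    \<open>D \<le> 37 * R\<close>. So the term \<open>40 * R\<close> in the bound for
    \<open>q\<close> outweighs \<open>D / 2\<close>, and \<open>q + t\<close> would exceed
    \<open>p choose 2\<close>.\<close>
  have noq: "\<not> pq_coloring n p q c" if s: "saving p D n c" for n c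
  proof
    assume c: "pq_coloring n p q c"
    obtain S t where S: "S \<in> nsets {..<n} p" "card (c ` nsets S 2) + t \<le> p choose 2" "p \<le> 2 * t + D"
      using s unfolding saving_def by blast
    have "q + t \<le> p choose 2" using c S(1,2) unfolding pq_coloring_def by fastforce
    then have "real q + real t \<le> real (p choose 2)" by (metis of_nat_add of_nat_le_iff)
    moreover have "real p \<le> 2 * real t + real D" using S(3) by linarith
    ultimately show False using q1 DR R by linarith
  qed
  have hyp: "\<exists>n0. \<forall>n\<ge>n0. \<forall>H. big \<eta> n H \<longrightarrow> good p D H" if "\<eta> > 0" for \<eta> :: real
    by (rule dense_good[OF p22 K(1,2) _ that]) (simp add: D_def)
  show "(\<lambda>n. real (n choose 2) - real (g n p q)) \<in> o(\<lambda>n. (real n)\<^sup>2)"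
  proof (rule landau_o.smallI)
    fix \<epsilon> :: real assume \<epsilon>: "\<epsilon> > 0"
    have "\<exists>n0. \<forall>n\<ge>n0. \<forall>c. real (card (c ` nsets {..<n} 2)) + \<epsilon> * real n ^ 2 \<le> real (n choose 2) \<longrightarrow> saving p D n c"
      by (rule few_colours_saving[OF hyp _ _ \<epsilon>]) (use p in \<open>simp_all add: D_def\<close>)
    then obtain n0 where n0: "\<And>n c. n \<ge> n0 \<Longrightarrow> real (card (c ` nsets {..<n} 2)) + \<epsilon> * real n ^ 2 \<le> real (n choose 2) \<Longrightarrow> saving p D n c"
      by blast
    have "norm (real (n choose 2) - real (g n p q)) \<le> \<epsilon> * norm ((real n)\<^sup>2)" if n: "n \<ge> n0" for n
    proof -
      obtain c where c: "pq_coloring n p q c" "card (c ` nsets {..<n} 2) = g n p q" using g_attained(1)[OF qp] by blast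
      have "\<not> real (card (c ` nsets {..<n} 2)) + \<epsilon> * real n ^ 2 \<le> real (n choose 2)" using n0[OF n] noq c(1) by blast
      moreover have "real (g n p q) \<le> real (n choose 2)" using g_attained(2)[OF qp] by (simp only: of_nat_le_iff)
      ultimately show ?thesis using c(2) by simp
    qed
    then show "\<forall>\<^sub>F n in at_top. norm (real (n choose 2) - real (g n p q)) \<le> \<epsilon> * norm ((real n)\<^sup>2)"
      unfolding eventually_at_top_linorder by blast
  qed
qed

end
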